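(* Suppose $\tau$ is in the limit-circle case at both endpoints $a$ and $b$. Then a relation $S$ is a self-adjoint restriction of $T_{\mathrm{max}}$ if and only if there are matrices $B_a$, $B_b\in\mathbb{C}^{2\times 2}$ with \begin{align*} \operatorname{rank}(B_a | B_b) = 2 \quad\text{and}\quad B_aJB_a^\ast = B_bJB_b^\ast \quad\text{with}\quad J=\begin{pmatrix} 0 & -1 \\ 1 & 0 \end{pmatrix}, \end{align*} such that \begin{align*} S = \left\lbrace f\in T_{\mathrm{max}} \left|\, B_a\begin{pmatrix} BC_{a}^1(f) \\ BC_{a}^2(f) \end{pmatrix} = B_b \begin{pmatrix} BC_{b}^1(f) \\ BC_{b}^2(f) \end{pmatrix}\right. \right\rbrace. \end{align*}
   Context: Let $(a,b)$ be an interval and $\varrho$, $\varsigma$, $\chi$ locally finite real Borel measures on $(a,b)$, with $\varrho$ positive and supported on more than one point, $\operatorname{supp}(\varsigma)=(a,b)$, $\varsigma(\{x\})\varrho(\{x\})=\varsigma(\{x\})\chi(\{x\})=0$ for all $x$, and such that for each gap $(\alpha,\beta)$ of $\operatorname{supp}(\varrho)$ every $f$ in the maximal domain with $f(\alpha-)=f(\beta+)=0$ vanishes on $(\alpha,\beta)$. The differential expression is $\tau f = \frac{d}{d\varrho}\left(-\frac{df}{d\varsigma} + \int f\, d\chi\right)$ on its maximal domain $\mathfrak{D}_\tau$ (left-continuous $f$ locally absolutely continuous w.r.t. $\varsigma$ for which $-\frac{df}{d\varsigma}+\int^x f\,d\chi$ is locally absolutely continuous w.r.t. $\varrho$), with quasi-derivative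 $f^{[1]}=df/d\varsigma$ and Wronskian $W(f,g)=fg^{[1]}-f^{[1]}g$. $T_{\mathrm{max}}=\{(f,\tau f): f\in\mathfrak{D}_\tau,\ f,\tau f\in L^2((a,b);\varrho)\}$ (elements identified with functions in $\mathfrak{D}_\tau$), and $T_{\mathrm{min}}=T_{\mathrm{max}}^\ast$. $\tau$ is in the limit-circle case at an endpoint if for every $z\in\mathbb{C}$ all solutions of $(\tau-z)u=0$ are square integrable w.r.t. $\varrho$ near that endpoint; then $W(f,g)(a)=\lim_{x\downarrow a}W(f,g)(x)$ and $W(f,g)(b)=\lim_{x\uparrow b}W(f,g)(x)$ exist for $f,g\in T_{\mathrm{max}}$. Fix $w_1$, $w_2\in T_{\mathrm{max}}$ with $W(w_1,w_2^\ast)(a)=1$, $W(w_1,w_1^\ast)(a)=W(w_2,w_2^\ast)(a)=0$ and $W(w_1,w_2^\ast)(b)=1$, $W(w_1,w_1^\ast)(b)=W(w_2,w_2^\ast)(b)=0$, and define the linear functionals on $T_{\mathrm{max}}$: $BC_a^1(f)=W(f,w_2^\ast)(a)$, $BC_a^2(f)=W(w_1^\ast,f)(a)$, $BC_b^1(f)=W(f,w_2^\ast)(b)$, $BC_b^2(f)=W(w_1^\ast,f)(b)$. *)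

theory Defs
  imports "HOL-Analysis.Analysis"
begin

definition I_ab :: "ereal \<Rightarrow> ereal \<Rightarrow> real set" where
  "I_ab a b = {x. a < ereal x \<and> ereal x < b}"

definition lf_measure_on :: "ereal \<Rightarrow> ereal \<Rightarrow> real measure \<Rightarrow> bool" where
  "lf_measure_on a b M \<longleftrightarrow> sets M = sets (restrict_space borel (I_ab a b)) \<and>
     (\<forall>\<alpha> \<beta>. a < ereal \<alpha> \<longrightarrow> ereal \<beta> < b \<longrightarrow> emeasure M {\<alpha>..\<beta>} < \<infinity>)"

text \<open>A locally finite real (signed) Borel measure on (a,b), given by its Jordan decomposition
  (positive part, negative part): two mutually singular locally finite positive measures.\<close>
definition signed_on :: "ereal \<Rightarrow> ereal \<Rightarrow> real measure \<times> real measure \<Rightarrow> bool" where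
  "signed_on a b \<mu> \<longleftrightarrow> lf_measure_on a b (fst \<mu>) \<and> lf_measure_on a b (snd \<mu>) \<and>
     (\<exists>A\<in>sets (fst \<mu>). emeasure (fst \<mu>) (space (fst \<mu>) - A) = 0 \<and> emeasure (snd \<mu>) A = 0)"

definition pos :: "real measure \<Rightarrow> real measure \<times> real measure" where
  "pos M = (M, null_measure M)"

definition smeas_pt :: "real measure \<times> real measure \<Rightarrow> real \<Rightarrow> real" where
  "smeas_pt \<mu> x = measure (fst \<mu>) {x} - measure (snd \<mu>) {x}"

definition ssupp :: "ereal \<Rightarrow> ereal \<Rightarrow> real measure \<times> real measure \<Rightarrow> real set" where
  "ssupp a b \<mu> = {x \<in> I_ab a b. \<forall>e>0.
      emeasure (fst \<mu>) (ball x e \<inter> I_ab a b) + emeasure (snd \<mu>) (ball x e \<inter> I_ab a b) \<noteq> 0}"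

text \<open>The integral from c to x with the left-continuous convention:
  int_{[c,x)} if c <= x, and - int_{[x,c)} if x < c.\<close>
definition cint :: "real measure \<Rightarrow> real \<Rightarrow> real \<Rightarrow> (real \<Rightarrow> complex) \<Rightarrow> complex" where
  "cint M c x h = (if c \<le> x then (LINT t:{c..<x}|M. h t) else - (LINT t:{x..<c}|M. h t))"

definition scint :: "real measure \<times> real measure \<Rightarrow> real \<Rightarrow> real \<Rightarrow> (real \<Rightarrow> complex) \<Rightarrow> complex" where
  "scint \<mu> c x h = cint (fst \<mu>) c x h - cint (snd \<mu>) c x h"

definition sloc_int :: "ereal \<Rightarrow> ereal \<Rightarrow> real measure \<times> real measure \<Rightarrow> (real \<Rightarrow> complex) \<Rightarrow> bool" where
  "sloc_int a b \<mu> h \<longleftrightarrow> (\<forall>\<alpha> \<beta>. a < ereal \<alpha> \<longrightarrow> ereal \<beta> < b \<longrightarrow>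
      set_integrable (fst \<mu>) {\<alpha>..\<beta>} h \<and> set_integrable (snd \<mu>) {\<alpha>..\<beta>} h)"

text \<open>f is locally absolutely continuous w.r.t. mu on (a,b) with (a version of the)
  Radon-Nikodym derivative h = df/dmu.\<close>
definition is_deriv :: "ereal \<Rightarrow> ereal \<Rightarrow> real measure \<times> real measure \<Rightarrow> (real \<Rightarrow> complex) \<Rightarrow> (real \<Rightarrow> complex) \<Rightarrow> bool" where
  "is_deriv a b \<mu> f h \<longleftrightarrow> sloc_int a b \<mu> h \<and>
     (\<exists>c\<in>I_ab a b. \<forall>x\<in>I_ab a b. f x = f c + scint \<mu> c x h)"

text \<open>qd_rel f h g: f is left-continuous, locally AC w.r.t. sigma with df/dsigma = h (this
  representative), f is locally chi-integrable, and -h + int^x f dchi is locally AC w.r.t. rho with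
  density g; i.e. f is in the maximal domain, f^[1] = h and tau f = g.\<close>
definition qd_rel :: "ereal \<Rightarrow> ereal \<Rightarrow> real measure \<Rightarrow> real measure \<times> real measure \<Rightarrow> real measure \<times> real measure
    \<Rightarrow> (real \<Rightarrow> complex) \<Rightarrow> (real \<Rightarrow> complex) \<Rightarrow> (real \<Rightarrow> complex) \<Rightarrow> bool" where
  "qd_rel a b \<rho> \<sigma> \<kappa> f h g \<longleftrightarrow>
     (\<forall>x\<in>I_ab a b. (f \<longlongrightarrow> f x) (at_left x)) \<and>
     is_deriv a b \<sigma> f h \<and> sloc_int a b \<kappa> f \<and>
     (\<exists>c\<in>I_ab a b. is_deriv a b (pos \<rho>) (\<lambda>x. - h x + scint \<kappa> c x f) g)"

definition Dtau :: "ereal \<Rightarrow> ereal \<Rightarrow> real measure \<Rightarrow> real measure \<times> real measure \<Rightarrow> real measure \<times> real measure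
    \<Rightarrow> (real \<Rightarrow> complex) \<Rightarrow> bool" where
  "Dtau a b \<rho> \<sigma> \<kappa> f \<longleftrightarrow> (\<exists>h g. qd_rel a b \<rho> \<sigma> \<kappa> f h g)"

text \<open>Quasi-derivative f^[1] = df/dsigma (the unique admissible representative, on (a,b)).\<close>
definition qd :: "ereal \<Rightarrow> ereal \<Rightarrow> real measure \<Rightarrow> real measure \<times> real measure \<Rightarrow> real measure \<times> real measure
    \<Rightarrow> (real \<Rightarrow> complex) \<Rightarrow> real \<Rightarrow> complex" where
  "qd a b \<rho> \<sigma> \<kappa> f x = (THE v. \<exists>h g. qd_rel a b \<rho> \<sigma> \<kappa> f h g \<and> h x = v)"

definition wronski :: "ereal \<Rightarrow> ereal \<Rightarrow> real measure \<Rightarrow> real measure \<times> real measure \<Rightarrow> real measure \<times> real measure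
    \<Rightarrow> (real \<Rightarrow> complex) \<Rightarrow> (real \<Rightarrow> complex) \<Rightarrow> real \<Rightarrow> complex" where
  "wronski a b \<rho> \<sigma> \<kappa> f g x = f x * qd a b \<rho> \<sigma> \<kappa> g x - qd a b \<rho> \<sigma> \<kappa> f x * g x"

definition cnjf :: "(real \<Rightarrow> complex) \<Rightarrow> real \<Rightarrow> complex" where
  "cnjf f = (\<lambda>x. cnj (f x))"

definition L2 :: "real measure \<Rightarrow> (real \<Rightarrow> complex) \<Rightarrow> bool" where
  "L2 \<rho> f \<longleftrightarrow> f \<in> borel_measurable \<rho> \<and> integrable \<rho> (\<lambda>x. (cmod (f x))\<^sup>2)"

definition Tmax :: "ereal \<Rightarrow> ereal \<Rightarrow> real measure \<Rightarrow> real measure \<times> real measure \<Rightarrow> real measure \<times> real measure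
    \<Rightarrow> ((real \<Rightarrow> complex) \<times> (real \<Rightarrow> complex)) set" where
  "Tmax a b \<rho> \<sigma> \<kappa> = {(f, g). (\<exists>h. qd_rel a b \<rho> \<sigma> \<kappa> f h g) \<and> L2 \<rho> f \<and> L2 \<rho> g}"

text \<open>The linear relation in L^2(rho) determined by a set of pairs of representatives.\<close>
definition aecl :: "real measure \<Rightarrow> ((real \<Rightarrow> complex) \<times> (real \<Rightarrow> complex)) set
    \<Rightarrow> ((real \<Rightarrow> complex) \<times> (real \<Rightarrow> complex)) set" where
  "aecl \<rho> R = {(f, g). L2 \<rho> f \<and> L2 \<rho> g \<and>
      (\<exists>(f', g')\<in>R. AE x in \<rho>. f x = f' x \<and> g x = g' x)}"

definition adj :: "real measure \<Rightarrow> ((real \<Rightarrow> complex) \<times> (real \<Rightarrow> complex)) set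
    \<Rightarrow> ((real \<Rightarrow> complex) \<times> (real \<Rightarrow> complex)) set" where
  "adj \<rho> R = {(f, g). L2 \<rho> f \<and> L2 \<rho> g \<and>
      (\<forall>(u, v)\<in>R. (LINT x|\<rho>. v x * cnj (f x)) = (LINT x|\<rho>. u x * cnj (g x)))}"

definition left_end :: "ereal \<Rightarrow> real filter" where
  "left_end a = (if a = -\<infinity> then at_bot else at_right (real_of_ereal a))"

definition right_end :: "ereal \<Rightarrow> real filter" where
  "right_end b = (if b = \<infinity> then at_top else at_left (real_of_ereal b))"

definition LC_left :: "ereal \<Rightarrow> ereal \<Rightarrow> real measure \<Rightarrow> real measure \<times> real measure \<Rightarrow> real measure \<times> real measure \<Rightarrow> bool" where
  "LC_left a b \<rho> \<sigma> \<kappa> \<longleftrightarrow> (\<forall>(z::complex) u. (\<exists>h. qd_rel a b \<rho> \<sigma> \<kappa> u h (\<lambda>x. z * u x)) \<longrightarrow>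
      (\<exists>c\<in>I_ab a b. set_integrable \<rho> {x \<in> I_ab a b. x \<le> c} (\<lambda>x. (cmod (u x))\<^sup>2)))"

definition LC_right :: "ereal \<Rightarrow> ereal \<Rightarrow> real measure \<Rightarrow> real measure \<times> real measure \<Rightarrow> real measure \<times> real measure \<Rightarrow> bool" where
  "LC_right a b \<rho> \<sigma> \<kappa> \<longleftrightarrow> (\<forall>(z::complex) u. (\<exists>h. qd_rel a b \<rho> \<sigma> \<kappa> u h (\<lambda>x. z * u x)) \<longrightarrow>
      (\<exists>c\<in>I_ab a b. set_integrable \<rho> {x \<in> I_ab a b. c \<le> x} (\<lambda>x. (cmod (u x))\<^sup>2)))"

definition W_a :: "ereal \<Rightarrow> ereal \<Rightarrow> real measure \<Rightarrow> real measure \<times> real measure \<Rightarrow> real measure \<times> real measure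
    \<Rightarrow> (real \<Rightarrow> complex) \<Rightarrow> (real \<Rightarrow> complex) \<Rightarrow> complex" where
  "W_a a b \<rho> \<sigma> \<kappa> f g = Lim (left_end a) (wronski a b \<rho> \<sigma> \<kappa> f g)"

definition W_b :: "ereal \<Rightarrow> ereal \<Rightarrow> real measure \<Rightarrow> real measure \<times> real measure \<Rightarrow> real measure \<times> real measure
    \<Rightarrow> (real \<Rightarrow> complex) \<Rightarrow> (real \<Rightarrow> complex) \<Rightarrow> complex" where
  "W_b a b \<rho> \<sigma> \<kappa> f g = Lim (right_end b) (wronski a b \<rho> \<sigma> \<kappa> f g)"

definition Jmat :: "complex^2^2" where
  "Jmat = (\<chi> i j. if i = 1 \<and> j = 2 then -1 else if i = 2 \<and> j = 1 then 1 else 0)"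

definition cadj :: "complex^2^2 \<Rightarrow> complex^2^2" where
  "cadj B = (\<chi> i j. cnj (B $ j $ i))"

definition block :: "complex^2^2 \<Rightarrow> complex^2^2 \<Rightarrow> complex^(2 + 2)^2" where
  "block A B = (\<chi> i j. case j of Inl k \<Rightarrow> A $ i $ k | Inr k \<Rightarrow> B $ i $ k)"

end

theory Submission
  imports Defs
begin

text \<open>Write \<open>\<tau> f = g\<close> as a first-order system for \<open>f\<close> and its quasi-derivative. As \<open>\<sigma>\<close> shares
  no atoms with \<open>\<rho>\<close> and \<open>\<kappa>\<close>, integration by parts has no jump terms; hence the Lagrange identity,
  and Wronskians of \<open>Tmax\<close> have limits at both endpoints. Initial value problems are solved forwards by
  Picard iteration in a suitably weighted norm; constancy of the Wronskian gives uniqueness and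
  continuation to the left. In the limit-circle case all solutions of \<open>\<tau> u = 0\<close> lie in \<open>L\<^sup>2\<close>, and the
  gap condition makes a fundamental system linearly independent there, so its Gram matrix is invertible.
  Therefore the boundary map \<open>\<Gamma> = (BC\<^sub>a, BC\<^sub>b)\<close> is onto \<open>\<complex>\<^sup>4\<close> and the adjoint of its kernel is contained in
  \<open>Tmax\<close>. In the coordinates \<open>\<Gamma>\<close> the Lagrange identity is a nondegenerate skew-Hermitian form, and the
  self-adjoint restrictions are the preimages of the subspaces equal to their own annihilator, which
  are exactly the solution sets of \<open>B\<^sub>a A = B\<^sub>b B\<close> for the matrices in question.\<close>

section \<open>Integration by parts\<close>

text \<open>Two obstacles shape the proof. First, at an endpoint neither \<open>f\<close> nor its
  quasi-derivative need converge; only Wronskians are known to. So every statement about boundary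
  values is an identity between 2x2 determinants, above all the Pluecker relation, that holds at
  each interior point and is passed to the limit; \<open>endform\<close> treats both ends alike.
  Second, boundary values belong to functions, whereas self-adjointness concerns classes modulo
  \<rho>-null sets. The bridge is the Lagrange identity: whether two pairs satisfy the defining
  relation of the adjoint depends on their classes only, and amounts to the vanishing of the
  boundary form at the boundary vectors of any representatives in \<open>Tmax\<close>. The role of
  the minimal relation is taken by the functions whose Wronskian limits with all of
  \<open>Tmax\<close> vanish. They are produced by solving \<tau> f = k with zero data at
  \<open>a\<close> and imposing two moment conditions on \<open>k\<close>, which by Lagrange are the
  data at \<open>b\<close>; the same device replaces multiplication by a cutoff function.\<close>

lemma open_I_ab: "open (I_ab a b)"
proof -
  have "I_ab a b = ereal -` {a<..<b}" by (auto simp: I_ab_def)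
  thus ?thesis using open_ereal_vimage[of "{a<..<b}"] by simp
qed

lemma I_ab_between: "x \<in> I_ab a b \<Longrightarrow> y \<in> I_ab a b \<Longrightarrow> x \<le> t \<Longrightarrow> t \<le> y \<Longrightarrow> t \<in> I_ab a b"
  unfolding I_ab_def by (auto intro: less_le_trans[of a "ereal x" "ereal t"] le_less_trans[of "ereal t"
    "ereal y" b])

lemma Ico_sub_I: "x \<in> I_ab a b \<Longrightarrow> y \<in> I_ab a b \<Longrightarrow> {x..<y} \<subseteq> I_ab a b"
  using I_ab_between[of x a b y] by auto

lemma lf_space: "lf_measure_on a b M \<Longrightarrow> space M = I_ab a b"
  using sets_eq_imp_space_eq[of M "restrict_space borel (I_ab a b)"]
  by (auto simp: lf_measure_on_def space_restrict_space)

lemma lf_sets: "lf_measure_on a b M \<Longrightarrow> A \<in> sets borel \<Longrightarrow> A \<subseteq> I_ab a b \<Longrightarrow> A \<in> sets M"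
  by (auto simp: lf_measure_on_def sets_restrict_space)

lemma lf_finite:
  assumes "lf_measure_on a b M" "x \<in> I_ab a b" "y \<in> I_ab a b"
  shows "emeasure M {x..y} < \<infinity>" "emeasure M {x..<y} < \<infinity>"
proof -
  show 1: "emeasure M {x..y} < \<infinity>" using assms by (auto simp: lf_measure_on_def I_ab_def)
  have "{x..y} \<in> sets M" using I_ab_between[OF assms(2,3)] by (intro lf_sets[OF assms(1)]) auto
  hence "emeasure M {x..<y} \<le> emeasure M {x..y}" by (intro emeasure_mono) auto
  thus "emeasure M {x..<y} < \<infinity>" using 1 by (rule order_le_less_trans)
qed

lemma lf_id: "lf_measure_on a b M \<Longrightarrow> (\<lambda>x. x) \<in> borel_measurable M"
  by (subst measurable_cong_sets[of M "restrict_space borel (I_ab a b)" borel borel])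
     (auto simp: lf_measure_on_def intro: measurable_restrict_space1)

text \<open>Split the product integral over \<open>s < t\<close>, \<open>t < s\<close> and the diagonal, which is null
  because there are no common atoms.\<close>
lemma integral_product_parts:
  fixes M N :: "real measure" and \<phi> \<psi> :: "real \<Rightarrow> complex"
  assumes fM: "finite_measure M" and fN: "finite_measure N"
    and idM: "(\<lambda>x. x) \<in> borel_measurable M" and idN: "(\<lambda>x. x) \<in> borel_measurable N"
    and atoms: "\<And>x. x \<in> space M \<Longrightarrow> x \<in> space N \<Longrightarrow> measure M {x} * measure N {x} = 0"
    and \<phi>: "integrable M \<phi>" and \<psi>: "integrable N \<psi>"
  shows "integrable N (\<lambda>t. (LINT s|M. indicator {..<t} s *\<^sub>R \<phi> s) * \<psi> t)"
    and "integrable M (\<lambda>s. \<phi> s * (LINT t|N. indicator {..<s} t *\<^sub>R \<psi> t))"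
    and "(LINT s|M. \<phi> s) * (LINT t|N. \<psi> t) =
      (LINT t|N. (LINT s|M. indicator {..<t} s *\<^sub>R \<phi> s) * \<psi> t) +
      (LINT s|M. \<phi> s * (LINT t|N. indicator {..<s} t *\<^sub>R \<psi> t))"
proof -
  interpret M: finite_measure M by fact
  interpret N: finite_measure N by fact
  interpret P: pair_sigma_finite M N ..
  note idM[measurable] idN[measurable]
  have [measurable]: "\<phi> \<in> borel_measurable M" "\<psi> \<in> borel_measurable N" using \<phi> \<psi> by auto
  define f where "f = (\<lambda>(s,t). \<phi> s * \<psi> t)"
  have f: "integrable (M \<Otimes>\<^sub>M N) f"
  proof (rule P.Fubini_integrable)
    show "f \<in> borel_measurable (M \<Otimes>\<^sub>M N)" unfolding f_def by measurable
    have "integrable M (\<lambda>x. norm (\<phi> x) * (LINT y|N. norm (\<psi> y)))" using \<phi> by auto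
    thus "integrable M (\<lambda>x. LINT y|N. norm (f (x, y)))" by (simp add: f_def norm_mult)
    show "AE x in M. integrable N (\<lambda>y. f (x, y))" using \<psi> by (simp add: f_def)
  qed
  define f1 where "f1 = (\<lambda>(s::real,t::real). indicator {..<t} s *\<^sub>R (\<phi> s * \<psi> t))"
  define f2 where "f2 = (\<lambda>(s::real,t::real). indicator {..<s} t *\<^sub>R (\<phi> s * \<psi> t))"
  define f3 where "f3 = (\<lambda>(s::real,t::real). indicator {t} s *\<^sub>R (\<phi> s * \<psi> t))"
  have i1: "integrable (M \<Otimes>\<^sub>M N) f1"
  proof (rule Bochner_Integration.integrable_bound[OF f])
    have "{x\<in>space (M \<Otimes>\<^sub>M N). fst x < snd x} \<in> sets (M \<Otimes>\<^sub>M N)" by measurable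
    thus "f1 \<in> borel_measurable (M \<Otimes>\<^sub>M N)" unfolding f1_def
      by (simp add: indicator_def case_prod_beta' if_distrib[of "\<lambda>x. x *\<^sub>R _"] cong: if_cong) measurable
  qed (auto simp: f1_def f_def indicator_def)
  have i2: "integrable (M \<Otimes>\<^sub>M N) f2"
  proof (rule Bochner_Integration.integrable_bound[OF f])
    have "{x\<in>space (M \<Otimes>\<^sub>M N). snd x < fst x} \<in> sets (M \<Otimes>\<^sub>M N)" by measurable
    thus "f2 \<in> borel_measurable (M \<Otimes>\<^sub>M N)" unfolding f2_def
      by (simp add: indicator_def case_prod_beta' if_distrib[of "\<lambda>x. x *\<^sub>R _"] cong: if_cong) measurable
  qed (auto simp: f2_def f_def indicator_def)
  have i3: "integrable (M \<Otimes>\<^sub>M N) f3"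
  proof (rule Bochner_Integration.integrable_bound[OF f])
    have "{x\<in>space (M \<Otimes>\<^sub>M N). fst x = snd x} \<in> sets (M \<Otimes>\<^sub>M N)" by measurable
    thus "f3 \<in> borel_measurable (M \<Otimes>\<^sub>M N)" unfolding f3_def
      by (simp add: indicator_def case_prod_beta' if_distrib[of "\<lambda>x. x *\<^sub>R _"] cong: if_cong) measurable
  qed (auto simp: f3_def f_def indicator_def)
  have sp: "f x = f1 x + f2 x + f3 x" for x
    by (cases x) (auto simp: f_def f1_def f2_def f3_def indicator_def)
  have e0: "integral\<^sup>L (M \<Otimes>\<^sub>M N) f = (LINT s|M. \<phi> s) * (LINT t|N. \<psi> t)"
    using P.integral_fst'[OF f] by (simp add: f_def)
  have "(\<lambda>y. \<integral>x. f1 (x, y) \<partial>M) = (\<lambda>t. (LINT s|M. indicator {..<t} s *\<^sub>R \<phi> s) * \<psi> t)"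
    by (simp add: f1_def flip: integral_mult_left_zero)
  moreover have i1': "integrable (M \<Otimes>\<^sub>M N) (\<lambda>(x,y). f1 (x, y))" using i1 by simp
  ultimately have e1: "integral\<^sup>L (M \<Otimes>\<^sub>M N) f1 = (LINT t|N. (LINT s|M. indicator {..<t} s *\<^sub>R \<phi> s) * \<psi> t)"
    and j1: "integrable N (\<lambda>t. (LINT s|M. indicator {..<t} s *\<^sub>R \<phi> s) * \<psi> t)"
    using P.integral_snd[OF i1'] P.integrable_snd[OF i1'] by simp_all
  have "(\<lambda>x. \<integral>y. f2 (x, y) \<partial>N) = (\<lambda>s. \<phi> s * (LINT t|N. indicator {..<s} t *\<^sub>R \<psi> t))"
    by (simp add: f2_def flip: integral_mult_right_zero)
  hence e2: "integral\<^sup>L (M \<Otimes>\<^sub>M N) f2 = (LINT s|M. \<phi> s * (LINT t|N. indicator {..<s} t *\<^sub>R \<psi> t))"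
    and j2: "integrable M (\<lambda>s. \<phi> s * (LINT t|N. indicator {..<s} t *\<^sub>R \<psi> t))"
    using P.integral_fst'[OF i2] P.integrable_fst'[OF i2] by simp_all
  have i3': "integrable (M \<Otimes>\<^sub>M N) (\<lambda>(x,y). f3 (x, y))" using i3 by simp
  have sing: "{x} \<in> sets N" if "x \<in> space N" for x
    using measurable_sets[OF idN, of "{x}"] that by (auto simp: Int_absorb2 vimage_def)
  \<comment> \<open>A finite measure has only countably many atoms, and each atom of
    \<open>M\<close> is \<open>N\<close>-null. So for \<open>N\<close>-almost every \<open>t\<close>
    the slice of the diagonal at \<open>t\<close> carries no mass.\<close>
  have "AE t in N. measure M {t} = 0"
  proof (rule AE_I')
    have c: "countable ({x. measure M {x} \<noteq> 0} \<inter> space N)" using M.countable_support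
      by (rule countable_Int1)
    have "(\<Union>x\<in>{x. measure M {x} \<noteq> 0} \<inter> space N. {x}) \<in> null_sets N"
    proof (rule null_sets_UN'[OF c])
      fix x assume x: "x \<in> {x. measure M {x} \<noteq> 0} \<inter> space N"
      hence "{x} \<in> sets M" using measure_notin_sets by force
      hence "x \<in> space M" using sets.sets_into_space by blast
      hence "measure N {x} = 0" using atoms[of x] x by auto
      thus "{x} \<in> null_sets N" using sing[of x] x by (simp add: null_sets_def N.emeasure_eq_measure)
    qed
    thus "({x. measure M {x} \<noteq> 0} \<inter> space N) \<in> null_sets N" by simp
  qed auto
  hence "AE t in N. (\<integral>x. f3 (x, t) \<partial>M) = 0"
  proof (rule AE_mp, intro AE_I2 impI)
    fix t assume t: "measure M {t} = 0"
    have eq: "(\<lambda>x. f3 (x,t)) = (\<lambda>x. indicator {t} x *\<^sub>R (\<phi> t * \<psi> t))"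
    proof (rule ext)
      fix x show "f3 (x,t) = indicator {t} x *\<^sub>R (\<phi> t * \<psi> t)"
        by (cases "x = t") (simp_all add: f3_def)
    qed
    have st: "{t} \<inter> space M \<in> sets M"
      using measurable_sets[OF idM, of "{t}"] by simp
    have int: "integrable M (indicator {t} :: real \<Rightarrow> real)"
      using st by (subst integrable_indicator_iff) (simp_all add: M.emeasure_eq_measure Int_commute)
    have "measure M ({t} \<inter> space M) = 0" using t by (cases "t \<in> space M") auto
    hence "(LINT x|M. indicator {t} x *\<^sub>R (\<phi> t * \<psi> t)) = 0"
      using int by (subst integral_scaleR_left) (simp_all add: Int_commute)
    thus "(\<integral>x. f3 (x, t) \<partial>M) = 0" unfolding eq .
  qed
  hence "(LINT t|N. (\<integral>x. f3 (x, t) \<partial>M)) = 0" by (rule integral_eq_zero_AE)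
  hence e3: "integral\<^sup>L (M \<Otimes>\<^sub>M N) f3 = 0"
    using P.integral_snd[OF i3'] by simp
  have "integral\<^sup>L (M \<Otimes>\<^sub>M N) f = integral\<^sup>L (M \<Otimes>\<^sub>M N) f1 + integral\<^sup>L (M \<Otimes>\<^sub>M N) f2
    + integral\<^sup>L (M \<Otimes>\<^sub>M N) f3"
  proof -
    have "f = (\<lambda>x. f1 x + f2 x + f3 x)" using sp by (rule ext)
    hence "integral\<^sup>L (M \<Otimes>\<^sub>M N) f = integral\<^sup>L (M \<Otimes>\<^sub>M N) (\<lambda>x. f1 x + f2 x + f3 x)" by (rule arg_cong)
    also have "\<dots> = integral\<^sup>L (M \<Otimes>\<^sub>M N) (\<lambda>x. f1 x + f2 x) + integral\<^sup>L (M \<Otimes>\<^sub>M N) f3"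
      by (intro Bochner_Integration.integral_add Bochner_Integration.integrable_add i1 i2 i3)
    also have "integral\<^sup>L (M \<Otimes>\<^sub>M N) (\<lambda>x. f1 x + f2 x) = integral\<^sup>L (M \<Otimes>\<^sub>M N) f1 + integral\<^sup>L (M \<Otimes>\<^sub>M N) f2"
      by (intro Bochner_Integration.integral_add i1 i2)
    finally show ?thesis .
  qed
  thus "(LINT s|M. \<phi> s) * (LINT t|N. \<psi> t) =
      (LINT t|N. (LINT s|M. indicator {..<t} s *\<^sub>R \<phi> s) * \<psi> t) +
      (LINT s|M. \<phi> s * (LINT t|N. indicator {..<s} t *\<^sub>R \<psi> t))"
    by (simp only: e0 e1 e2 e3 add_0_right)
  show "integrable N (\<lambda>t. (LINT s|M. indicator {..<t} s *\<^sub>R \<phi> s) * \<psi> t)" by (rule j1)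
  show "integrable M (\<lambda>s. \<phi> s * (LINT t|N. indicator {..<s} t *\<^sub>R \<psi> t))" by (rule j2)
qed

text \<open>On \<open>[p, q)\<close> both measures are finite, so the product formula applies to the
  restrictions. With half-open intervals the two inner integrals are over \<open>s < t\<close> and
  \<open>t < s\<close>, and only the diagonal is left out.\<close>

lemma lf_parts:
  fixes \<phi> \<psi> :: "real \<Rightarrow> complex"
  assumes M: "lf_measure_on a b M" and N: "lf_measure_on a b N"
    and p: "p \<in> I_ab a b" and q: "q \<in> I_ab a b"
    and atoms: "\<And>x. x \<in> I_ab a b \<Longrightarrow> measure M {x} * measure N {x} = 0"
    and \<phi>: "set_integrable M {p..<q} \<phi>" and \<psi>: "set_integrable N {p..<q} \<psi>"
  shows "set_integrable N {p..<q} (\<lambda>t. (LINT s:{p..<t}|M. \<phi> s) * \<psi> t)"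
    and "set_integrable M {p..<q} (\<lambda>s. \<phi> s * (LINT t:{p..<s}|N. \<psi> t))"
    and "(LINT s:{p..<q}|M. \<phi> s) * (LINT t:{p..<q}|N. \<psi> t) =
      (LINT t:{p..<q}|N. (LINT s:{p..<t}|M. \<phi> s) * \<psi> t) +
      (LINT s:{p..<q}|M. \<phi> s * (LINT t:{p..<s}|N. \<psi> t))"
proof -
  let ?K = "{p..<q}"
  let ?M = "restrict_space M ?K" and ?N = "restrict_space N ?K"
  have K: "?K \<subseteq> I_ab a b" by (rule Ico_sub_I[OF p q])
  have KM: "?K \<in> sets M" by (rule lf_sets[OF M _ K]) simp
  have KN: "?K \<in> sets N" by (rule lf_sets[OF N _ K]) simp
  have KM': "?K \<inter> space M \<in> sets M" and KN': "?K \<inter> space N \<in> sets N" using KM KN by auto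
  have spM: "space ?M = ?K" using K lf_space[OF M] by (auto simp: space_restrict_space)
  have spN: "space ?N = ?K" using K lf_space[OF N] by (auto simp: space_restrict_space)
  have fM: "finite_measure ?M" using lf_finite[OF M p q]
    by (intro finite_measureI) (simp add: spM emeasure_restrict_space[OF KM'])
  have fN: "finite_measure ?N" using lf_finite[OF N p q]
    by (intro finite_measureI) (simp add: spN emeasure_restrict_space[OF KN'])
  have idM: "(\<lambda>x. x) \<in> borel_measurable ?M" using lf_id[OF M] by (rule measurable_restrict_space1)
  have idN: "(\<lambda>x. x) \<in> borel_measurable ?N" using lf_id[OF N] by (rule measurable_restrict_space1)
  have at: "measure ?M {x} * measure ?N {x} = 0" if "x \<in> space ?M" "x \<in> space ?N" for x
    using atoms[of x] that K spM by
      (simp add: measure_restrict_space[OF KM'] measure_restrict_space[OF KN'] subset_iff)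
  have \<phi>': "integrable ?M \<phi>" using \<phi> by (simp add: integrable_restrict_space[OF KM'] set_integrable_def)
  have \<psi>': "integrable ?N \<psi>" using \<psi> by (simp add: integrable_restrict_space[OF KN'] set_integrable_def)
  have eM: "(LINT s|?M. indicator {..<t} s *\<^sub>R \<phi> s) = (LINT s:{p..<t}|M. \<phi> s)" if "t \<in> ?K" for t
    unfolding integral_restrict_space[OF KM'] set_lebesgue_integral_def using that
    by (intro Bochner_Integration.integral_cong) (auto simp: indicator_def)
  have eN: "(LINT s|?N. indicator {..<t} s *\<^sub>R \<psi> s) = (LINT s:{p..<t}|N. \<psi> s)" if "t \<in> ?K" for t
    unfolding integral_restrict_space[OF KN'] set_lebesgue_integral_def using that
    by (intro Bochner_Integration.integral_cong) (auto simp: indicator_def)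
  note P = integral_product_parts[OF fM fN idM idN at \<phi>' \<psi>']
  have c1: "indicator ?K t *\<^sub>R ((LINT s|?M. indicator {..<t} s *\<^sub>R \<phi> s) * \<psi> t) =
      indicator ?K t *\<^sub>R ((LINT s:{p..<t}|M. \<phi> s) * \<psi> t)" for t
    using eM by (auto simp: indicator_def)
  have c2: "indicator ?K t *\<^sub>R (\<phi> t * (LINT s|?N. indicator {..<t} s *\<^sub>R \<psi> s)) =
      indicator ?K t *\<^sub>R (\<phi> t * (LINT s:{p..<t}|N. \<psi> s))" for t
    using eN by (auto simp: indicator_def)
  show "set_integrable N ?K (\<lambda>t. (LINT s:{p..<t}|M. \<phi> s) * \<psi> t)"
    using P(1) unfolding integrable_restrict_space[OF KN'] set_integrable_def c1 by simp
  show "set_integrable M ?K (\<lambda>s. \<phi> s * (LINT t:{p..<s}|N. \<psi> t))"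
    using P(2) unfolding integrable_restrict_space[OF KM'] set_integrable_def c2 by simp
  show "(LINT s:{p..<q}|M. \<phi> s) * (LINT t:{p..<q}|N. \<psi> t) =
      (LINT t:{p..<q}|N. (LINT s:{p..<t}|M. \<phi> s) * \<psi> t) +
      (LINT s:{p..<q}|M. \<phi> s * (LINT t:{p..<s}|N. \<psi> t))"
    using P(3) unfolding integral_restrict_space[OF KM', of \<phi>] integral_restrict_space[OF KN', of \<psi>]
      integral_restrict_space[OF KM', of "\<lambda>s. \<phi> s * (LINT t|?N. indicator {..<s} t *\<^sub>R \<psi> t)"]
      integral_restrict_space[OF KN', of "\<lambda>t. (LINT s|?M. indicator {..<t} s *\<^sub>R \<phi> s) * \<psi> t"]
      c1 c2 by (simp add: set_lebesgue_integral_def)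
qed

section \<open>Integrals against signed measures over half-open intervals\<close>

definition lfs :: "ereal \<Rightarrow> ereal \<Rightarrow> real measure \<times> real measure \<Rightarrow> bool" where
  "lfs a b \<mu> \<longleftrightarrow> lf_measure_on a b (fst \<mu>) \<and> lf_measure_on a b (snd \<mu>)"

definition sI :: "real measure \<times> real measure \<Rightarrow> real \<Rightarrow> real \<Rightarrow> (real \<Rightarrow> complex) \<Rightarrow> bool" where
  "sI \<mu> p q h \<longleftrightarrow> set_integrable (fst \<mu>) {p..<q} h \<and> set_integrable (snd \<mu>) {p..<q} h"

text \<open>Unlike \<open>scint\<close> this is not oriented: for \<open>q < p\<close> the interval
  is empty and the value is 0. Additivity in the interval is therefore stated for ordered
  points.\<close>

definition sint :: "real measure \<times> real measure \<Rightarrow> real \<Rightarrow> real \<Rightarrow> (real \<Rightarrow> complex) \<Rightarrow> complex" where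
  "sint \<mu> p q h = (LINT t:{p..<q}|fst \<mu>. h t) - (LINT t:{p..<q}|snd \<mu>. h t)"

lemma lfs_Ico: "lfs a b \<mu> \<Longrightarrow> p \<in> I_ab a b \<Longrightarrow> q \<in> I_ab a b \<Longrightarrow> {p..<q} \<in> sets (fst \<mu>) \<and> {p..<q} \<in> sets (snd \<mu>)"
  unfolding lfs_def using lf_sets[of a b "fst \<mu>" "{p..<q}"] lf_sets[of a b "snd \<mu>" "{p..<q}"] Ico_sub_I[of p
    a b q] by simp

lemma sI_add: "sI \<mu> p q f \<Longrightarrow> sI \<mu> p q g \<Longrightarrow> sI \<mu> p q (\<lambda>x. f x + g x)"
  by (simp add: sI_def set_integral_add)

lemma sI_diff: "sI \<mu> p q f \<Longrightarrow> sI \<mu> p q g \<Longrightarrow> sI \<mu> p q (\<lambda>x. f x - g x)"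
  by (simp add: sI_def set_integral_diff)

lemma sI_cmult: "sI \<mu> p q f \<Longrightarrow> sI \<mu> p q (\<lambda>x. c * f x)"
  by (simp add: sI_def)

lemma sint_add: "sI \<mu> p q f \<Longrightarrow> sI \<mu> p q g \<Longrightarrow> sint \<mu> p q (\<lambda>x. f x + g x) = sint \<mu> p q f + sint \<mu> p q g"
  by (simp add: sI_def sint_def set_integral_add)

lemma sint_diff: "sI \<mu> p q f \<Longrightarrow> sI \<mu> p q g \<Longrightarrow> sint \<mu> p q (\<lambda>x. f x - g x) = sint \<mu> p q f - sint \<mu> p q g"
  by (simp add: sI_def sint_def set_integral_diff)

lemma sint_cmult: "sint \<mu> p q (\<lambda>x. c * f x) = c * sint \<mu> p q f"
  by (simp add: sint_def algebra_simps)

lemma sint_cnj: "sint \<mu> p q (\<lambda>x. cnj (f x)) = cnj (sint \<mu> p q f)"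
  by (simp add: sint_def set_lebesgue_integral_def flip: integral_cnj complex_cnj_scaleR)

lemma sI_cnj: "sI \<mu> p q f \<Longrightarrow> sI \<mu> p q (\<lambda>x. cnj (f x))"
  unfolding sI_def set_integrable_def by (simp flip: complex_cnj_scaleR)

lemma sI_cong: "(\<And>x. p \<le> x \<Longrightarrow> x < q \<Longrightarrow> f x = g x) \<Longrightarrow> sI \<mu> p q f = sI \<mu> p q g"
  unfolding sI_def set_integrable_def
  by (intro arg_cong2[of _ _ _ _ "(\<and>)"] Bochner_Integration.integrable_cong) (auto simp: indicator_def)

lemma sint_cong: "(\<And>x. p \<le> x \<Longrightarrow> x < q \<Longrightarrow> f x = g x) \<Longrightarrow> sint \<mu> p q f = sint \<mu> p q g"
  unfolding sint_def set_lebesgue_integral_def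
  by (intro arg_cong2[of _ _ _ _ "(-)"] Bochner_Integration.integral_cong) (auto simp: indicator_def)

lemma sint_refl [simp]: "sint \<mu> p p h = 0"
  by (simp add: sint_def set_lebesgue_integral_def)

lemma sI_subset:
  assumes "lfs a b \<mu>" "p' \<in> I_ab a b" "q' \<in> I_ab a b" "sI \<mu> p q h" "p \<le> p'" "q' \<le> q"
  shows "sI \<mu> p' q' h"
proof -
  have "{p'..<q'} \<subseteq> {p..<q}" using assms by auto
  thus ?thesis using assms(4) lfs_Ico[OF assms(1-3)] unfolding sI_def
    by (blast intro: set_integrable_subset)
qed

lemma sint_split:
  assumes "lfs a b \<mu>" "p \<in> I_ab a b" "r \<in> I_ab a b" "q \<in> I_ab a b" "p \<le> r" "r \<le> q" "sI \<mu> p q h"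
  shows "sint \<mu> p q h = sint \<mu> p r h + sint \<mu> r q h"
proof -
  have e: "{p..<q} = {p..<r} \<union> {r..<q}" "{p..<r} \<inter> {r..<q} = {}" using assms by auto
  have 1: "sI \<mu> p r h" and 2: "sI \<mu> r q h" using assms by (auto intro: sI_subset)
  show ?thesis using 1 2 unfolding sint_def sI_def e(1)
    by (simp add: set_integral_Un[OF e(2)])
qed

text \<open>Formulated for the Jordan parts, because the product formula is applied to all four
  pairs of parts.\<close>

definition no_common_atoms ::
  "ereal \<Rightarrow> ereal \<Rightarrow> real measure \<times> real measure \<Rightarrow> real measure \<times> real measure \<Rightarrow> bool" where
  "no_common_atoms a b \<mu> \<nu> \<longleftrightarrow> (\<forall>x\<in>I_ab a b. (measure (fst \<mu>) {x} = 0 \<and> measure (snd \<mu>) {x} = 0) \<or>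
      (measure (fst \<nu>) {x} = 0 \<and> measure (snd \<nu>) {x} = 0))"

lemma sint_parts:
  assumes \<mu>: "lfs a b \<mu>" and \<nu>: "lfs a b \<nu>" and na: "no_common_atoms a b \<mu> \<nu>"
    and p: "p \<in> I_ab a b" and q: "q \<in> I_ab a b"
    and \<phi>: "sI \<mu> p q \<phi>" and \<psi>: "sI \<nu> p q \<psi>"
  shows "sI \<nu> p q (\<lambda>t. sint \<mu> p t \<phi> * \<psi> t)" "sI \<mu> p q (\<lambda>t. \<phi> t * sint \<nu> p t \<psi>)"
    "sint \<mu> p q \<phi> * sint \<nu> p q \<psi> = sint \<nu> p q (\<lambda>t. sint \<mu> p t \<phi> * \<psi> t)
      + sint \<mu> p q (\<lambda>t. \<phi> t * sint \<nu> p t \<psi>)"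
proof -
  have m: "lf_measure_on a b (fst \<mu>)" "lf_measure_on a b (snd \<mu>)" "lf_measure_on a b (fst \<nu>)"
    "lf_measure_on a b (snd \<nu>)"
    using \<mu> \<nu> by (auto simp: lfs_def)
  have i: "set_integrable (fst \<mu>) {p..<q} \<phi>" "set_integrable (snd \<mu>) {p..<q} \<phi>"
      "set_integrable (fst \<nu>) {p..<q} \<psi>" "set_integrable (snd \<nu>) {p..<q} \<psi>"
    using \<phi> \<psi> by (auto simp: sI_def)
  have at: "measure (fst \<mu>) {x} * measure (fst \<nu>) {x} = 0" "measure (fst \<mu>) {x} * measure (snd \<nu>) {x} = 0"
    "measure (snd \<mu>) {x} * measure (fst \<nu>) {x} = 0" "measure (snd \<mu>) {x} * measure (snd \<nu>) {x} = 0"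
    if "x \<in> I_ab a b" for x using na that by (auto simp: no_common_atoms_def)
  note P1 = lf_parts[OF m(1) m(3) p q at(1) i(1) i(3)]
  note P2 = lf_parts[OF m(1) m(4) p q at(2) i(1) i(4)]
  note P3 = lf_parts[OF m(2) m(3) p q at(3) i(2) i(3)]
  note P4 = lf_parts[OF m(2) m(4) p q at(4) i(2) i(4)]
  have s1: "sint \<mu> p t \<phi> * \<psi> t = (LINT s:{p..<t}|fst \<mu>. \<phi> s) * \<psi> t - (LINT s:{p..<t}|snd \<mu>. \<phi> s) * \<psi> t"
    for t
    by (simp add: sint_def algebra_simps)
  have s2: "\<phi> t * sint \<nu> p t \<psi> = \<phi> t * (LINT s:{p..<t}|fst \<nu>. \<psi> s) - \<phi> t * (LINT s:{p..<t}|snd \<nu>. \<psi> s)"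
    for t
    by (simp add: sint_def algebra_simps)
  show "sI \<nu> p q (\<lambda>t. sint \<mu> p t \<phi> * \<psi> t)"
    unfolding s1 sI_def using P1(1) P2(1) P3(1) P4(1) by (simp add: set_integral_diff)
  show "sI \<mu> p q (\<lambda>t. \<phi> t * sint \<nu> p t \<psi>)"
    unfolding s2 sI_def using P1(2) P2(2) P3(2) P4(2) by (simp add: set_integral_diff)
  show "sint \<mu> p q \<phi> * sint \<nu> p q \<psi> = sint \<nu> p q (\<lambda>t. sint \<mu> p t \<phi> * \<psi> t)
    + sint \<mu> p q (\<lambda>t. \<phi> t * sint \<nu> p t \<psi>)"
    unfolding s1 s2 unfolding sint_def
    using P1(1,2) P2(1,2) P3(1,2) P4(1,2) P1(3) P2(3) P3(3) P4(3)
    by (simp add: set_integral_diff algebra_simps)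
qed

section \<open>The first-order system and the Lagrange identity\<close>

lemma lf_null_measure: "lf_measure_on a b M \<Longrightarrow> lf_measure_on a b (null_measure M)"
  by (simp add: lf_measure_on_def)

lemma lfs_pos: "lf_measure_on a b M \<Longrightarrow> lfs a b (pos M)"
  by (simp add: lfs_def pos_def lf_null_measure)

lemma set_integrable_null_measure:
  fixes h :: "real \<Rightarrow> complex"
  assumes "set_integrable M A h" shows "set_integrable (null_measure M) A h"
proof -
  have "(\<lambda>x. indicator A x *\<^sub>R h x) \<in> borel_measurable (null_measure M)"
    using assms by (subst measurable_cong_sets[of "null_measure M" M borel borel])
      (auto simp: set_integrable_def)
  thus ?thesis unfolding set_integrable_def
    by (intro integrableI_bounded) (auto simp: nn_integral_null_measure)
qed

lemma set_integral_null_measure: "(LINT x:A|null_measure M. h x) = (0::complex)"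
  unfolding set_lebesgue_integral_def
  by (rule integral_eq_zero_AE) (auto intro!: AE_I[where N="space M"])

lemma sI_pos: "sI (pos M) p q h \<longleftrightarrow> set_integrable M {p..<q} h"
  by (auto simp: sI_def pos_def set_integrable_null_measure)

lemma sint_pos: "sint (pos M) p q h = (LINT t:{p..<q}|M. h t)"
  by (simp add: sint_def pos_def set_integral_null_measure)

text \<open>By mutual singularity a point is charged by at most one of the two parts, so the
  difference of the point masses cannot vanish by cancellation.\<close>

lemma signed_on_atom:
  assumes \<mu>: "signed_on a b \<mu>" and x: "x \<in> I_ab a b" and z: "smeas_pt \<mu> x = 0"
  shows "measure (fst \<mu>) {x} = 0 \<and> measure (snd \<mu>) {x} = 0"
proof -
  from \<mu> obtain A where l: "lf_measure_on a b (fst \<mu>)" "lf_measure_on a b (snd \<mu>)" and A: "A\<in>sets (fst \<mu>)"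
    "emeasure (fst \<mu>) (space (fst \<mu>) - A) = 0" "emeasure (snd \<mu>) A = 0"
    unfolding signed_on_def by blast
  have sp: "space (fst \<mu>) = I_ab a b" using lf_space[OF l(1)] .
  have s: "sets (fst \<mu>) = sets (snd \<mu>)" using l by (simp add: lf_measure_on_def)
  have "measure (fst \<mu>) {x} = 0 \<or> measure (snd \<mu>) {x} = 0"
  proof (cases "x \<in> A")
    case True
    have "emeasure (snd \<mu>) {x} \<le> emeasure (snd \<mu>) A" using True A(1) s by (intro emeasure_mono) auto
    thus ?thesis using A(3) by (simp add: measure_def)
  next
    case False
    have "emeasure (fst \<mu>) {x} \<le> emeasure (fst \<mu>) (space (fst \<mu>) - A)"
      using False A(1) x unfolding sp[symmetric] by (intro emeasure_mono) auto
    thus ?thesis using A(2) by (simp add: measure_def)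
  qed
  thus ?thesis using z by (auto simp: smeas_pt_def)
qed

lemma no_common_atoms_signed:
  assumes "signed_on a b \<mu>" "signed_on a b \<nu>" "\<forall>x\<in>I_ab a b. smeas_pt \<mu> x * smeas_pt \<nu> x = 0"
  shows "no_common_atoms a b \<mu> \<nu>"
  unfolding no_common_atoms_def
proof
  fix x assume x: "x \<in> I_ab a b"
  hence "smeas_pt \<mu> x = 0 \<or> smeas_pt \<nu> x = 0" using assms(3) by auto
  thus "(measure (fst \<mu>) {x} = 0 \<and> measure (snd \<mu>) {x} = 0) \<or> (measure (fst \<nu>) {x} = 0 \<and> measure (snd \<nu>) {x}
    = 0)"
    using signed_on_atom[OF assms(1) x] signed_on_atom[OF assms(2) x] by argo
qed

lemma signed_on_pos: "lf_measure_on a b M \<Longrightarrow> signed_on a b (pos M)"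
  unfolding signed_on_def pos_def
  by (auto simp: lf_null_measure intro!: bexI[of _ "space M"])

lemma smeas_pt_pos: "smeas_pt (pos M) x = measure M {x}"
  by (simp add: smeas_pt_def pos_def measure_def)

section \<open>Solutions of the first-order system\<close>

locale sturm_liouville =
  fixes a b :: ereal and \<rho> :: "real measure" and \<sigma> \<kappa> :: "real measure \<times> real measure"
  assumes ab: "a < b"
    and rho: "lf_measure_on a b \<rho>"
    and sig: "signed_on a b \<sigma>"
    and chi: "signed_on a b \<kappa>"
    and sig_supp: "ssupp a b \<sigma> = I_ab a b"
    and pts_rho: "\<forall>x\<in>I_ab a b. smeas_pt \<sigma> x * measure \<rho> {x} = 0"
    and pts_chi: "\<forall>x\<in>I_ab a b. smeas_pt \<sigma> x * smeas_pt \<kappa> x = 0"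
begin

abbreviation "I \<equiv> I_ab a b"

lemma lfs_sig: "lfs a b \<sigma>" and lfs_chi: "lfs a b \<kappa>" and lfs_rho: "lfs a b (pos \<rho>)"
  using sig chi rho by (auto simp: lfs_def signed_on_def lfs_pos pos_def lf_null_measure)

lemma nca_chi: "no_common_atoms a b \<sigma> \<kappa>" and nca_rho: "no_common_atoms a b \<sigma> (pos \<rho>)"
  using no_common_atoms_signed[OF sig chi pts_chi]
    no_common_atoms_signed[OF sig signed_on_pos[OF rho]] pts_rho by (auto simp: smeas_pt_pos)

text \<open>The first-order system for \<open>(f, f\<^sup>[\<^sup>1\<^sup>])\<close> with \<open>\<tau> f = g\<close>, restricted to a subinterval \<open>J\<close>.\<close>
definition qsol :: "real set \<Rightarrow> (real \<Rightarrow> complex) \<Rightarrow> (real \<Rightarrow> complex) \<Rightarrow> (real \<Rightarrow> complex) \<Rightarrow> bool" where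
  "qsol J f h g \<longleftrightarrow> (\<forall>x\<in>J. \<forall>y\<in>J. x \<le> y \<longrightarrow> sI \<sigma> x y h \<and> sI \<kappa> x y f \<and> sI (pos \<rho>) x y g \<and>
     f y = f x + sint \<sigma> x y h \<and> h y = h x + sint \<kappa> x y f - sint (pos \<rho>) x y g)"

lemma qsolD:
  assumes "qsol J f h g" "x \<in> J" "y \<in> J" "x \<le> y"
  shows "sI \<sigma> x y h" "sI \<kappa> x y f" "sI (pos \<rho>) x y g" "f y = f x + sint \<sigma> x y h"
    "h y = h x + sint \<kappa> x y f - sint (pos \<rho>) x y g"
  using assms unfolding qsol_def by blast+

lemma qsol_mono: "qsol J f h g \<Longrightarrow> J' \<subseteq> J \<Longrightarrow> qsol J' f h g"
  unfolding qsol_def by blast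

lemma qsolI:
  assumes "\<And>x y. x \<in> J \<Longrightarrow> y \<in> J \<Longrightarrow> x \<le> y \<Longrightarrow> sI \<sigma> x y h \<and> sI \<kappa> x y f \<and> sI (pos \<rho>) x y g \<and>
     f y = f x + sint \<sigma> x y h \<and> h y = h x + sint \<kappa> x y f - sint (pos \<rho>) x y g"
  shows "qsol J f h g"
  using assms unfolding qsol_def by blast

lemma qsol_add:
  assumes 1: "qsol J f h g" and 2: "qsol J f' h' g'"
  shows "qsol J (\<lambda>x. f x + f' x) (\<lambda>x. h x + h' x) (\<lambda>x. g x + g' x)"
proof (rule qsolI)
  fix x y assume xy: "x \<in> J" "y \<in> J" "x \<le> y"
  show "sI \<sigma> x y (\<lambda>x. h x + h' x) \<and> sI \<kappa> x y (\<lambda>x. f x + f' x) \<and> sI (pos \<rho>) x y (\<lambda>x. g x + g' x) \<and>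
     f y + f' y = f x + f' x + sint \<sigma> x y (\<lambda>x. h x + h' x) \<and>
     h y + h' y = h x + h' x + sint \<kappa> x y (\<lambda>x. f x + f' x) - sint (pos \<rho>) x y (\<lambda>x. g x + g' x)"
    using qsolD[OF 1 xy] qsolD[OF 2 xy] by (simp add: sint_add sI_add)
qed

lemma qsol_cmult:
  assumes 1: "qsol J f h g"
  shows "qsol J (\<lambda>x. c * f x) (\<lambda>x. c * h x) (\<lambda>x. c * g x)"
proof (rule qsolI)
  fix x y assume xy: "x \<in> J" "y \<in> J" "x \<le> y"
  show "sI \<sigma> x y (\<lambda>x. c * h x) \<and> sI \<kappa> x y (\<lambda>x. c * f x) \<and> sI (pos \<rho>) x y (\<lambda>x. c * g x) \<and>
     c * f y = c * f x + sint \<sigma> x y (\<lambda>x. c * h x) \<and>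
     c * h y = c * h x + sint \<kappa> x y (\<lambda>x. c * f x) - sint (pos \<rho>) x y (\<lambda>x. c * g x)"
    using qsolD[OF 1 xy] by (simp add: sint_cmult sI_cmult distrib_left right_diff_distrib)
qed

lemma qsol_cnj:
  assumes 1: "qsol J f h g"
  shows "qsol J (cnjf f) (cnjf h) (cnjf g)"
  unfolding cnjf_def
proof (rule qsolI)
  fix x y assume xy: "x \<in> J" "y \<in> J" "x \<le> y"
  show "sI \<sigma> x y (\<lambda>x. cnj (h x)) \<and> sI \<kappa> x y (\<lambda>x. cnj (f x)) \<and> sI (pos \<rho>) x y (\<lambda>x. cnj (g x)) \<and>
     cnj (f y) = cnj (f x) + sint \<sigma> x y (\<lambda>x. cnj (h x)) \<and>
     cnj (h y) = cnj (h x) + sint \<kappa> x y (\<lambda>x. cnj (f x)) - sint (pos \<rho>) x y (\<lambda>x. cnj (g x))"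
    using qsolD[OF 1 xy] by (simp add: sint_cnj sI_cnj)
qed

text \<open>The product rule for \<open>f1 * h2\<close>: \<open>f1\<close> is driven by \<sigma> and
  \<open>h2\<close> by \<kappa> and \<rho>, so both integrations by parts are free of diagonal
  terms. The \<kappa> and \<sigma> integrals on the right are symmetric in the two solutions and
  cancel on antisymmetrisation, which leaves the Lagrange identity.\<close>

lemma qsol_half_lagrange:
  assumes J: "J \<subseteq> I" and 1: "qsol J f1 h1 g1" and 2: "qsol J f2 h2 g2" and x: "x \<in> J" and y: "y \<in> J"
    and xy: "x \<le> y"
    and oc: "{x..y} \<subseteq> J"
  shows "sI (pos \<rho>) x y (\<lambda>t. f1 t * g2 t)"
   "f1 y * h2 y - f1 x * h2 x = sint \<kappa> x y (\<lambda>t. f1 t * f2 t) - sint (pos \<rho>) x y (\<lambda>t. f1 t * g2 t)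
     + sint \<sigma> x y (\<lambda>t. h1 t * h2 t)"
proof -
  note D1 = qsolD[OF 1 x y xy] and D2 = qsolD[OF 2 x y xy]
  have xI: "x \<in> I" and yI: "y \<in> I" using x y J by auto
  note K = sint_parts[OF lfs_sig lfs_chi nca_chi xI yI D1(1) D2(2)]
  note R = sint_parts[OF lfs_sig lfs_rho nca_rho xI yI D1(1) D2(3)]
  have f1: "f1 t = f1 x + sint \<sigma> x t h1" if "x \<le> t" "t < y" for t
    using oc that by (intro qsolD(4)[OF 1 x _ that(1)]) auto
  have h2: "h2 t = h2 x + sint \<kappa> x t f2 - sint (pos \<rho>) x t g2" if "x \<le> t" "t < y" for t
    using oc that by (intro qsolD(5)[OF 2 x _ that(1)]) auto
  have i1: "sI (pos \<rho>) x y (\<lambda>t. f1 x * g2 t + sint \<sigma> x t h1 * g2 t)" by (intro sI_add sI_cmult D2(3) R(1))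
  have e1: "sI (pos \<rho>) x y (\<lambda>t. f1 x * g2 t + sint \<sigma> x t h1 * g2 t) = sI (pos \<rho>) x y (\<lambda>t. f1 t * g2 t)"
    by (rule sI_cong) (subst f1, assumption, assumption, simp only: distrib_right)
  show "sI (pos \<rho>) x y (\<lambda>t. f1 t * g2 t)" using i1 e1 by simp
  have s1: "sint (pos \<rho>) x y (\<lambda>t. f1 t * g2 t) = f1 x * sint (pos \<rho>) x y g2
    + sint (pos \<rho>) x y (\<lambda>t. sint \<sigma> x t h1 * g2 t)"
  proof -
    have "sint (pos \<rho>) x y (\<lambda>t. f1 t * g2 t) = sint (pos \<rho>) x y (\<lambda>t. f1 x * g2 t + sint \<sigma> x t h1 * g2 t)"
      by (rule sint_cong) (subst f1, assumption, assumption, simp only: distrib_right)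
    thus ?thesis by (simp add: sint_add[OF sI_cmult[OF D2(3)] R(1)] sint_cmult)
  qed
  have s2: "sint \<kappa> x y (\<lambda>t. f1 t * f2 t) = f1 x * sint \<kappa> x y f2 + sint \<kappa> x y (\<lambda>t. sint \<sigma> x t h1 * f2 t)"
  proof -
    have "sint \<kappa> x y (\<lambda>t. f1 t * f2 t) = sint \<kappa> x y (\<lambda>t. f1 x * f2 t + sint \<sigma> x t h1 * f2 t)"
      by (rule sint_cong) (subst f1, assumption, assumption, simp only: distrib_right)
    thus ?thesis by (simp add: sint_add[OF sI_cmult[OF D2(2)] K(1)] sint_cmult)
  qed
  have s3: "sint \<sigma> x y (\<lambda>t. h1 t * h2 t) = h2 x * sint \<sigma> x y h1 + sint \<sigma> x y (\<lambda>t. h1 t * sint \<kappa> x t f2)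
    - sint \<sigma> x y (\<lambda>t. h1 t * sint (pos \<rho>) x t g2)"
  proof -
    have "sint \<sigma> x y (\<lambda>t. h1 t * h2 t) = sint \<sigma> x y (\<lambda>t. (h2 x * h1 t + h1 t * sint \<kappa> x t f2)
      - h1 t * sint (pos \<rho>) x t g2)"
      by (rule sint_cong) (subst h2, assumption, assumption, simp only: distrib_left right_diff_distrib
        mult.commute)
    thus ?thesis by (simp add: sint_diff[OF sI_add[OF sI_cmult[OF D1(1)] K(2)] R(2)] sint_add[OF sI_cmult[OF
      D1(1)] K(2)] sint_cmult)
  qed
  show "f1 y * h2 y - f1 x * h2 x = sint \<kappa> x y (\<lambda>t. f1 t * f2 t) - sint (pos \<rho>) x y (\<lambda>t. f1 t * g2 t)
    + sint \<sigma> x y (\<lambda>t. h1 t * h2 t)"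
    unfolding s1 s2 s3 D1(4) D2(5) using K(3) R(3) by (simp only: algebra_simps)
qed

lemma qsol_lagrange:
  assumes J: "J \<subseteq> I" and 1: "qsol J f1 h1 g1" and 2: "qsol J f2 h2 g2" and x: "x \<in> J" and y: "y \<in> J"
    and xy: "x \<le> y"
    and oc: "{x..y} \<subseteq> J"
  shows "set_integrable \<rho> {x..<y} (\<lambda>t. g1 t * f2 t - f1 t * g2 t)"
    "(f1 y * h2 y - h1 y * f2 y) - (f1 x * h2 x - h1 x * f2 x) = (LINT t:{x..<y}|\<rho>. g1 t * f2 t
      - f1 t * g2 t)"
proof -
  note A = qsol_half_lagrange[OF J 1 2 x y xy oc]
  note B = qsol_half_lagrange[OF J 2 1 x y xy oc]
  have i: "sI (pos \<rho>) x y (\<lambda>t. g1 t * f2 t)" using B(1) by (simp add: mult.commute)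
  have c: "sint \<kappa> x y (\<lambda>t. f2 t * f1 t) = sint \<kappa> x y (\<lambda>t. f1 t * f2 t)" "sint \<sigma> x y (\<lambda>t. h2 t * h1 t)
    = sint \<sigma> x y (\<lambda>t. h1 t * h2 t)"
    "sint (pos \<rho>) x y (\<lambda>t. f2 t * g1 t) = sint (pos \<rho>) x y (\<lambda>t. g1 t * f2 t)"
    by (simp_all add: mult.commute)
  show "set_integrable \<rho> {x..<y} (\<lambda>t. g1 t * f2 t - f1 t * g2 t)"
    using sI_diff[OF i A(1)] by (simp add: sI_pos)
  have "(f1 y * h2 y - h1 y * f2 y) - (f1 x * h2 x - h1 x * f2 x) = (f1 y * h2 y - f1 x * h2 x)
    - (f2 y * h1 y - f2 x * h1 x)"
    by (simp add: algebra_simps)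
  also have "\<dots> = sint (pos \<rho>) x y (\<lambda>t. g1 t * f2 t) - sint (pos \<rho>) x y (\<lambda>t. f1 t * g2 t)"
    unfolding A(2) B(2) c by simp
  also have "\<dots> = sint (pos \<rho>) x y (\<lambda>t. g1 t * f2 t - f1 t * g2 t)" using sint_diff[OF i A(1)] by simp
  finally show "(f1 y * h2 y - h1 y * f2 y) - (f1 x * h2 x - h1 x * f2 x) = (LINT t:{x..<y}|\<rho>. g1 t * f2 t
    - f1 t * g2 t)"
    by (simp add: sint_pos)
qed

end

section \<open>Weights for the Picard iteration\<close>

lemma lf_finite_restrict:
  assumes M: "lf_measure_on a b M" and c: "c \<in> I_ab a b" and q: "q \<in> I_ab a b"
  shows "finite_measure (restrict_space M {c..<q})"
    and "x \<le> q \<Longrightarrow> c \<le> p \<Longrightarrow> measure (restrict_space M {c..<q}) {p..<x} = measure M {p..<x}"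
proof -
  have K: "{c..<q} \<in> sets M" using Ico_sub_I[OF c q] by (intro lf_sets[OF M]) auto
  hence K': "{c..<q} \<inter> space M \<in> sets M" by auto
  have sp: "space (restrict_space M {c..<q}) = {c..<q}"
    using Ico_sub_I[OF c q] lf_space[OF M] by (auto simp: space_restrict_space)
  show "finite_measure (restrict_space M {c..<q})"
    by (rule finite_measureI) (use lf_finite(2)[OF M c q] in \<open>simp add: sp emeasure_restrict_space[OF K']\<close>)
  show "x \<le> q \<Longrightarrow> c \<le> p \<Longrightarrow> measure (restrict_space M {c..<q}) {p..<x} = measure M {p..<x}"
    by (rule measure_restrict_space[OF K']) auto
qed

text \<open>Each \<open>t\<close> in the set has
  \<open>M [t, x) = M [c, x) - M [c, t) < M [c, x) - s\<close>. The set is closed upwards in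
  \<open>[c, x)\<close>, hence an interval ending at \<open>x\<close>; if its infimum does not
  belong to it, it is exhausted by intervals \<open>[u n, x)\<close> and the bound survives the
  limit.\<close>

lemma measure_upper_part:
  fixes M :: "real measure"
  assumes "finite_measure M" and Ico: "\<And>p. c \<le> p \<Longrightarrow> {p..<x} \<in> sets M"
    and s: "s \<le> measure M {c..<x}"
  shows "{t\<in>{c..<x}. s < measure M {c..<t}} \<in> sets M"
    "measure M {t\<in>{c..<x}. s < measure M {c..<t}} \<le> measure M {c..<x} - s"
proof -
  interpret finite_measure M by fact
  let ?P = "\<lambda>t. measure M {c..<t}"
  let ?A = "{t\<in>{c..<x}. s < ?P t}"
  have IcoM: "{p..<t} \<in> sets M" if "c \<le> p" "p \<le> t" "t \<le> x" for p t
  proof -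
    have "{p..<t} = {p..<x} - {t..<x}" using that by auto
    thus ?thesis using Ico[of p] Ico[of t] that by auto
  qed
  have up: "u \<in> ?A" if "t \<in> ?A" "t \<le> u" "u < x" for t u
  proof -
    have "?P t \<le> ?P u" using that IcoM[of c u] by (intro finite_measure_mono) auto
    thus ?thesis using that by auto
  qed
  have seg: "measure M {t..<x} \<le> ?P x - s" if "t \<in> ?A" for t
  proof -
    have "{c..<x} = {c..<t} \<union> {t..<x}" using that by auto
    moreover have "measure M ({c..<t} \<union> {t..<x}) = ?P t + measure M {t..<x}"
      using that IcoM[of c t] IcoM[of t x]
      by (intro finite_measure_Union) auto
    ultimately have "?P x = ?P t + measure M {t..<x}" by simp
    thus ?thesis using that by auto
  qed
  have "?A \<in> sets M \<and> measure M ?A \<le> ?P x - s"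
  proof (cases "?A = {}")
    case True thus ?thesis unfolding True using s by simp
  next
    case ne: False
    have bdd: "bdd_below ?A" by (rule bdd_belowI[of _ c]) auto
    define i where "i = Inf ?A"
    have ci: "c \<le> i" unfolding i_def using ne by (rule cInf_greatest) auto
    have il: "i \<le> t" if "t \<in> ?A" for t unfolding i_def by (rule cInf_lower[OF that bdd])
    show ?thesis
    proof (cases "i \<in> ?A")
      case True
      have "?A = {i..<x}"
      proof (intro set_eqI iffI)
        fix t assume "t \<in> ?A" thus "t \<in> {i..<x}" using il[of t] by simp
      next
        fix t assume "t \<in> {i..<x}" thus "t \<in> ?A" using up[OF True, of t] by simp
      qed
      thus ?thesis using Ico[OF ci] seg[OF True] by simp
    next
      case False
      from ne obtain t0 where t0: "t0 \<in> ?A" by blast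
      have ix: "i < x" using il[OF t0] t0 by auto
      \<comment> \<open>The denominator starts at 2, as 1 would give the point \<open>x\<close>
        itself, which is not in the set.\<close>
      define u where "u n = i + (x - i) / real (n + 2)" for n
      have u: "i < u n" "u n < x" for n
      proof -
        have "(x - i) / real (n + 2) < (x - i) / 1" by (rule divide_strict_left_mono) (use ix in auto)
        thus "u n < x" by (simp add: u_def)
        show "i < u n" using ix by (simp add: u_def)
      qed
      have uA: "u n \<in> ?A" for n
      proof -
        obtain t where "t \<in> ?A" "t < u n" using cInf_lessD[OF ne, of "u n"] u(1)[of n] unfolding i_def
          by auto
        thus ?thesis using up[of t "u n"] u(2)[of n] by auto
      qed
      have lim: "u \<longlonglongrightarrow> i"
      proof -
        have "(\<lambda>n. i + (x - i) / real (n + 2)) \<longlonglongrightarrow> i + 0"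
          by (intro tendsto_add tendsto_const LIMSEQ_ignore_initial_segment[OF lim_const_over_n])
        thus ?thesis unfolding u_def by simp
      qed
      have Aeq: "?A = (\<Union>n. {u n..<x})"
      proof (intro set_eqI iffI)
        fix t assume t: "t \<in> ?A"
        hence "i < t" using il[OF t] False by (cases "i = t") auto
        hence "eventually (\<lambda>n. u n < t) sequentially" using lim by (rule order_tendstoD(2)[rotated])
        then obtain n where "u n < t" by (auto simp: eventually_sequentially)
        thus "t \<in> (\<Union>n. {u n..<x})" using t by (auto intro!: exI[of _ n])
      next
        fix t assume "t \<in> (\<Union>n. {u n..<x})"
        then obtain n where "u n \<le> t" "t < x" by auto
        thus "t \<in> ?A" using up[OF uA[of n]] by blast
      qed
      have cu: "c \<le> u n" for n using ci u(1)[of n] by auto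
      have dec: "u m \<le> u n" if "n \<le> m" for m n
        unfolding u_def using that ix by (auto intro!: divide_left_mono)
      have r: "range (\<lambda>n. {u n..<x}) \<subseteq> sets M" using Ico[OF cu] by auto
      have inc: "incseq (\<lambda>n. {u n..<x})" unfolding incseq_def
        using dec by (auto intro: order_trans)
      have "(\<lambda>n. measure M {u n..<x}) \<longlonglongrightarrow> measure M (\<Union>n. {u n..<x})"
        by (rule finite_Lim_measure_incseq[OF r inc])
      hence "measure M (\<Union>n. {u n..<x}) \<le> ?P x - s"
        by (rule LIMSEQ_le_const2) (use seg[OF uA] in auto)
      moreover have "(\<Union>n. {u n..<x}) \<in> sets M" using r by blast
      ultimately show ?thesis unfolding Aeq by simp
    qed
  qed
  thus "?A \<in> sets M" "measure M ?A \<le> ?P x - s" by auto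
qed

text \<open>A Bielecki weight: in the supremum norm of \<open>h / E\<close> on
  \<open>[c, q]\<close>, integration from \<open>c\<close> has norm at most \<theta>. Monotonicity
  gives measurability and lets weights be multiplied.\<close>

definition weight :: "real measure \<Rightarrow> real \<Rightarrow> real \<Rightarrow> real \<Rightarrow> (real \<Rightarrow> real) \<Rightarrow> bool" where
  "weight M c q \<theta> E \<longleftrightarrow> mono E \<and> (\<forall>x. 1 \<le> E x) \<and>
     (\<forall>x. c \<le> x \<and> x \<le> q \<longrightarrow> (LINT t:{c..<x}|M. E t) \<le> \<theta> * E x)"

lemma mono_set_integrable:
  fixes E :: "real \<Rightarrow> real"
  assumes M: "lf_measure_on a b M" and c: "c \<in> I_ab a b" and q: "q \<in> I_ab a b" and E: "mono E" "\<And>x. 0 \<le> E x"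
  shows "set_integrable M {c..<q} E"
proof -
  have S: "{c..<q} \<in> sets M" using Ico_sub_I[OF c q] by (intro lf_sets[OF M]) auto
  have E': "E \<in> borel_measurable M" using borel_measurable_mono[OF E(1)] lf_id[OF M] by measurable
  have "set_integrable M {c..<q} (\<lambda>_. E q)"
    unfolding set_integrable_def using S lf_finite(2)[OF M c q] by simp
  thus ?thesis
  proof (rule set_integrable_bound)
    show "set_borel_measurable M {c..<q} E" unfolding set_borel_measurable_def using S E' by measurable
    show "AE x in M. x \<in> {c..<q} \<longrightarrow> norm (E x) \<le> norm (E q)"
      using E monoD[OF E(1)] by (auto simp: less_imp_le)
  qed
qed

text \<open>With \<open>\<Phi> t = M [c, t)\<close>, take \<open>E = K ^ \<lceil>\<Phi> / \<epsilon>\<rceil>\<close>: left of \<open>x\<close> the exponent is maximal only on a set of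
  mass at most \<open>\<epsilon>\<close>, atoms notwithstanding, and elsewhere \<open>E\<close> is smaller by a factor \<open>K\<close>.\<close>
lemma ex_weight:
  assumes M: "lf_measure_on a b M" and c: "c \<in> I_ab a b" and q: "q \<in> I_ab a b" and cq: "c \<le> q"
    and \<theta>: "0 < \<theta>"
  shows "\<exists>E. weight M c q \<theta> E"
proof -
  let ?M = "restrict_space M {c..<q}"
  note fin = lf_finite_restrict(1)[OF M c q]
  interpret R: finite_measure ?M by (rule fin)
  have K: "{c..<q} \<in> sets M" using Ico_sub_I[OF c q] by (intro lf_sets[OF M]) auto
  have eqm: "measure ?M {p..<x} = measure M {p..<x}" if "x \<le> q" "c \<le> p" for p x
    by (rule lf_finite_restrict(2)[OF M c q that])
  have Ico: "{p..<x} \<in> sets ?M" if "x \<le> q" "c \<le> p" for p x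
  proof -
    have "{p..<x} \<in> sets M" by (rule lf_sets[OF M]) (use that Ico_sub_I[OF c q] in auto)
    thus ?thesis using K that by (subst sets_restrict_space_iff) auto
  qed
  define m where "m = measure M {c..<q}"
  \<comment> \<open>The truncation at \<open>q\<close> makes the cumulative mass finite and monotone
    on the whole line, as \<open>weight\<close> demands of \<open>E\<close>.\<close>
  define P where "P t = measure M {c..<min t q}" for t
  have Pm: "P t = measure ?M {c..<min t q}" for t using eqm[of "min t q" c] by (simp add: P_def)
  have monoP: "mono P"
  proof (rule monoI)
    fix x y :: real assume "x \<le> y"
    thus "P x \<le> P y" unfolding Pm using Ico[of "min y q" c] by (intro R.finite_measure_mono) auto
  qed
  \<comment> \<open>When the exponent at \<open>x\<close> is \<open>n + 1\<close>, the integral is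
    at most \<open>K ^ n * m + K ^ (n + 1) * \<epsilon>\<close>. Each summand has to stay below half
    of \<open>\<theta> * K ^ (n + 1)\<close>; this dictates \<epsilon> and the lower bound
    \<open>2 * m / \<theta>\<close> for \<open>K\<close>.\<close>
  define \<epsilon> where "\<epsilon> = \<theta> / 2"
  have \<epsilon>: "0 < \<epsilon>" using \<theta> by (simp add: \<epsilon>_def)
  define K where "K = max 1 (2 * m / \<theta>)"
  have K1: "1 \<le> K" and Km: "m \<le> \<theta> / 2 * K" using \<theta> by (auto simp: K_def field_simps max_def)
  define k where "k t = nat \<lceil>P t / \<epsilon>\<rceil>" for t
  define E where "E t = K ^ k t" for t
  have monok: "mono k"
    using monoP \<epsilon> unfolding k_def by (intro monoI nat_mono ceiling_mono divide_right_mono)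
      (auto dest: monoD)
  have E1: "1 \<le> E x" for x using K1 by (simp add: E_def)
  have monoE: "mono E" unfolding E_def using K1 monok by (intro monoI power_increasing) (auto dest: monoD)
  have "(LINT t:{c..<x}|M. E t) \<le> \<theta> * E x" if x: "c \<le> x" "x \<le> q" for x
  proof -
    have xI: "x \<in> I_ab a b" using I_ab_between[OF c q x] .
    have Px: "P t = measure M {c..<t}" if "t \<le> x" for t using that x by (simp add: P_def min_absorb1)
    have S: "{c..<x} \<in> sets M" using Ico_sub_I[OF c xI] by (intro lf_sets[OF M]) auto
    have iE: "set_integrable M {c..<x} E" using E1
      by (intro mono_set_integrable[OF M c xI monoE]) (meson order_trans zero_le_one)
    have le_m: "measure M {c..<x} \<le> m"
    proof -
      have "measure ?M {c..<x} \<le> measure ?M {c..<q}"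
        using x Ico[of q c] by (intro R.finite_measure_mono) auto
      thus ?thesis unfolding m_def eqm[OF x(2) order_refl] eqm[OF order_refl order_refl] .
    qed
    have fx: "emeasure M {c..<x} < \<infinity>" using lf_finite(2)[OF M c xI] .
    have ic: "set_integrable M {c..<x} (\<lambda>_. C)" for C :: real
      unfolding set_integrable_def using S fx by simp
    have lc: "(LINT t:{c..<x}|M. C) = C * measure M {c..<x}" for C :: real
      using S fx by (simp add: set_lebesgue_integral_def)
    show ?thesis
    proof (cases "k x")
      case 0
      hence z: "measure M {c..<x} = 0" using \<epsilon> Px[of x]
        by (auto simp: k_def divide_le_0_iff intro: antisym[OF _ measure_nonneg])
      have "(LINT t:{c..<x}|M. E t) \<le> (LINT t:{c..<x}|M. E x)"
        using iE ic monoD[OF monoE] by (intro set_integral_mono) auto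
      also have "\<dots> = 0" using z by (simp add: lc)
      finally show ?thesis using E1[of x] \<theta> by (simp add: order_trans[OF _ mult_nonneg_nonneg])
    next
      case (Suc n)
      \<comment> \<open>The largest cumulative mass for which the exponent is still at most
        \<open>n\<close>.\<close>
      define s where "s = real n * \<epsilon>"
      have "int n < \<lceil>P x / \<epsilon>\<rceil>" using Suc by (simp add: k_def)
      hence "real n < P x / \<epsilon>" by (simp add: less_ceiling_iff)
      hence sx: "s < P x" using \<epsilon> by (simp add: s_def field_simps)
      have "P x / \<epsilon> \<le> real (Suc n)" using Suc unfolding k_def by linarith
      hence Pxs: "P x - s \<le> \<epsilon>" using \<epsilon> by (simp add: s_def field_simps)
      define A where "A = {t\<in>{c..<x}. s < measure M {c..<t}}"
      have AR: "A = {t\<in>{c..<x}. s < measure ?M {c..<t}}" unfolding A_def using x by (auto simp: eqm)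
      have up: "A \<in> sets ?M" "measure ?M A \<le> \<epsilon>"
        using measure_upper_part[OF fin, of c x s] Ico[OF x(2)] sx Pxs x eqm[of x c] Px[of x]
          unfolding AR[symmetric]
        by (auto simp: AR)
      have AM: "A \<in> sets M" using up(1) K by (subst (asm) sets_restrict_space_iff) (auto simp: Int_absorb2)
      have Asub: "A \<subseteq> {c..<x}" by (auto simp: A_def)
      have mA: "measure M A \<le> \<epsilon>"
      proof -
        have "A \<subseteq> {c..<q}" using Asub x by auto
        thus ?thesis using up(2) measure_restrict_space[of "{c..<q}" M A] K by auto
      qed
      have fA: "emeasure M A < \<infinity>"
        using emeasure_mono[OF Asub S] fx by (rule order_le_less_trans)
      have iA: "set_integrable M {c..<x} (\<lambda>t. K ^ Suc n * indicator A t)"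
      proof -
        have "set_integrable M {c..<x} (indicator A :: real \<Rightarrow> real)"
          unfolding set_integrable_def using S AM fA Asub
          by (simp add: indicator_inter_arith[symmetric] Int_absorb1)
        thus ?thesis by (rule set_integrable_mult_right)
      qed
      have pt: "E t \<le> K ^ n + K ^ Suc n * indicator A t" if "t \<in> {c..<x}" for t
      proof (cases "t \<in> A")
        case True
        have "E t \<le> E x" using monoD[OF monoE] that by auto
        moreover have "0 \<le> K ^ n" using K1 by simp
        ultimately show ?thesis using True Suc by (simp add: E_def)
      next
        case False
        hence "P t \<le> s" using that Px[of t] by (auto simp: A_def not_less)
        hence "P t / \<epsilon> \<le> real n" using \<epsilon> by (simp add: s_def field_simps)
        hence "k t \<le> n" unfolding k_def by (simp add: ceiling_le_iff)
        thus ?thesis using False K1 by (simp add: E_def power_increasing)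
      qed
      have "(LINT t:{c..<x}|M. E t) \<le> (LINT t:{c..<x}|M. K ^ n + K ^ Suc n * indicator A t)"
        using iE ic iA pt by (intro set_integral_mono set_integral_add) auto
      also have "\<dots> = (LINT t:{c..<x}|M. K ^ n) + (LINT t:{c..<x}|M. K ^ Suc n * indicator A t)"
        by (rule set_integral_add(2)[OF ic iA])
      also have "(LINT t:{c..<x}|M. K ^ Suc n * indicator A t) = K ^ Suc n * measure M A"
      proof -
        have "(LINT t:{c..<x}|M. (indicator A t :: real)) = measure M A"
          unfolding set_lebesgue_integral_def using S AM Asub sets.sets_into_space[OF AM]
          by (simp add: indicator_inter_arith[symmetric] Int_absorb1 Int_absorb2)
        thus ?thesis by (simp del: power_Suc)
      qed
      also have "(LINT t:{c..<x}|M. K ^ n) + K ^ Suc n * measure M A \<le> K ^ n * m + K ^ Suc n * \<epsilon>"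
        unfolding lc using K1 le_m mA by (intro add_mono mult_left_mono) auto
      also have "\<dots> \<le> K ^ n * (\<theta> / 2 * K) + K ^ Suc n * \<epsilon>"
        using Km K1 by (intro add_mono mult_left_mono) auto
      also have "\<dots> = \<theta> * E x" by (simp add: E_def Suc \<epsilon>_def field_simps)
      finally show ?thesis .
    qed
  qed
  thus ?thesis using monoE E1 unfolding weight_def by blast
qed

section \<open>Existence and uniqueness of solutions\<close>

text \<open>An increasing factor can be estimated by its value at \<open>x\<close> and taken out of
  the integral. Thus a product of weights for several measures is a weight for each of them, and the
  same norm serves all Jordan parts at once.\<close>

lemma weight_mult:
  assumes M: "lf_measure_on a b M" and c: "c \<in> I_ab a b" and q: "q \<in> I_ab a b"
    and E: "weight M c q \<theta> E" and F: "mono F" "\<And>x. 1 \<le> F x"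
  shows "weight M c q \<theta> (\<lambda>x. E x * F x)"
  unfolding weight_def
proof (intro conjI allI impI)
  have E1: "mono E" "\<And>x. 1 \<le> E x" using E by (auto simp: weight_def)
  have p: "0 \<le> E x" "0 \<le> F x" for x using E1(2)[of x] F(2)[of x] by linarith+
  show m: "mono (\<lambda>x. E x * F x)"
    using E1(1) F(1) p by (intro monoI mult_mono) (auto dest: monoD)
  show "1 \<le> E x * F x" for x using mult_mono[OF E1(2)[of x] F(2)[of x]] p by simp
  fix x assume x: "c \<le> x \<and> x \<le> q"
  hence xI: "x \<in> I_ab a b" using I_ab_between[OF c q] by auto
  have "(LINT t:{c..<x}|M. E t * F t) \<le> (LINT t:{c..<x}|M. E t * F x)"
    using mono_set_integrable[OF M c xI m] mono_set_integrable[OF M c xI E1(1)] p monoD[OF F(1)]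
    by (intro set_integral_mono mult_left_mono) auto
  also have "\<dots> = (LINT t:{c..<x}|M. E t) * F x" by simp
  also have "\<dots> \<le> (\<theta> * E x) * F x" using E x p by (intro mult_right_mono) (auto simp: weight_def)
  finally show "(LINT t:{c..<x}|M. E t * F t) \<le> \<theta> * (E x * F x)" by (simp add: mult.assoc)
qed

lemma weight_mono: "weight M c q \<theta> E \<Longrightarrow> mono E" and weight_ge: "weight M c q \<theta> E \<Longrightarrow> 1 \<le> E x"
  by (auto simp: weight_def)

definition sweight :: "real measure \<times> real measure \<Rightarrow> real \<Rightarrow> real \<Rightarrow> real \<Rightarrow> (real \<Rightarrow> real) \<Rightarrow> bool" where
  "sweight \<mu> c q \<theta> E \<longleftrightarrow> weight (fst \<mu>) c q \<theta> E \<and> weight (snd \<mu>) c q \<theta> E"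

lemma ex_sweight:
  assumes \<mu>: "lfs a b \<mu>" and \<nu>: "lfs a b \<nu>" and c: "c \<in> I_ab a b" and q: "q \<in> I_ab a b" and cq: "c \<le> q"
    and \<theta>: "0 < \<theta>"
  shows "\<exists>E. sweight \<mu> c q \<theta> E \<and> sweight \<nu> c q \<theta> E"
proof -
  have m: "lf_measure_on a b (fst \<mu>)" "lf_measure_on a b (snd \<mu>)" "lf_measure_on a b (fst \<nu>)"
    "lf_measure_on a b (snd \<nu>)"
    using \<mu> \<nu> by (auto simp: lfs_def)
  obtain E1 where E1: "weight (fst \<mu>) c q \<theta> E1" using ex_weight[OF m(1) c q cq \<theta>] ..
  obtain E2 where E2: "weight (snd \<mu>) c q \<theta> E2" using ex_weight[OF m(2) c q cq \<theta>] ..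
  obtain E3 where E3: "weight (fst \<nu>) c q \<theta> E3" using ex_weight[OF m(3) c q cq \<theta>] ..
  obtain E4 where E4: "weight (snd \<nu>) c q \<theta> E4" using ex_weight[OF m(4) c q cq \<theta>] ..
  have A1: "weight (fst \<mu>) c q \<theta> (\<lambda>x. E1 x * E2 x)"
    by (rule weight_mult[OF m(1) c q E1 weight_mono[OF E2] weight_ge[OF E2]])
  have A2: "weight (snd \<mu>) c q \<theta> (\<lambda>x. E1 x * E2 x)"
    using weight_mult[OF m(2) c q E2 weight_mono[OF E1] weight_ge[OF E1]]
    by (simp add: mult.commute)
  have A3: "weight (fst \<nu>) c q \<theta> (\<lambda>x. E3 x * E4 x)"
    by (rule weight_mult[OF m(3) c q E3 weight_mono[OF E4] weight_ge[OF E4]])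
  have A4: "weight (snd \<nu>) c q \<theta> (\<lambda>x. E3 x * E4 x)"
    using weight_mult[OF m(4) c q E4 weight_mono[OF E3] weight_ge[OF E3]]
    by (simp add: mult.commute)
  let ?E = "\<lambda>x. (E1 x * E2 x) * (E3 x * E4 x)"
  have "weight (fst \<mu>) c q \<theta> ?E" by (rule weight_mult[OF m(1) c q A1 weight_mono[OF A3] weight_ge[OF A3]])
  moreover have "weight (snd \<mu>) c q \<theta> ?E"
    by (rule weight_mult[OF m(2) c q A2 weight_mono[OF A3] weight_ge[OF A3]])
  moreover have "weight (fst \<nu>) c q \<theta> ?E"
    using weight_mult[OF m(3) c q A3 weight_mono[OF A1] weight_ge[OF A1]]
    by (simp add: mult.commute)
  moreover have "weight (snd \<nu>) c q \<theta> ?E"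
    using weight_mult[OF m(4) c q A4 weight_mono[OF A1] weight_ge[OF A1]]
    by (simp add: mult.commute)
  ultimately show ?thesis unfolding sweight_def by blast
qed

lemma weight_bound:
  fixes h :: "real \<Rightarrow> complex"
  assumes M: "lf_measure_on a b M" and c: "c \<in> I_ab a b" and q: "q \<in> I_ab a b" and E: "weight M c q \<theta> E"
    and x: "c \<le> x" "x \<le> q" and h: "set_integrable M {c..<x} h"
      and C: "0 \<le> C" "\<And>t. c \<le> t \<Longrightarrow> t < x \<Longrightarrow> cmod (h t) \<le> C * E t"
  shows "cmod (LINT t:{c..<x}|M. h t) \<le> C * (\<theta> * E x)"
proof -
  have xI: "x \<in> I_ab a b" using I_ab_between[OF c q x] .
  have "set_integrable M {c..<x} E"
    using mono_set_integrable[OF M c xI weight_mono[OF E]] weight_ge[OF E]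
      by (meson order_trans zero_le_one)
  hence iE: "set_integrable M {c..<x} (\<lambda>t. C * E t)" by simp
  have "cmod (LINT t:{c..<x}|M. h t) \<le> (LINT t:{c..<x}|M. C * E t)"
    unfolding set_lebesgue_integral_def
    by (rule Bochner_Integration.integral_norm_bound_integral)
       (use h iE C in \<open>auto simp: set_integrable_def indicator_def\<close>)
  also have "\<dots> = C * (LINT t:{c..<x}|M. E t)" by simp
  also have "\<dots> \<le> C * (\<theta> * E x)" using E x C(1) by (intro mult_left_mono) (auto simp: weight_def)
  finally show ?thesis .
qed

lemma sweight_bound:
  assumes \<mu>: "lfs a b \<mu>" and c: "c \<in> I_ab a b" and q: "q \<in> I_ab a b" and E: "sweight \<mu> c q \<theta> E"
    and x: "c \<le> x" "x \<le> q" and h: "sI \<mu> c x h" and C: "0 \<le> C" "\<And>t. c \<le> t \<Longrightarrow> t < x \<Longrightarrow> cmod (h t) \<le> C * E t"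
  shows "cmod (sint \<mu> c x h) \<le> C * (2 * \<theta> * E x)"
proof -
  have m: "lf_measure_on a b (fst \<mu>)" "lf_measure_on a b (snd \<mu>)" using \<mu> by (auto simp: lfs_def)
  have "cmod (LINT t:{c..<x}|fst \<mu>. h t) \<le> C * (\<theta> * E x)"
    by (rule weight_bound[OF m(1) c q _ x _ C]) (use E h in \<open>auto simp: sweight_def sI_def\<close>)
  moreover have "cmod (LINT t:{c..<x}|snd \<mu>. h t) \<le> C * (\<theta> * E x)"
    by (rule weight_bound[OF m(2) c q _ x _ C]) (use E h in \<open>auto simp: sweight_def sI_def\<close>)
  ultimately show ?thesis unfolding sint_def
    using norm_triangle_ineq4[of "LINT t:{c..<x}|fst \<mu>. h t" "LINT t:{c..<x}|snd \<mu>. h t"] by linarith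
qed

lemma set_integral_dominated:
  fixes h :: "nat \<Rightarrow> real \<Rightarrow> complex"
  assumes S: "A \<in> sets M" "emeasure M A < \<infinity>" and i: "\<And>n. set_integrable M A (h n)"
    and l: "\<And>t. t \<in> A \<Longrightarrow> (\<lambda>n. h n t) \<longlonglongrightarrow> g t"
    and B: "\<And>n t. t \<in> A \<Longrightarrow> cmod (h n t) \<le> B"
  shows "set_integrable M A g" "(\<lambda>n. LINT t:A|M. h n t) \<longlonglongrightarrow> (LINT t:A|M. g t)"
proof -
  have l': "(\<lambda>n. indicator A t *\<^sub>R h n t) \<longlonglongrightarrow> indicator A t *\<^sub>R g t" for t
    using l[of t] by (cases "t \<in> A") auto
  have m: "(\<lambda>t. indicator A t *\<^sub>R h n t) \<in> borel_measurable M" for n using i[of n] by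
    (auto simp: set_integrable_def)
  have mg: "(\<lambda>t. indicator A t *\<^sub>R g t) \<in> borel_measurable M"
    by (rule borel_measurable_LIMSEQ_metric[OF m l'])
  have w: "integrable M (\<lambda>t. indicator A t * B)" using S by simp
  have b: "AE t in M. norm (indicator A t *\<^sub>R h n t) \<le> indicator A t * B" for n
    using B[of _ n] by (auto simp: indicator_def)
  have l'': "AE t in M. (\<lambda>n. indicator A t *\<^sub>R h n t) \<longlonglongrightarrow> indicator A t *\<^sub>R g t" using l' by simp
  show "set_integrable M A g" unfolding set_integrable_def
    by (rule integrable_dominated_convergence[OF mg m w l'' b])
  show "(\<lambda>n. LINT t:A|M. h n t) \<longlonglongrightarrow> (LINT t:A|M. g t)" unfolding set_lebesgue_integral_def
    by (rule integral_dominated_convergence[OF mg m w l'' b])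
qed

lemma sint_dominated:
  assumes \<mu>: "lfs a b \<mu>" and p: "p \<in> I_ab a b" and q: "q \<in> I_ab a b"
    and i: "\<And>n. sI \<mu> p q (h n)" and l: "\<And>t. p \<le> t \<Longrightarrow> t < q \<Longrightarrow> (\<lambda>n. h n t) \<longlonglongrightarrow> g t"
    and B: "\<And>n t. p \<le> t \<Longrightarrow> t < q \<Longrightarrow> cmod (h n t) \<le> B"
  shows "sI \<mu> p q g" "(\<lambda>n. sint \<mu> p q (h n)) \<longlonglongrightarrow> sint \<mu> p q g"
proof -
  have m: "lf_measure_on a b (fst \<mu>)" "lf_measure_on a b (snd \<mu>)" using \<mu> by (auto simp: lfs_def)
  have s: "{p..<q} \<in> sets (fst \<mu>)" "{p..<q} \<in> sets (snd \<mu>)" using lfs_Ico[OF \<mu> p q] by auto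
  have i': "set_integrable (fst \<mu>) {p..<q} (h n)" "set_integrable (snd \<mu>) {p..<q} (h n)" for n using i[of n]
    by (auto simp: sI_def)
  have l': "(\<lambda>n. h n t) \<longlonglongrightarrow> g t" if "t \<in> {p..<q}" for t using that l by simp
  have B': "cmod (h n t) \<le> B" if "t \<in> {p..<q}" for n t using that B by simp
  note D1 = set_integral_dominated[OF s(1) lf_finite(2)[OF m(1) p q] i'(1) l' B', simplified]
   and D2 = set_integral_dominated[OF s(2) lf_finite(2)[OF m(2) p q] i'(2) l' B', simplified]
  show "sI \<mu> p q g" unfolding sI_def using D1(1) D2(1) by simp
  show "(\<lambda>n. sint \<mu> p q (h n)) \<longlonglongrightarrow> sint \<mu> p q g" unfolding sint_def
    by (intro tendsto_diff D1(2) D2(2))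
qed

lemma sI_const:
  assumes \<mu>: "lfs a b \<mu>" and p: "p \<in> I_ab a b" and q: "q \<in> I_ab a b" shows "sI \<mu> p q (\<lambda>_. C)"
proof -
  have m: "lf_measure_on a b (fst \<mu>)" "lf_measure_on a b (snd \<mu>)" using \<mu> by (auto simp: lfs_def)
  show ?thesis using lfs_Ico[OF \<mu> p q] lf_finite(2)[OF m(1) p q] lf_finite(2)[OF m(2) p q]
    by (auto simp: sI_def set_integrable_def)
qed

section \<open>Picard iteration to the right of a base point\<close>

context sturm_liouville begin

text \<open>Since the integrals run over \<open>[c, x)\<close>, the values at \<open>x\<close> are
  determined explicitly by values strictly to the left of \<open>x\<close>. The contribution of
  \<open>k\<close> does not involve the unknowns and is absorbed into the start function
  \<open>h0\<close>.\<close>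

lemma qsol_forward_aux:
  assumes c: "c \<in> I" and kk: "\<And>q. q \<in> I \<Longrightarrow> c \<le> q \<Longrightarrow> sI (pos \<rho>) c q k"
  shows "\<exists>f h. f c = d1 \<and> h c = d2 \<and> (\<forall>x\<in>I. c \<le> x \<longrightarrow> sI \<sigma> c x h \<and> sI \<kappa> c x f \<and>
     f x = d1 + sint \<sigma> c x h \<and> h x = d2 + sint \<kappa> c x f - sint (pos \<rho>) c x k)"
proof -
  define h0 where "h0 x = d2 - sint (pos \<rho>) c x k" for x
  define Y where "Y = rec_nat (\<lambda>_::real. d1, h0) (\<lambda>_ (f, h). (\<lambda>x. d1 + sint \<sigma> c x h, \<lambda>x. h0 x
    + sint \<kappa> c x f))"
  define F where "F n = fst (Y n)" for n
  define H where "H n = snd (Y n)" for n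
  have F0: "F 0 = (\<lambda>_. d1)" and H0: "H 0 = h0" by (simp_all add: F_def H_def Y_def)
  have FS: "F (Suc n) = (\<lambda>x. d1 + sint \<sigma> c x (H n))" and HS: "H (Suc n) = (\<lambda>x. h0 x + sint \<kappa> c x (F n))"
    for n
    by (simp_all add: F_def H_def Y_def case_prod_beta)
  have ih0: "sI \<sigma> c q h0" if q: "q \<in> I" "c \<le> q" for q
  proof -
    \<comment> \<open>With the constant 1 as one factor, integration by parts yields the
      integrability of an indefinite integral. The same device keeps all iterates
      integrable.\<close>
    have "sI \<sigma> c q (\<lambda>t. 1 * sint (pos \<rho>) c t k)"
      by (rule sint_parts(2)[OF lfs_sig lfs_rho nca_rho c q(1) sI_const[OF lfs_sig c q(1)] kk[OF q]])
    thus ?thesis unfolding h0_def using sI_diff[OF sI_const[OF lfs_sig c q(1)]] by simp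
  qed
  have int: "sI \<sigma> c q (H n) \<and> sI \<kappa> c q (F n)" if q: "q \<in> I" "c \<le> q" for q n
  proof (induction n)
    case 0 thus ?case using ih0[OF q] sI_const[OF lfs_chi c q(1)] by (simp add: F0 H0)
  next
    case (Suc n)
    have "sI \<kappa> c q (\<lambda>t. sint \<sigma> c t (H n) * 1)"
      by (rule sint_parts(1)[OF lfs_sig lfs_chi nca_chi c q(1) _ sI_const[OF lfs_chi c q(1)]])
        (use Suc in auto)
    moreover have "sI \<sigma> c q (\<lambda>t. 1 * sint \<kappa> c t (F n))"
      by (rule sint_parts(2)[OF lfs_sig lfs_chi nca_chi c q(1) sI_const[OF lfs_sig c q(1)]])
        (use Suc in auto)
    ultimately show ?case unfolding FS HS
      using sI_add[OF sI_const[OF lfs_chi c q(1)]] sI_add[OF ih0[OF q]] by simp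
  qed
  \<comment> \<open>The iterates do not depend on \<open>q\<close>; only the weight and the bound
    do. The bound, uniform in \<open>n\<close>, allows dominated convergence in the integral
    equations.\<close>
  have key: "\<exists>B. \<forall>x. c \<le> x \<and> x \<le> q \<longrightarrow> (\<forall>n. cmod (F n x) \<le> B \<and> cmod (H n x) \<le> B) \<and>
      convergent (\<lambda>n. F n x) \<and> convergent (\<lambda>n. H n x)" if q: "q \<in> I" "c \<le> q" for q
  proof -
    \<comment> \<open>The two Jordan parts double the norm, so \<theta> = 1/4 makes every step a
      contraction by 1/2.\<close>
    obtain E where E: "sweight \<sigma> c q (1/4) E" "sweight \<kappa> c q (1/4) E"
      using ex_sweight[OF lfs_sig lfs_chi c q(1) q(2), of "1/4"] by auto
    have E1: "mono E" "\<And>x. 1 \<le> E x" using E(1) weight_mono weight_ge unfolding sweight_def by blast+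
    have E0: "0 \<le> E x" for x using E1(2)[of x] by linarith
    define B0 where "B0 = cmod d2 + (LINT t:{c..<q}|\<rho>. cmod (k t))"
    have Bk: "cmod (sint (pos \<rho>) c x k) \<le> (LINT t:{c..<q}|\<rho>. cmod (k t))" if x: "c \<le> x" "x \<le> q" for x
    proof -
      have xI: "x \<in> I" using I_ab_between[OF c q(1) x] .
      have ik: "set_integrable \<rho> {c..<q} k" "set_integrable \<rho> {c..<x} k" using kk[OF q] kk[OF xI x(1)] by
        (auto simp: sI_pos)
      have "cmod (LINT t:{c..<x}|\<rho>. k t) \<le> (LINT t:{c..<q}|\<rho>. cmod (k t))"
        unfolding set_lebesgue_integral_def
        by (rule Bochner_Integration.integral_norm_bound_integral)
           (use ik x integrable_norm[OF ik(1)[unfolded set_integrable_def]] in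
             \<open>auto simp: set_integrable_def indicator_def\<close>)
      thus ?thesis by (simp add: sint_pos)
    qed
    have h0B: "cmod (h0 x) \<le> B0" if "c \<le> x" "x \<le> q" for x
      using Bk[OF that] norm_triangle_ineq4[of d2 "sint (pos \<rho>) c x k"] by (simp add: h0_def B0_def)
    define C where "C = max (cmod d1) B0"
    have C: "0 \<le> C" "cmod d1 \<le> C" "B0 \<le> C" unfolding C_def using norm_ge_zero[of d1] by linarith+
    have diff: "\<forall>x. c \<le> x \<and> x \<le> q \<longrightarrow> cmod (F (Suc n) x - F n x) \<le> C / 2 ^ n * E x \<and> cmod (H (Suc n) x
      - H n x) \<le> C / 2 ^ n * E x" for n
    proof (induction n)
      case 0
      show ?case
      proof (intro allI impI)
        fix x assume x: "c \<le> x \<and> x \<le> q"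
        hence xI: "x \<in> I" using I_ab_between[OF c q(1)] by auto
        have CE: "u \<le> C \<Longrightarrow> u \<le> C * E t" for u t using mult_left_mono[OF E1(2)[of t] C(1)] by linarith
        have "cmod (sint \<sigma> c x h0) \<le> C * (2 * (1/4) * E x)"
        proof (rule sweight_bound[OF lfs_sig c q(1) E(1)])
          show "cmod (h0 t) \<le> C * E t" if "c \<le> t" "t < x" for t
            using CE[of "cmod (h0 t)" t] h0B[of t] that x C by auto
        qed (use x xI ih0 C in auto)
        moreover have "cmod (sint \<kappa> c x (\<lambda>_. d1)) \<le> C * (2 * (1/4) * E x)"
          by (rule sweight_bound[OF lfs_chi c q(1) E(2)]) (use x sI_const[OF lfs_chi c xI] C CE in auto)
        ultimately show "cmod (F (Suc 0) x - F 0 x) \<le> C / 2 ^ 0 * E x \<and> cmod (H (Suc 0) x - H 0 x)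
          \<le> C / 2 ^ 0 * E x"
          unfolding FS HS F0 H0 using mult_nonneg_nonneg[OF C(1) E0[of x]] by simp
      qed
    next
      case (Suc n)
      show ?case
      proof (intro allI impI)
        fix x assume x: "c \<le> x \<and> x \<le> q"
        hence xI: "x \<in> I" using I_ab_between[OF c q(1)] by auto
        have i: "sI \<sigma> c x (H m)" "sI \<kappa> c x (F m)" for m using int[OF xI] x by auto
        have "F (Suc (Suc n)) x - F (Suc n) x = sint \<sigma> c x (\<lambda>t. H (Suc n) t - H n t)"
          using sint_diff[OF i(1) i(1), of "Suc n" n] by (simp add: FS[of "Suc n"] FS[of n])
        moreover have "H (Suc (Suc n)) x - H (Suc n) x = sint \<kappa> c x (\<lambda>t. F (Suc n) t - F n t)"
          using sint_diff[OF i(2) i(2), of "Suc n" n] by (simp add: HS[of "Suc n"] HS[of n])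
        moreover have "cmod (sint \<sigma> c x (\<lambda>t. H (Suc n) t - H n t)) \<le> C / 2 ^ n * (2 * (1/4) * E x)"
          by (rule sweight_bound[OF lfs_sig c q(1) E(1)]) (use x Suc C sI_diff[OF i(1) i(1)] in auto)
        moreover have "cmod (sint \<kappa> c x (\<lambda>t. F (Suc n) t - F n t)) \<le> C / 2 ^ n * (2 * (1/4) * E x)"
          by (rule sweight_bound[OF lfs_chi c q(1) E(2)]) (use x Suc C sI_diff[OF i(2) i(2)] in auto)
        ultimately show "cmod (F (Suc (Suc n)) x - F (Suc n) x) \<le> C / 2 ^ Suc n * E x
          \<and> cmod (H (Suc (Suc n)) x - H (Suc n) x) \<le> C / 2 ^ Suc n * E x"
          by simp
      qed
    qed
    \<comment> \<open>Telescoping against the geometric series, whose sum is the constant 2.\<close>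
    have tele: "cmod (y n) \<le> cmod (y 0) + 2 * D \<and> convergent y" if "\<And>n. cmod (y (Suc n) - y n) \<le> D / 2 ^ n"
      for y :: "nat \<Rightarrow> complex" and D n
    proof
      have D: "0 \<le> D" using order_trans[OF norm_ge_zero that[of 0]] by simp
      have sm: "summable (\<lambda>n. D / 2 ^ n)" using summable_mult[OF summable_geometric[of "1/2::real"], of D]
        by (simp add: power_divide)
      have "(\<Sum>n. D / 2 ^ n) = 2 * D"
        using suminf_mult[OF summable_geometric[of "1/2::real"], of D] suminf_geometric[of "1/2::real"]
        by (simp add: power_divide)
      hence sle: "(\<Sum>i<n. D / 2 ^ i) \<le> 2 * D" for n using sum_le_suminf[OF sm, of "{..<n}"] D by auto
      have eq: "y n = y 0 + (\<Sum>i<n. y (Suc i) - y i)" for n by (simp add: sum_lessThan_telescope)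
      have "cmod (\<Sum>i<n. y (Suc i) - y i) \<le> (\<Sum>i<n. D / 2 ^ i)" by (rule sum_norm_le) (rule that)
      thus "cmod (y n) \<le> cmod (y 0) + 2 * D"
        using norm_triangle_ineq[of "y 0" "\<Sum>i<n. y (Suc i) - y i"] sle[of n] eq[of n] by simp
      have "summable (\<lambda>i. y (Suc i) - y i)" by (rule summable_comparison_test'[OF sm that])
      hence "convergent (\<lambda>n. \<Sum>i<n. y (Suc i) - y i)" by (simp add: summable_iff_convergent)
      hence "convergent (\<lambda>n. y 0 + (\<Sum>i<n. y (Suc i) - y i))" by (intro convergent_add convergent_const)
      moreover have "y = (\<lambda>n. y 0 + (\<Sum>i<n. y (Suc i) - y i))" by (rule ext) (rule eq)
      ultimately show "convergent y" by argo
    qed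
    show ?thesis
    proof (intro exI[of _ "C + 2 * (C * E q)"] allI impI)
      fix x assume x: "c \<le> x \<and> x \<le> q"
      have le: "C * E x \<le> C * E q" using C(1) monoD[OF E1(1)] x by (intro mult_left_mono) auto
      have "cmod (F n x) \<le> cmod (F 0 x) + 2 * (C * E x) \<and> convergent (\<lambda>n. F n x)" for n
        by (rule tele) (use diff x in auto)
      moreover have "cmod (H n x) \<le> cmod (H 0 x) + 2 * (C * E x) \<and> convergent (\<lambda>n. H n x)" for n
        by (rule tele) (use diff x in auto)
      moreover have "cmod (F 0 x) \<le> C" "cmod (H 0 x) \<le> C" using h0B[of x] x C by (auto simp: F0 H0)
      ultimately show "(\<forall>n. cmod (F n x) \<le> C + 2 * (C * E q) \<and> cmod (H n x) \<le> C + 2 * (C * E q)) \<and>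
          convergent (\<lambda>n. F n x) \<and> convergent (\<lambda>n. H n x)" using le
            by (meson add_mono mult_left_mono order_trans zero_le_numeral)
    qed
  qed
  define f where "f x = lim (\<lambda>n. F n x)" for x
  define h where "h x = lim (\<lambda>n. H n x)" for x
  have lim: "(\<lambda>n. F n x) \<longlonglongrightarrow> f x" "(\<lambda>n. H n x) \<longlonglongrightarrow> h x" if "x \<in> I" "c \<le> x" for x
    using key[OF that] that unfolding f_def h_def convergent_LIMSEQ_iff by auto
  have main: "sI \<sigma> c x h \<and> sI \<kappa> c x f \<and> f x = d1 + sint \<sigma> c x h \<and> h x = d2 + sint \<kappa> c x f
    - sint (pos \<rho>) c x k"
    if x: "x \<in> I" "c \<le> x" for x
  proof -
    obtain B where B: "\<And>t n. c \<le> t \<Longrightarrow> t \<le> x \<Longrightarrow> cmod (F n t) \<le> B" "\<And>t n. c \<le> t \<Longrightarrow> t \<le> x \<Longrightarrow> cmod (H n t) \<le> B"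
      using key[OF x] by blast
    have tI: "t \<in> I" if "c \<le> t" "t < x" for t using I_ab_between[OF c x(1), of t] that by auto
    have 1: "sI \<sigma> c x h" "(\<lambda>n. sint \<sigma> c x (H n)) \<longlonglongrightarrow> sint \<sigma> c x h"
      using sint_dominated[OF lfs_sig c x(1), of H h B] int[OF x] lim(2) tI B(2) by auto
    have 2: "sI \<kappa> c x f" "(\<lambda>n. sint \<kappa> c x (F n)) \<longlonglongrightarrow> sint \<kappa> c x f"
      using sint_dominated[OF lfs_chi c x(1), of F f B] int[OF x] lim(1) tI B(1) by auto
    have "(\<lambda>n. F (Suc n) x) \<longlonglongrightarrow> d1 + sint \<sigma> c x h" unfolding FS by (intro tendsto_add tendsto_const 1)
    hence "f x = d1 + sint \<sigma> c x h" using LIMSEQ_Suc[OF lim(1)[OF x]] LIMSEQ_unique by blast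
    moreover have "(\<lambda>n. H (Suc n) x) \<longlonglongrightarrow> h0 x + sint \<kappa> c x f" unfolding HS
      by (intro tendsto_add tendsto_const 2)
    hence "h x = h0 x + sint \<kappa> c x f" using LIMSEQ_Suc[OF lim(2)[OF x]] LIMSEQ_unique by blast
    ultimately show ?thesis using 1(1) 2(1) by (simp add: h0_def)
  qed
  show ?thesis
    by (rule exI[of _ f], rule exI[of _ h]) (use main main[OF c order_refl] in auto)
qed

end

section \<open>Fundamental systems, uniqueness and global solutions\<close>

context sturm_liouville begin

lemma I_convex: "\<forall>x\<in>I. \<forall>y\<in>I. {x..y} \<subseteq> I"
proof (intro ballI subsetI)
  fix x y t assume "x \<in> I" "y \<in> I" "t \<in> {x..y}"
  thus "t \<in> I" using I_ab_between[of x a b y t] by simp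
qed

lemma J_convex: "\<forall>x\<in>{x\<in>I. p \<le> x}. \<forall>y\<in>{x\<in>I. p \<le> x}. {x..y} \<subseteq> {x\<in>I. p \<le> x}"
proof (intro ballI subsetI)
  fix x y t assume "x \<in> {x\<in>I. p \<le> x}" "y \<in> {x\<in>I. p \<le> x}" "t \<in> {x..y}"
  thus "t \<in> {x\<in>I. p \<le> x}" using I_ab_between[of x a b y t] by simp
qed

definition loc_rho :: "(real \<Rightarrow> complex) \<Rightarrow> bool" where
  "loc_rho k \<longleftrightarrow> (\<forall>p\<in>I. \<forall>q\<in>I. sI (pos \<rho>) p q k)"

lemma qsol_forward:
  assumes c: "c \<in> I" and k: "loc_rho k"
  shows "\<exists>f h. f c = d1 \<and> h c = d2 \<and> qsol {x\<in>I. c \<le> x} f h k"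
proof -
  have kk: "\<And>q. q \<in> I \<Longrightarrow> c \<le> q \<Longrightarrow> sI (pos \<rho>) c q k" using k c by (auto simp: loc_rho_def)
  obtain f h where fh: "f c = d1" "h c = d2" and
    S: "\<And>x. x \<in> I \<Longrightarrow> c \<le> x \<Longrightarrow> sI \<sigma> c x h \<and> sI \<kappa> c x f \<and> f x = d1 + sint \<sigma> c x h \<and> h x = d2 + sint \<kappa> c x f
      - sint (pos \<rho>) c x k"
    using qsol_forward_aux[OF c kk, of d1 d2] by blast
  have "qsol {x\<in>I. c \<le> x} f h k"
  proof (rule qsolI)
    fix x y assume xy: "x \<in> {x\<in>I. c \<le> x}" "y \<in> {x\<in>I. c \<le> x}" "x \<le> y"
    hence I: "x \<in> I" "y \<in> I" "c \<le> x" "c \<le> y" by auto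
    note Sx = S[OF I(1,3)] and Sy = S[OF I(2,4)]
    have i: "sI \<sigma> c y h" "sI \<kappa> c y f" "sI (pos \<rho>) c y k" using Sy kk[OF I(2,4)] by auto
    note sp = sint_split[OF lfs_sig c I(1,2,3) xy(3) i(1)] sint_split[OF lfs_chi c I(1,2,3) xy(3) i(2)]
      sint_split[OF lfs_rho c I(1,2,3) xy(3) i(3)]
    have "sI \<sigma> x y h" "sI \<kappa> x y f" "sI (pos \<rho>) x y k"
      using sI_subset[OF lfs_sig I(1,2) i(1) I(3)] sI_subset[OF lfs_chi I(1,2) i(2) I(3)] sI_subset[OF
        lfs_rho I(1,2) i(3) I(3)] by auto
    moreover have "f y = f x + sint \<sigma> x y h" using Sx Sy sp(1) by auto
    moreover have "h y = h x + sint \<kappa> x y f - sint (pos \<rho>) x y k" using Sx Sy sp(2,3) by auto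
    ultimately show "sI \<sigma> x y h \<and> sI \<kappa> x y f \<and> sI (pos \<rho>) x y k \<and>
         f y = f x + sint \<sigma> x y h \<and> h y = h x + sint \<kappa> x y f - sint (pos \<rho>) x y k" by blast
  qed
  thus ?thesis using fh by blast
qed

lemma loc_rho_0: "loc_rho (\<lambda>_. 0)"
  by (simp add: loc_rho_def sI_def set_integrable_def)

lemma qsol_wronskian_const:
  assumes J: "J \<subseteq> I" "\<forall>x\<in>J. \<forall>y\<in>J. {x..y} \<subseteq> J" and 1: "qsol J f1 h1 (\<lambda>_. 0)" and 2: "qsol J f2 h2 (\<lambda>_. 0)"
    and x: "x \<in> J" and y: "y \<in> J"
  shows "f1 x * h2 x - h1 x * f2 x = f1 y * h2 y - h1 y * f2 y"
proof -
  have *: "f1 x * h2 x - h1 x * f2 x = f1 y * h2 y - h1 y * f2 y" if "x \<in> J" "y \<in> J" "x \<le> y" for x y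
    using qsol_lagrange(2)[OF J(1) 1 2 that] J(2) that by simp
  show ?thesis
  proof (cases "x \<le> y")
    case True show ?thesis by (rule *[OF x y True])
  next
    case False thus ?thesis by (intro *[OF y x, symmetric]) simp
  qed
qed

text \<open>Cramer's rule for a system of determinant 1: the coefficients of the vector
  \<open>(d, e)\<close> are its determinants with the two basis vectors, that is,
  Wronskians.\<close>

lemma plucker_solve:
  fixes d e u1 v1 u2 v2 :: complex
  assumes "u1 * v2 - v1 * u2 = 1"
  shows "d = u1 * (d * v2 - e * u2) - u2 * (d * v1 - e * u1)" "e = v1 * (d * v2 - e * u2) - v2 * (d * v1
    - e * u1)"
proof -
  have "u1 * (d * v2 - e * u2) - u2 * (d * v1 - e * u1) = d * (u1 * v2 - v1 * u2)"
    "v1 * (d * v2 - e * u2) - v2 * (d * v1 - e * u1) = e * (u1 * v2 - v1 * u2)" by algebra+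
  thus "d = u1 * (d * v2 - e * u2) - u2 * (d * v1 - e * u1)" "e = v1 * (d * v2 - e * u2) - v2 * (d * v1
    - e * u1)"
    using assms by simp_all
qed

definition fundamental :: "real set \<Rightarrow> (real \<Rightarrow> complex) \<Rightarrow> (real \<Rightarrow> complex) \<Rightarrow> (real \<Rightarrow> complex) \<Rightarrow> (real \<Rightarrow> complex) \<Rightarrow> bool" where
  "fundamental J u1 v1 u2 v2 \<longleftrightarrow> qsol J u1 v1 (\<lambda>_. 0) \<and> qsol J u2 v2 (\<lambda>_. 0) \<and> (\<forall>x\<in>J. u1 x * v2 x
    - v1 x * u2 x = 1)"

text \<open>The Wronskians of \<open>(d, e)\<close> with both fundamental solutions vanish at
  \<open>c\<close>, hence on all of \<open>J\<close>, and Cramer's rule recovers \<open>d\<close>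
  and \<open>e\<close> from them. No Gronwall estimate is involved, and the argument is indifferent
  to the side of \<open>c\<close> on which \<open>x\<close> lies.\<close>

lemma qsol_zero_unique:
  assumes J: "J \<subseteq> I" "\<forall>x\<in>J. \<forall>y\<in>J. {x..y} \<subseteq> J" and F: "fundamental J u1 v1 u2 v2"
    and d: "qsol J d e (\<lambda>_. 0)" and c: "c \<in> J" "d c = 0" "e c = 0" and x: "x \<in> J"
  shows "d x = 0" "e x = 0"
proof -
  have u: "qsol J u1 v1 (\<lambda>_. 0)" "qsol J u2 v2 (\<lambda>_. 0)" "u1 x * v2 x - v1 x * u2 x = 1"
    using F x by (auto simp: fundamental_def)
  have P: "d x * v1 x - e x * u1 x = 0" "d x * v2 x - e x * u2 x = 0"
    using qsol_wronskian_const[OF J d u(1) x c(1)] qsol_wronskian_const[OF J d u(2) x c(1)] c by auto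
  thus "d x = 0" "e x = 0" using plucker_solve[OF u(3), where d="d x" and e="e x"] unfolding P by simp_all
qed

lemma qsol_unique:
  assumes J: "J \<subseteq> I" "\<forall>x\<in>J. \<forall>y\<in>J. {x..y} \<subseteq> J" and F: "fundamental J u1 v1 u2 v2"
    and 1: "qsol J f h k" and 2: "qsol J f' h' k" and c: "c \<in> J" "f c = f' c" "h c = h' c" and x: "x \<in> J"
  shows "f x = f' x" "h x = h' x"
proof -
  have "qsol J (\<lambda>x. f x + -1 * f' x) (\<lambda>x. h x + -1 * h' x) (\<lambda>x. k x + -1 * k x)"
    by (rule qsol_add[OF 1 qsol_cmult[OF 2]])
  hence d: "qsol J (\<lambda>x. f x - f' x) (\<lambda>x. h x - h' x) (\<lambda>x. 0)" by simp
  show "f x = f' x" "h x = h' x" using qsol_zero_unique[OF J F d c(1) _ _ x] c by simp_all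
qed

lemma fundamental_forward:
  assumes p: "p \<in> I"
  shows "\<exists>u1 v1 u2 v2. fundamental {x\<in>I. p \<le> x} u1 v1 u2 v2"
proof -
  let ?J = "{x\<in>I. p \<le> x}"
  obtain u1 v1 where 1: "u1 p = 1" "v1 p = 0" "qsol ?J u1 v1 (\<lambda>_. 0)"
    using qsol_forward[OF p loc_rho_0, of 1 0] by blast
  obtain u2 v2 where 2: "u2 p = 0" "v2 p = 1" "qsol ?J u2 v2 (\<lambda>_. 0)"
    using qsol_forward[OF p loc_rho_0, of 0 1] by blast
  note oc = J_convex[of p]
  have "u1 x * v2 x - v1 x * u2 x = 1" if "x \<in> ?J" for x
    using qsol_wronskian_const[of ?J, OF _ oc 1(3) 2(3) that, of p] p 1 2 by auto
  thus ?thesis using 1 2 unfolding fundamental_def by blast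
qed

text \<open>To the left of \<open>c\<close> the value at \<open>x\<close> is read off the forward solution starting at \<open>x\<close> that has the
  prescribed data at \<open>c\<close>; so the system never has to be solved backwards, where it is implicit at atoms.\<close>
lemma qsol_exists:
  assumes c: "c \<in> I" and k: "loc_rho k"
  shows "\<exists>f h. f c = d1 \<and> h c = d2 \<and> qsol I f h k"
proof -
  define J where "J p = {x\<in>I. p \<le> x}" for p
  have JI: "J p \<subseteq> I" for p by (auto simp: J_def)
  have oc: "\<forall>x\<in>J p. \<forall>y\<in>J p. {x..y} \<subseteq> J p" for p unfolding J_def by (rule J_convex)
  have "\<exists>f h. f c = d1 \<and> h c = d2 \<and> qsol (J p) f h k" if p: "p \<in> I" "p \<le> c" for p
  proof -
    have cJ: "c \<in> J p" using c p by (simp add: J_def)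
    obtain u1 v1 u2 v2 where F: "fundamental (J p) u1 v1 u2 v2" using fundamental_forward[OF p(1)]
      unfolding J_def by blast
    obtain f h where f: "qsol (J p) f h k" using qsol_forward[OF p(1) k] unfolding J_def by blast
    have u: "qsol (J p) u1 v1 (\<lambda>_. 0)" "qsol (J p) u2 v2 (\<lambda>_. 0)" "u1 c * v2 c - v1 c * u2 c = 1"
      using F cJ by (auto simp: fundamental_def)
    \<comment> \<open>A forward solution from \<open>p\<close> with arbitrary data misses the data
      at \<open>c\<close>; the defect is written by Cramer's rule as a combination of the
      fundamental solutions and added.\<close>
    define s t where "s = (d1 - f c) * v2 c - (d2 - h c) * u2 c"
      and "t = - ((d1 - f c) * v1 c - (d2 - h c) * u1 c)"
    have "qsol (J p) (\<lambda>x. f x + (s * u1 x + t * u2 x)) (\<lambda>x. h x + (s * v1 x + t * v2 x)) (\<lambda>x. k x + (s * 0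
      + t * 0))"
      by (intro qsol_add qsol_cmult f u)
    hence "qsol (J p) (\<lambda>x. f x + (s * u1 x + t * u2 x)) (\<lambda>x. h x + (s * v1 x + t * v2 x)) k" by simp
    moreover have "f c + (s * u1 c + t * u2 c) = d1" "h c + (s * v1 c + t * v2 c) = d2"
      using plucker_solve[OF u(3), where d="d1 - f c" and e="d2 - h c"] by
        (simp_all add: s_def t_def algebra_simps)
    ultimately show ?thesis by (intro exI[of _ "\<lambda>x. f x + (s * u1 x + t * u2 x)"] exI[of _ "\<lambda>x. h x
      + (s * v1 x + t * v2 x)"]) simp
  qed
  then obtain \<Phi> \<Psi> where \<Phi>: "\<And>p. p \<in> I \<Longrightarrow> p \<le> c \<Longrightarrow> \<Phi> p c = d1 \<and> \<Psi> p c = d2 \<and> qsol (J p) (\<Phi> p) (\<Psi> p) k"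
    by metis
  define f where "f x = \<Phi> (min x c) x" for x
  define h where "h x = \<Psi> (min x c) x" for x
  \<comment> \<open>The pieces fit together: two of them share their data at \<open>c\<close>, hence
    agree to the right of the larger starting point by uniqueness there. So near any two points a
    single piece can be used.\<close>
  have eq: "f x = \<Phi> p x \<and> h x = \<Psi> p x" if p: "p \<in> I" "p \<le> c" and x: "x \<in> J p" for p x
  proof -
    define m where "m = min x c"
    have xI: "x \<in> I" using x JI by auto
    have m: "m \<in> I" "m \<le> c" "p \<le> m" "x \<in> J m" "c \<in> J m" using xI c p x by (auto simp: m_def min_def J_def)
    obtain u1 v1 u2 v2 where F: "fundamental (J m) u1 v1 u2 v2" using fundamental_forward[OF m(1)]
      unfolding J_def by blast
    have q: "qsol (J m) (\<Phi> p) (\<Psi> p) k" using \<Phi>[OF p] m(3) by (auto intro: qsol_mono simp: J_def)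
    show ?thesis using qsol_unique[OF JI oc F _ q m(5) _ _ m(4), of "\<Phi> m" "\<Psi> m"] \<Phi>[OF p] \<Phi>[OF m(1,2)]
      unfolding f_def h_def m_def[symmetric] by auto
  qed
  have "qsol I f h k"
  proof (rule qsolI)
    fix x y assume xy: "x \<in> I" "y \<in> I" "x \<le> y"
    define p where "p = min x c"
    have p: "p \<in> I" "p \<le> c" "x \<in> J p" "y \<in> J p" using xy c by (auto simp: p_def J_def min_def)
    have Q: "qsol (J p) (\<Phi> p) (\<Psi> p) k" using \<Phi>[OF p(1,2)] by simp
    have e: "f t = \<Phi> p t" "h t = \<Psi> p t" if "x \<le> t" "t \<le> y" for t
    proof -
      have "t \<in> J p" using oc[of p] p(3,4) that by (meson atLeastAtMost_iff subsetD)
      thus "f t = \<Phi> p t" "h t = \<Psi> p t" using eq[OF p(1,2)] by auto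
    qed
    have c1: "sI \<sigma> x y h = sI \<sigma> x y (\<Psi> p)" "sI \<kappa> x y f = sI \<kappa> x y (\<Phi> p)" by (intro sI_cong; simp add: e)+
    have c2: "sint \<sigma> x y h = sint \<sigma> x y (\<Psi> p)" "sint \<kappa> x y f = sint \<kappa> x y (\<Phi> p)"
      by (intro sint_cong; simp add: e)+
    show "sI \<sigma> x y h \<and> sI \<kappa> x y f \<and> sI (pos \<rho>) x y k \<and> f y = f x + sint \<sigma> x y h \<and> h y = h x + sint \<kappa> x y f
      - sint (pos \<rho>) x y k"
      unfolding c1 c2 e[OF order_refl xy(3)] e[OF xy(3) order_refl]
      using qsolD[OF Q p(3,4) xy(3)] by blast
  qed
  moreover have "f c = d1" "h c = d2" using \<Phi>[OF c order_refl] by (auto simp: f_def h_def)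
  ultimately show ?thesis by blast
qed

lemma I_nonempty: "\<exists>c. c \<in> I"
  using ereal_dense2[OF ab] by (auto simp: I_ab_def)

lemma fundamental_exists:
  assumes c: "c \<in> I"
  shows "\<exists>u1 v1 u2 v2. fundamental I u1 v1 u2 v2 \<and> u1 c = 1 \<and> v1 c = 0 \<and> u2 c = 0 \<and> v2 c = 1"
proof -
  obtain u1 v1 where 1: "u1 c = 1" "v1 c = 0" "qsol I u1 v1 (\<lambda>_. 0)"
    using qsol_exists[OF c loc_rho_0, of 1 0] by blast
  obtain u2 v2 where 2: "u2 c = 0" "v2 c = 1" "qsol I u2 v2 (\<lambda>_. 0)"
    using qsol_exists[OF c loc_rho_0, of 0 1] by blast
  have "u1 x * v2 x - v1 x * u2 x = 1" if "x \<in> I" for x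
    using qsol_wronskian_const[OF order_refl I_convex 1(3) 2(3) that c] 1 2 by auto
  thus ?thesis using 1 2 unfolding fundamental_def by blast
qed

end

section \<open>The maximal domain\<close>

lemma sint_left_cont:
  assumes \<mu>: "lfs a b \<mu>" and p: "p \<in> I_ab a b" and y: "y \<in> I_ab a b" and py: "p < y" and i: "sI \<mu> p y h"
  shows "((\<lambda>x. sint \<mu> p x h) \<longlongrightarrow> sint \<mu> p y h) (at_left y)"
proof (rule tendsto_at_left_sequentially[OF py])
  fix S :: "nat \<Rightarrow> real"
  assume S: "\<And>n. S n < y" "\<And>n. p < S n" "incseq S" "S \<longlonglongrightarrow> y"
  have SI: "S n \<in> I_ab a b" for n using I_ab_between[OF p y, of "S n"] S(1)[of n] S(2)[of n] by auto
  have inc: "incseq (\<lambda>n. {p..<S n})" using S(3) by (auto simp: incseq_def intro: order.strict_trans2)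
  have un: "(\<Union>n. {p..<S n}) = {p..<y}"
  proof (intro set_eqI iffI)
    fix t assume "t \<in> {p..<y}"
    hence "eventually (\<lambda>n. t < S n) sequentially" using order_tendstoD(1)[OF S(4)] by auto
    then obtain n where "t < S n" by (auto simp: eventually_sequentially)
    thus "t \<in> (\<Union>n. {p..<S n})" using \<open>t \<in> {p..<y}\<close> by auto
  next
    fix t assume "t \<in> (\<Union>n. {p..<S n})"
    then obtain n where "p \<le> t" "t < S n" by auto
    thus "t \<in> {p..<y}" using S(1)[of n] by auto
  qed
  show "(\<lambda>n. sint \<mu> p (S n) h) \<longlonglongrightarrow> sint \<mu> p y h"
    unfolding sint_def
    using set_integral_cont_up[of "\<lambda>n. {p..<S n}" "fst \<mu>" h] set_integral_cont_up[of "\<lambda>n. {p..<S n}" "snd \<mu>"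
      h]
      lfs_Ico[OF \<mu> p SI] inc i unfolding un sI_def
    by (intro tendsto_diff) auto
qed

text \<open>As \<open>x\<close> decreases to \<open>y\<close> the intervals \<open>[y, x)\<close>
  shrink to \<open>{y}\<close> and not to the empty set. The limit is the jump at \<open>y\<close>,
  which can be nonzero only if \<open>y\<close> is an atom.\<close>

lemma sint_right_lim:
  assumes \<mu>: "lfs a b \<mu>" and y: "y \<in> I_ab a b" and q: "q \<in> I_ab a b" and yq: "y < q" and i: "sI \<mu> y q h"
  shows "\<exists>L. ((\<lambda>x. sint \<mu> y x h) \<longlongrightarrow> L) (at_right y) \<and> (measure (fst \<mu>) {y} = 0 \<longrightarrow> measure (snd \<mu>) {y} = 0 \<longrightarrow> L
    = 0)"
proof -
  let ?L = "(LINT t:{y}|fst \<mu>. h t) - (LINT t:{y}|snd \<mu>. h t)"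
  have m: "lf_measure_on a b (fst \<mu>)" "lf_measure_on a b (snd \<mu>)" using \<mu> by (auto simp: lfs_def)
  have L: "((\<lambda>x. sint \<mu> y x h) \<longlongrightarrow> ?L) (at_right y)"
  proof (rule tendsto_at_right_sequentially[OF yq])
    fix S :: "nat \<Rightarrow> real"
    assume S: "\<And>n. y < S n" "\<And>n. S n < q" "decseq S" "S \<longlonglongrightarrow> y"
    have SI: "S n \<in> I_ab a b" for n using I_ab_between[OF y q, of "S n"] S(1)[of n] S(2)[of n] by auto
    have dec: "decseq (\<lambda>n. {y..<S n})" using S(3) by (auto simp: decseq_def intro: order.strict_trans2)
    have un: "(\<Inter>n. {y..<S n}) = {y}"
    proof (intro set_eqI iffI)
      fix t assume t: "t \<in> (\<Inter>n. {y..<S n})"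
      hence "y \<le> t" by auto
      moreover have "t \<le> y" by (rule LIMSEQ_le_const[OF S(4)]) (use t in \<open>auto intro: less_imp_le\<close>)
      ultimately show "t \<in> {y}" by simp
    qed (use S(1) in auto)
    have i0: "sI \<mu> y (S 0) h" using sI_subset[OF \<mu> y SI[of 0] i] S(2)[of 0] by auto
    show "(\<lambda>n. sint \<mu> y (S n) h) \<longlonglongrightarrow> ?L"
      unfolding sint_def
      using set_integral_cont_down[of "\<lambda>n. {y..<S n}" "fst \<mu>" h] set_integral_cont_down[of "\<lambda>n. {y..<S n}"
        "snd \<mu>" h]
        lfs_Ico[OF \<mu> y SI] dec i0 unfolding un sI_def
      by (intro tendsto_diff) auto
  qed
  have z: "(LINT t:{y}|M. h t) = 0" if M: "lf_measure_on a b M" and "measure M {y} = 0" for M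
  proof -
    have s: "{y} \<in> sets M" using y by (intro lf_sets[OF M]) auto
    have "emeasure M {y} < \<infinity>" using lf_finite(1)[OF M y y] by simp
    hence "emeasure M {y} = 0" using that(2) by (auto simp: measure_def enn2real_eq_0_iff)
    hence "AE t in M. t \<notin> {y}" using s by (intro AE_not_in) auto
    thus ?thesis unfolding set_lebesgue_integral_def by (intro integral_eq_zero_AE) auto
  qed
  show ?thesis using L z[OF m(1)] z[OF m(2)] by (intro exI[of _ ?L]) simp
qed

lemma scint_diff:
  assumes \<mu>: "lfs a b \<mu>" and c: "c \<in> I_ab a b" and x: "x \<in> I_ab a b" and y: "y \<in> I_ab a b" and xy: "x \<le> y"
    and i: "\<And>p q. p \<in> I_ab a b \<Longrightarrow> q \<in> I_ab a b \<Longrightarrow> sI \<mu> p q h"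
  shows "scint \<mu> c y h = scint \<mu> c x h + sint \<mu> x y h"
proof -
  have s: "scint \<mu> c t h = (if c \<le> t then sint \<mu> c t h else - sint \<mu> t c h)" for t
    by (simp add: scint_def cint_def sint_def)
  consider "c \<le> x" | "x < c" "c \<le> y" | "y < c" by linarith
  thus ?thesis
  proof cases
    case 1 thus ?thesis using sint_split[OF \<mu> c x y 1 xy i[OF c y]] xy by (simp add: s)
  next
    case 2 thus ?thesis using sint_split[OF \<mu> x c y _ 2(2) i[OF x y]] xy by (simp add: s)
  next
    case 3 thus ?thesis using sint_split[OF \<mu> x y c xy _ i[OF x c]] xy by (simp add: s)
  qed
qed

lemma sloc_int_iff:
  assumes \<mu>: "lfs a b \<mu>"
  shows "sloc_int a b \<mu> h \<longleftrightarrow> (\<forall>p\<in>I_ab a b. \<forall>q\<in>I_ab a b. sI \<mu> p q h)"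
proof
  assume L: "sloc_int a b \<mu> h"
  show "\<forall>p\<in>I_ab a b. \<forall>q\<in>I_ab a b. sI \<mu> p q h"
  proof (intro ballI)
    fix p q assume pq: "p \<in> I_ab a b" "q \<in> I_ab a b"
    have "set_integrable (fst \<mu>) {p..q} h" "set_integrable (snd \<mu>) {p..q} h"
      using L pq by (auto simp: sloc_int_def I_ab_def)
    thus "sI \<mu> p q h" unfolding sI_def using lfs_Ico[OF \<mu> pq] by (auto intro: set_integrable_subset)
  qed
next
  assume R: "\<forall>p\<in>I_ab a b. \<forall>q\<in>I_ab a b. sI \<mu> p q h"
  have m: "lf_measure_on a b (fst \<mu>)" "lf_measure_on a b (snd \<mu>)" using \<mu> by (auto simp: lfs_def)
  show "sloc_int a b \<mu> h" unfolding sloc_int_def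
  proof (intro allI impI)
    fix \<alpha> \<beta> assume ab: "a < ereal \<alpha>" "ereal \<beta> < b"
    show "set_integrable (fst \<mu>) {\<alpha>..\<beta>} h \<and> set_integrable (snd \<mu>) {\<alpha>..\<beta>} h"
    proof (cases "\<alpha> \<le> \<beta>")
      case True
      obtain \<beta>' where b': "\<beta> < \<beta>'" "ereal \<beta>' < b" using ereal_dense2[OF ab(2)] by auto
      have aI: "\<alpha> \<in> I_ab a b" using ab True by
        (auto simp: I_ab_def intro: le_less_trans[of "ereal \<alpha>" "ereal \<beta>" b])
      have bI: "\<beta>' \<in> I_ab a b" using ab True b' by
        (auto simp: I_ab_def intro: less_trans[of a "ereal \<alpha>" "ereal \<beta>'"])
      have sub: "{\<alpha>..\<beta>} \<subseteq> {\<alpha>..<\<beta>'}" using b' by auto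
      have "{\<alpha>..\<beta>} \<subseteq> I_ab a b" using sub Ico_sub_I[OF aI bI] by blast
      hence "{\<alpha>..\<beta>} \<in> sets (fst \<mu>)" "{\<alpha>..\<beta>} \<in> sets (snd \<mu>)" using lf_sets[OF m(1)] lf_sets[OF m(2)] by auto
      thus ?thesis using R aI bI sub unfolding sI_def by (blast intro: set_integrable_subset)
    qed simp
  qed
qed

text \<open>Trades the base point and the oriented integral for increments over all ordered pairs,
  the shape in which \<open>qsol\<close> is written.\<close>

lemma is_deriv_iff:
  assumes \<mu>: "lfs a b \<mu>" and ne: "I_ab a b \<noteq> {}"
  shows "is_deriv a b \<mu> f h \<longleftrightarrow> (\<forall>p\<in>I_ab a b. \<forall>q\<in>I_ab a b. sI \<mu> p q h) \<and>
    (\<forall>x\<in>I_ab a b. \<forall>y\<in>I_ab a b. x \<le> y \<longrightarrow> f y = f x + sint \<mu> x y h)"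
proof (cases "\<forall>p\<in>I_ab a b. \<forall>q\<in>I_ab a b. sI \<mu> p q h")
  case True
  hence i: "\<And>p q. p \<in> I_ab a b \<Longrightarrow> q \<in> I_ab a b \<Longrightarrow> sI \<mu> p q h" by blast
  have "(\<exists>c\<in>I_ab a b. \<forall>x\<in>I_ab a b. f x = f c + scint \<mu> c x h) \<longleftrightarrow>
    (\<forall>x\<in>I_ab a b. \<forall>y\<in>I_ab a b. x \<le> y \<longrightarrow> f y = f x + sint \<mu> x y h)" (is "?A \<longleftrightarrow> ?B")
  proof
    assume ?A
    then obtain c where c: "c \<in> I_ab a b" and e: "\<And>x. x \<in> I_ab a b \<Longrightarrow> f x = f c + scint \<mu> c x h" by blast
    show ?B
    proof (intro ballI impI)
      fix x y assume xy: "x \<in> I_ab a b" "y \<in> I_ab a b" "x \<le> y"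
      show "f y = f x + sint \<mu> x y h"
        using e[OF xy(1)] e[OF xy(2)] scint_diff[OF \<mu> c xy i] by simp
    qed
  next
    assume B: ?B
    from ne obtain c where c: "c \<in> I_ab a b" by blast
    have "f x = f c + scint \<mu> c x h" if x: "x \<in> I_ab a b" for x
    proof (cases "c \<le> x")
      case True
      hence "f x = f c + sint \<mu> c x h" using B c x by blast
      thus ?thesis using True by (simp add: scint_def cint_def sint_def)
    next
      case False
      hence "f c = f x + sint \<mu> x c h" using B c x by (meson not_le order_less_imp_le)
      thus ?thesis using False by (simp add: scint_def cint_def sint_def)
    qed
    thus ?A using c by blast
  qed
  thus ?thesis using True unfolding is_deriv_def sloc_int_iff[OF \<mu>] by argo
next
  case False thus ?thesis unfolding is_deriv_def sloc_int_iff[OF \<mu>] by argo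
qed

section \<open>The maximal domain as solution set of the system; one-sided limits\<close>

context sturm_liouville begin

lemma qd_rel_qsol:
  assumes "qd_rel a b \<rho> \<sigma> \<kappa> f h g"
  shows "qsol I f h g"
proof -
  have ne: "I \<noteq> {}" using I_nonempty by blast
  from assms obtain c where 1: "is_deriv a b \<sigma> f h" and 2: "sloc_int a b \<kappa> f" and c: "c \<in> I"
    and 3: "is_deriv a b (pos \<rho>) (\<lambda>x. - h x + scint \<kappa> c x f) g" unfolding qd_rel_def by blast
  note 1 = 1[unfolded is_deriv_iff[OF lfs_sig ne]] and 2 = 2[unfolded sloc_int_iff[OF lfs_chi]]
    and 3 = 3[unfolded is_deriv_iff[OF lfs_rho ne]]
  show ?thesis
  proof (rule qsolI)
    fix x y assume xy: "x \<in> I" "y \<in> I" "x \<le> y"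
    have "- h y + scint \<kappa> c y f = - h x + scint \<kappa> c x f + sint (pos \<rho>) x y g" using 3 xy by blast
    moreover have "scint \<kappa> c y f = scint \<kappa> c x f + sint \<kappa> x y f" using 2
      by (intro scint_diff[OF lfs_chi c xy]) blast
    ultimately have "h y = h x + sint \<kappa> x y f - sint (pos \<rho>) x y g" by (simp add: algebra_simps)
    moreover have "f y = f x + sint \<sigma> x y h" "sI \<sigma> x y h" using 1 xy by blast+
    moreover have "sI \<kappa> x y f" "sI (pos \<rho>) x y g" using 2 3 xy by blast+
    ultimately show "sI \<sigma> x y h \<and> sI \<kappa> x y f \<and> sI (pos \<rho>) x y g \<and> f y = f x + sint \<sigma> x y h \<and> h y = h x
      + sint \<kappa> x y f - sint (pos \<rho>) x y g"
      by blast
  qed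
qed

lemma qsol_sI:
  assumes q: "qsol I f h g" and x: "x \<in> I" and y: "y \<in> I"
  shows "sI \<sigma> x y h" "sI \<kappa> x y f" "sI (pos \<rho>) x y g"
proof -
  have E: "sI \<mu> x y k" if "\<not> x \<le> y" for \<mu> k
  proof -
    have "{x..<y} = {}" using that by auto
    thus ?thesis by (simp add: sI_def)
  qed
  show "sI \<sigma> x y h" "sI \<kappa> x y f" "sI (pos \<rho>) x y g"
    using qsolD(1,2,3)[OF q x y] E by (cases "x \<le> y"; blast)+
qed

lemma I_left: "y \<in> I \<Longrightarrow> \<exists>p\<in>I. p < y" and I_right: "y \<in> I \<Longrightarrow> \<exists>p\<in>I. y < p"
proof -
  assume y: "y \<in> I"
  obtain p where p: "a < ereal p" "p < y" using y ereal_dense2[of a "ereal y"] by (auto simp: I_ab_def)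
  show "\<exists>p\<in>I. p < y" using p y by (intro bexI[of _ p])
    (auto simp: I_ab_def intro: less_trans[of "ereal p" "ereal y" b])
next
  assume y: "y \<in> I"
  obtain p where p: "y < p" "ereal p < b" using y ereal_dense2[of "ereal y" b] by (auto simp: I_ab_def)
  show "\<exists>p\<in>I. y < p" using p y by (intro bexI[of _ p])
    (auto simp: I_ab_def intro: less_trans[of a "ereal y" "ereal p"])
qed

lemma qsol_left_cont:
  assumes q: "qsol I f h g" and y: "y \<in> I"
  shows "(f \<longlongrightarrow> f y) (at_left y)" "(h \<longlongrightarrow> h y) (at_left y)"
proof -
  obtain p where p: "p \<in> I" "p < y" using I_left[OF y] by blast
  have ev: "eventually (\<lambda>x. p < x \<and> x < y) (at_left y)"
    using eventually_at_left[OF p(2)] p(2) by blast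
  have e: "f x = f p + sint \<sigma> p x h \<and> h x = h p + sint \<kappa> p x f - sint (pos \<rho>) p x g" if "p < x" "x < y"
    for x
  proof -
    have "x \<in> I" using I_ab_between[OF p(1) y, of x] that by simp
    thus ?thesis using qsolD(4,5)[OF q p(1), of x] that by simp
  qed
  note L = sint_left_cont[OF _ p(1) y p(2)]
  have ey: "f y = f p + sint \<sigma> p y h" "h y = h p + sint \<kappa> p y f - sint (pos \<rho>) p y g"
    using qsolD(4,5)[OF q p(1) y] p(2) by auto
  have "((\<lambda>x. f p + sint \<sigma> p x h) \<longlongrightarrow> f y) (at_left y)" unfolding ey
    by (intro tendsto_intros L[OF lfs_sig qsol_sI(1)[OF q p(1) y]])
  moreover have "eventually (\<lambda>x. f p + sint \<sigma> p x h = f x) (at_left y)" using ev by eventually_elim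
    (use e in metis)
  ultimately show "(f \<longlongrightarrow> f y) (at_left y)" by (rule Lim_transform_eventually)
  have "((\<lambda>x. h p + sint \<kappa> p x f - sint (pos \<rho>) p x g) \<longlongrightarrow> h y) (at_left y)" unfolding ey
    by (intro tendsto_intros L[OF lfs_chi qsol_sI(2)[OF q p(1) y]] L[OF lfs_rho qsol_sI(3)[OF q p(1) y]])
  moreover have "eventually (\<lambda>x. h p + sint \<kappa> p x f - sint (pos \<rho>) p x g = h x) (at_left y)" using ev
    by eventually_elim (use e in metis)
  ultimately show "(h \<longlongrightarrow> h y) (at_left y)" by (rule Lim_transform_eventually)
qed

text \<open>From the right \<open>f\<close> can jump only at atoms of \<sigma>, and these are not
  atoms of \<rho>. So at an atom of \<rho> a function vanishing almost everywhere also has right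
  limit 0, which the gap condition will ask for.\<close>

lemma qsol_right_lim:
  assumes q: "qsol I f h g" and y: "y \<in> I"
  shows "\<exists>L. (f \<longlongrightarrow> L) (at_right y) \<and> (measure \<rho> {y} \<noteq> 0 \<longrightarrow> L = f y)"
proof -
  obtain p where p: "p \<in> I" "y < p" using I_right[OF y] by blast
  have ev: "eventually (\<lambda>x. y < x \<and> x < p) (at_right y)"
    using eventually_at_right[OF p(2)] p(2) by blast
  have e: "f x = f y + sint \<sigma> y x h" if "y < x" "x < p" for x
  proof -
    have "x \<in> I" using I_ab_between[OF y p(1), of x] that by simp
    thus ?thesis using qsolD(4)[OF q y, of x] that by simp
  qed
  obtain L where L: "((\<lambda>x. sint \<sigma> y x h) \<longlongrightarrow> L) (at_right y)" "measure (fst \<sigma>) {y} = 0 \<longrightarrow> measure (snd \<sigma>) {y}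
    = 0 \<longrightarrow> L = 0"
    using sint_right_lim[OF lfs_sig y p(1) p(2) qsol_sI(1)[OF q y p(1)]] by blast
  have "((\<lambda>x. f y + sint \<sigma> y x h) \<longlongrightarrow> f y + L) (at_right y)" by (intro tendsto_intros L)
  moreover have "eventually (\<lambda>x. f y + sint \<sigma> y x h = f x) (at_right y)" using ev by eventually_elim
    (use e in metis)
  ultimately have "(f \<longlongrightarrow> f y + L) (at_right y)" by (rule Lim_transform_eventually)
  moreover have "measure \<rho> {y} \<noteq> 0 \<longrightarrow> L = 0"
    using pts_rho y signed_on_atom[OF sig y] L(2) by auto
  ultimately show ?thesis by (intro exI[of _ "f y + L"]) auto
qed

lemma qsol_qd_rel:
  assumes q: "qsol I f h g"
  shows "qd_rel a b \<rho> \<sigma> \<kappa> f h g"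
  unfolding qd_rel_def
proof (intro conjI)
  have ne: "I \<noteq> {}" using I_nonempty by blast
  show "\<forall>x\<in>I. (f \<longlongrightarrow> f x) (at_left x)" using qsol_left_cont[OF q] by blast
  show "is_deriv a b \<sigma> f h" unfolding is_deriv_iff[OF lfs_sig ne] using qsol_sI[OF q] qsolD(4)[OF q]
    by blast
  show "sloc_int a b \<kappa> f" unfolding sloc_int_iff[OF lfs_chi] using qsol_sI[OF q] by blast
  obtain c where c: "c \<in> I" using I_nonempty by blast
  have "- h y + scint \<kappa> c y f = - h x + scint \<kappa> c x f + sint (pos \<rho>) x y g" if xy: "x \<in> I" "y \<in> I" "x \<le> y"
    for x y
  proof -
    have "scint \<kappa> c y f = scint \<kappa> c x f + sint \<kappa> x y f"
      by (rule scint_diff[OF lfs_chi c xy]) (rule qsol_sI(2)[OF q])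
    thus ?thesis using qsolD(5)[OF q xy] by simp
  qed
  hence "is_deriv a b (pos \<rho>) (\<lambda>x. - h x + scint \<kappa> c x f) g" unfolding is_deriv_iff[OF lfs_rho ne]
    using qsol_sI[OF q] by blast
  thus "\<exists>c\<in>I. is_deriv a b (pos \<rho>) (\<lambda>x. - h x + scint \<kappa> c x f) g" using c by blast
qed

lemma qd_rel_iff: "qd_rel a b \<rho> \<sigma> \<kappa> f h g \<longleftrightarrow> qsol I f h g"
  using qd_rel_qsol qsol_qd_rel by blast

end

section \<open>Uniqueness of the quasi-derivative\<close>

text \<open>The half-open intervals form an intersection-stable generator, so vanishing integrals
  over them extend to all Borel subsets. That only equates the integrals against the two Jordan
  parts; testing with \<open>C \<inter> A\<close> and \<open>C - A\<close>, where \<open>A\<close>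
  carries the positive part and is null for the negative one, makes both vanish separately.\<close>

lemma sint_zero_imp_AE_zero:
  assumes \<mu>: "signed_on a b \<mu>" and p: "p \<in> I_ab a b" and q: "q \<in> I_ab a b" and i: "sI \<mu> p q D"
    and z: "\<And>x y. p \<le> x \<Longrightarrow> x \<le> y \<Longrightarrow> y \<le> q \<Longrightarrow> sint \<mu> x y D = 0"
  shows "AE t in fst \<mu>. t \<in> {p..<q} \<longrightarrow> D t = 0" "AE t in snd \<mu>. t \<in> {p..<q} \<longrightarrow> D t = 0"
proof -
  let ?M = "fst \<mu>" and ?N = "snd \<mu>" and ?K = "{p..<q}"
  from \<mu> obtain A where l: "lf_measure_on a b ?M" "lf_measure_on a b ?N" and A: "A \<in> sets ?M"
    "emeasure ?M (space ?M - A) = 0" "emeasure ?N A = 0"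
    unfolding signed_on_def by blast
  have lfs: "lfs a b \<mu>" using l by (simp add: lfs_def)
  have sM: "sets ?M = sets (restrict_space borel (I_ab a b))" and sN: "sets ?N = sets ?M" using l by
    (auto simp: lf_measure_on_def)
  have K: "?K \<in> sets ?M" "?K \<in> sets ?N" using lfs_Ico[OF lfs p q] by auto
  have KI: "?K \<subseteq> I_ab a b" by (rule Ico_sub_I[OF p q])
  have iM: "set_integrable ?M ?K D" and iN: "set_integrable ?N ?K D" using i by (auto simp: sI_def)
  have BK: "B \<inter> ?K \<in> sets ?M" if "B \<in> sets borel" for B
    using lf_sets[OF l(1), of "B \<inter> ?K"] that KI by auto
  have iMB: "set_integrable ?M (B \<inter> ?K) D" and iNB: "set_integrable ?N (B \<inter> ?K) D" if "B \<in> sets borel" for B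
    using set_integrable_subset[OF iM] set_integrable_subset[OF iN] BK[OF that] sN by auto
  have P: "(LINT t:B \<inter> ?K|?M. D t) = (LINT t:B \<inter> ?K|?N. D t)" if B: "B \<in> sets borel" for B
  proof -
    let ?G = "range (\<lambda>(u, v). {u..<v::real})"
    have bs: "sets (borel :: real measure) = sigma_sets UNIV ?G" by (subst borel_eq_atLeastLessThan) simp
    have st: "Int_stable ?G"
    proof (rule Int_stableI)
      fix X Y assume "X \<in> ?G" "Y \<in> ?G"
      then obtain u v u' v' where "X = {u..<v}" "Y = {u'..<v'}" by auto
      hence "X \<inter> Y = {max u u'..<min v v'}" by auto
      thus "X \<inter> Y \<in> ?G" by auto
    qed
    have g: "B \<in> sigma_sets UNIV ?G" using B bs by simp
    have gP: "?G \<subseteq> Pow UNIV" by simp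
    from st gP g show ?thesis
    proof (induction B rule: sigma_sets_induct_disjoint)
      case (basic X)
      then obtain u v where X: "X = {u..<v}" by auto
      have e: "X \<inter> ?K = {max u p..<min v q}" unfolding X by auto
      show ?case
      proof (cases "max u p \<le> min v q")
        case True
        have "sint \<mu> (max u p) (min v q) D = 0" using True by (intro z) auto
        thus ?thesis unfolding e sint_def by simp
      next
        case False
        hence "X \<inter> ?K = {}" unfolding e by auto
        thus ?thesis by (simp add: set_lebesgue_integral_def)
      qed
    next
      case empty show ?case by (simp add: set_lebesgue_integral_def)
    next
      case (compl X)
      have Xb: "X \<in> sets borel" using compl bs by simp
      hence Yb: "UNIV - X \<in> sets borel" by auto
      have e: "X \<inter> ?K \<union> (UNIV - X) \<inter> ?K = ?K" "(X \<inter> ?K) \<inter> ((UNIV - X) \<inter> ?K) = {}" by auto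
      have "sint \<mu> p q D = 0 \<or> ?K = {}" using z[of p q] by (cases "p \<le> q") auto
      hence z0: "(LINT t:?K|?M. D t) = (LINT t:?K|?N. D t)" by
        (auto simp: sint_def set_lebesgue_integral_def)
      show ?case using set_integral_Un[OF e(2) iMB[OF Xb] iMB[OF Yb]] set_integral_Un[OF e(2) iNB[OF Xb]
        iNB[OF Yb]] compl z0
        unfolding e(1) by simp
    next
      case (union X)
      have Xb: "X i \<in> sets borel" for i using union bs by auto
      have Ub: "(\<Union>i. X i) \<in> sets borel" using Xb by auto
      have e: "(\<Union>i. X i) \<inter> ?K = (\<Union>i. X i \<inter> ?K)" by auto
      have d: "(X i \<inter> ?K) \<inter> (X j \<inter> ?K) = {}" if "i \<noteq> j" for i j using union(1) that by
        (auto simp: disjoint_family_on_def)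
      have "(LINT t:(\<Union>i. X i \<inter> ?K)|?M. D t) = (\<Sum>i. (LINT t:X i \<inter> ?K|?M. D t))"
      proof (rule lebesgue_integral_countable_add)
        show "X i \<inter> ?K \<in> sets ?M" for i by (rule BK[OF Xb])
        show "set_integrable ?M (\<Union>i. X i \<inter> ?K) D" using iMB[OF Ub] unfolding e .
      qed (rule d)
      moreover have "(LINT t:(\<Union>i. X i \<inter> ?K)|?N. D t) = (\<Sum>i. (LINT t:X i \<inter> ?K|?N. D t))"
      proof (rule lebesgue_integral_countable_add)
        show "X i \<inter> ?K \<in> sets ?N" for i unfolding sN by (rule BK[OF Xb])
        show "set_integrable ?N (\<Union>i. X i \<inter> ?K) D" using iNB[OF Ub] unfolding e .
      qed (rule d)
      moreover have "(LINT t:X i \<inter> ?K|?M. D t) = (LINT t:X i \<inter> ?K|?N. D t)" for i by (rule union)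
      ultimately show ?case unfolding e by (simp only:)
    qed
  qed
  have Asp: "A \<subseteq> I_ab a b" using sets.sets_into_space[OF A(1)] lf_space[OF l(1)] by simp
  have bor: "C \<in> sets borel" if "C \<in> sets ?M" for C
    using that borel_open[OF open_I_ab[of a b]] unfolding sM by (auto simp: sets_restrict_space)
  have nullM: "(LINT t:C|?M. D t) = 0" if "C \<in> sets ?M" "C \<inter> A = {}" for C
  proof -
    have "emeasure ?M C \<le> emeasure ?M (space ?M - A)" using that A sets.sets_into_space[OF that(1)]
      by (intro emeasure_mono) auto
    hence "C \<in> null_sets ?M" using A(2) that by auto
    hence "AE t in ?M. t \<notin> C" by (rule AE_not_in)
    thus ?thesis unfolding set_lebesgue_integral_def by (intro integral_eq_zero_AE) auto
  qed
  have nullN: "(LINT t:C|?N. D t) = 0" if "C \<in> sets ?M" "C \<subseteq> A" for C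
  proof -
    have "emeasure ?N C \<le> emeasure ?N A" using that A sN by (intro emeasure_mono) auto
    hence "C \<in> null_sets ?N" using A(3) that sN by auto
    hence "AE t in ?N. t \<notin> C" by (rule AE_not_in)
    thus ?thesis unfolding set_lebesgue_integral_def by (intro integral_eq_zero_AE) auto
  qed
  have both: "(LINT t:C \<inter> ?K|?M. D t) = 0 \<and> (LINT t:C \<inter> ?K|?N. D t) = 0" if C: "C \<in> sets ?M" for C
  proof -
    have b: "C \<inter> A \<in> sets borel" "C - A \<in> sets borel" using bor[OF C] bor[OF A(1)] by auto
    have s: "C \<inter> A \<inter> ?K \<in> sets ?M" "(C - A) \<inter> ?K \<in> sets ?M" using BK b by auto
    have 1: "(LINT t:C \<inter> A \<inter> ?K|?N. D t) = 0" by (rule nullN[OF s(1)]) auto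
    have 2: "(LINT t:(C - A) \<inter> ?K|?M. D t) = 0" by (rule nullM[OF s(2)]) auto
    have e: "C \<inter> A \<inter> ?K \<union> (C - A) \<inter> ?K = C \<inter> ?K" "(C \<inter> A \<inter> ?K) \<inter> ((C - A) \<inter> ?K) = {}" by auto
    show ?thesis using 1 2 P[OF b(1)] P[OF b(2)]
      set_integral_Un[OF e(2) iMB[OF b(1)] iMB[OF b(2)]] set_integral_Un[OF e(2) iNB[OF b(1)] iNB[OF b(2)]]
      unfolding e(1) by simp
  qed
  have fin: "AE t in M. t \<in> ?K \<longrightarrow> D t = 0"
    if M: "lf_measure_on a b M" and iM: "set_integrable M ?K D" and KM: "?K \<in> sets M"
      and zM: "\<And>C. C \<in> sets M \<Longrightarrow> (LINT t:C \<inter> ?K|M. D t) = 0" for M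
  proof -
    interpret R: finite_measure "restrict_space M ?K" by (rule lf_finite_restrict(1)[OF M p q])
    have K': "?K \<inter> space M \<in> sets M" using KM by auto
    have "AE t in restrict_space M ?K. D t = 0"
    proof (rule R.density_zero)
      show "integrable (restrict_space M ?K) D" using iM by
        (simp add: integrable_restrict_space[OF K'] set_integrable_def)
      fix C assume "C \<in> sets (restrict_space M ?K)"
      hence C: "C \<in> sets M" "C \<subseteq> ?K" using KM by (auto simp: sets_restrict_space)
      have "(LINT t:C|restrict_space M ?K. D t) = (LINT t:C \<inter> ?K|M. D t)"
        unfolding set_lebesgue_integral_def integral_restrict_space[OF K'] by
          (simp add: indicator_inter_arith mult.commute)
      thus "(LINT t:C|restrict_space M ?K. D t) = 0" using zM[OF C(1)] by simp
    qed
    thus ?thesis by (simp add: AE_restrict_space_iff[OF K'])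
  qed
  show "AE t in ?M. t \<in> ?K \<longrightarrow> D t = 0" using both by (intro fin[OF l(1) iM K(1)]) blast
  show "AE t in ?N. t \<in> ?K \<longrightarrow> D t = 0" using both sN by (intro fin[OF l(2) iN K(2)]) blast
qed

lemma left_cont_nonzero:
  fixes D :: "real \<Rightarrow> complex"
  assumes l: "(D \<longlongrightarrow> D z) (at_left z)" and nz: "D z \<noteq> 0" and p: "p < z"
  shows "\<exists>x. p < x \<and> x < z \<and> (\<forall>t. x < t \<and> t \<le> z \<longrightarrow> D t \<noteq> 0)"
proof -
  have "eventually (\<lambda>t. D t \<noteq> 0) (at_left z)" using tendsto_imp_eventually_ne[OF l nz] .
  then obtain y where y: "y < z" "\<And>t. y < t \<Longrightarrow> t < z \<Longrightarrow> D t \<noteq> 0"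
    unfolding eventually_at_left[OF p] by blast
  obtain x where "max p y < x" "x < z" using dense[of "max p y" z] p y by auto
  thus ?thesis using y nz by (intro exI[of _ x]) (auto simp: le_less)
qed

context sturm_liouville begin

text \<open>The density vanishes almost everywhere for both parts of \<sigma>. A nonzero value at
  \<open>w\<close> would by left continuity persist on an open interval ending at \<open>w\<close>,
  which would then be \<sigma>-null although \<sigma> has full support.\<close>

lemma left_cont_sint_zero:
  assumes pq: "p \<in> I" "q \<in> I" and i: "sI \<sigma> p q D" and z: "\<And>x y. p < x \<Longrightarrow> x \<le> y \<Longrightarrow> y < q \<Longrightarrow> sint \<sigma> x y D = 0"
    and lc: "\<And>x. p < x \<Longrightarrow> x < q \<Longrightarrow> (D \<longlongrightarrow> D x) (at_left x)" and w: "p < w" "w < q"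
  shows "D w = 0"
proof (rule ccontr)
  assume nz: "D w \<noteq> 0"
  obtain x where x: "p < x" "x < w" "\<And>t. x < t \<Longrightarrow> t \<le> w \<Longrightarrow> D t \<noteq> 0"
    using left_cont_nonzero[OF lc[OF w] nz w(1)] by blast
  have xI: "x \<in> I" "w \<in> I" using I_ab_between[OF pq, of x] I_ab_between[OF pq, of w] x w by auto
  have "sI \<sigma> x w D" using sI_subset[OF lfs_sig xI i] x w by auto
  note ae = sint_zero_imp_AE_zero[OF sig xI this]
  have "AE t in fst \<sigma>. t \<in> {x..<w} \<longrightarrow> D t = 0" "AE t in snd \<sigma>. t \<in> {x..<w} \<longrightarrow> D t = 0"
    by (rule ae; use z x w in auto)+
  hence ae': "AE t in fst \<sigma>. t \<notin> {x<..<w}" "AE t in snd \<sigma>. t \<notin> {x<..<w}" using x(3) by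
    (auto elim: eventually_mono)
  have l: "lf_measure_on a b (fst \<sigma>)" "lf_measure_on a b (snd \<sigma>)" using lfs_sig by (auto simp: lfs_def)
  have sub: "{x<..<w} \<subseteq> I" using I_ab_between[OF xI] by auto
  have s: "{x<..<w} \<in> sets (fst \<sigma>)" "{x<..<w} \<in> sets (snd \<sigma>)"
    using lf_sets[OF l(1) _ sub] lf_sets[OF l(2) _ sub] by auto
  have em: "emeasure (fst \<sigma>) {x<..<w} = 0" "emeasure (snd \<sigma>) {x<..<w} = 0"
    using ae' AE_iff_null_sets[OF s(1)] AE_iff_null_sets[OF s(2)] by auto
  define m where "m = (x + w) / 2"
  have "m \<in> I" using sub x(2) by (auto simp: m_def subset_iff)
  hence "m \<in> ssupp a b \<sigma>" using sig_supp by simp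
  moreover have "0 < (w - x) / 2" using x(2) by simp
  ultimately have ne: "emeasure (fst \<sigma>) (ball m ((w - x)/2) \<inter> I) + emeasure (snd \<sigma>) (ball m ((w
    - x)/2) \<inter> I) \<noteq> 0"
    unfolding ssupp_def by blast
  have "ball m ((w - x)/2) = {x<..<w}" by (auto simp: m_def ball_def dist_real_def abs_less_iff field_simps)
  moreover have "{x<..<w} \<inter> I = {x<..<w}" using sub by auto
  ultimately show False using em ne by simp
qed

text \<open>Justifies the definite description in \<open>qd\<close>. The difference of two
  candidates has zero \<sigma>-integrals and is left-continuous.\<close>

lemma qsol_h_unique:
  assumes 1: "qsol I f h g" and 2: "qsol I f h' g'" and x: "x \<in> I"
  shows "h x = h' x"
proof -
  obtain p q where p: "p \<in> I" "p < x" and q: "q \<in> I" "x < q" using I_left[OF x] I_right[OF x] by blast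
  have "h x - h' x = 0"
  proof (rule left_cont_sint_zero[OF p(1) q(1), where D = "\<lambda>x. h x - h' x"])
    show "sI \<sigma> p q (\<lambda>x. h x - h' x)" by (intro sI_diff qsol_sI[OF 1 p(1) q(1)] qsol_sI[OF 2 p(1) q(1)])
    fix u v assume uv: "p < u" "u \<le> v" "v < q"
    have I: "u \<in> I" "v \<in> I" using I_ab_between[OF p(1) q(1)] uv by auto
    show "sint \<sigma> u v (\<lambda>x. h x - h' x) = 0"
      using qsolD(4)[OF 1 I uv(2)] qsolD(4)[OF 2 I uv(2)] sint_diff[OF qsol_sI(1)[OF 1 I] qsol_sI(1)[OF 2
        I]] by simp
  next
    fix u assume "p < u" "u < q"
    hence "u \<in> I" using I_ab_between[OF p(1) q(1)] by auto
    thus "((\<lambda>x. h x - h' x) \<longlongrightarrow> h u - h' u) (at_left u)"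
      by (intro tendsto_diff qsol_left_cont(2)[OF 1] qsol_left_cont(2)[OF 2])
  qed (use p q in auto)
  thus ?thesis by simp
qed

lemma qd_eq:
  assumes "qsol I f h g" "x \<in> I"
  shows "qd a b \<rho> \<sigma> \<kappa> f x = h x"
  unfolding qd_def qd_rel_iff using assms qsol_h_unique by (intro the_equality) blast+

lemma wronski_eq:
  assumes "qsol I f h g" "qsol I f' h' g'" "x \<in> I"
  shows "wronski a b \<rho> \<sigma> \<kappa> f f' x = f x * h' x - h x * f' x"
  unfolding wronski_def qd_eq[OF assms(1,3)] qd_eq[OF assms(2,3)] ..

end

section \<open>Gaps in the support of \<rho>\<close>

lemma ssupp_pos: "ssupp a b (pos M) = {x \<in> I_ab a b. \<forall>e>0. emeasure M (ball x e \<inter> I_ab a b) \<noteq> 0}"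
  by (simp add: ssupp_def pos_def)

lemma ssupp_pos_closed:
  assumes M: "lf_measure_on a b M" and z: "z \<in> I_ab a b"
    and s: "\<And>e. e > 0 \<Longrightarrow> \<exists>s\<in>ssupp a b (pos M). dist z s < e"
  shows "z \<in> ssupp a b (pos M)"
  unfolding ssupp_pos
proof (intro CollectI conjI z allI impI notI)
  fix e :: real assume e: "e > 0" and 0: "emeasure M (ball z e \<inter> I_ab a b) = 0"
  obtain s where s: "s \<in> ssupp a b (pos M)" "dist z s < e" using s[OF e] by blast
  define d where "d = e - dist z s"
  have d: "d > 0" using s by (simp add: d_def)
  have "ball s d \<subseteq> ball z e"
  proof
    fix t assume "t \<in> ball s d"
    thus "t \<in> ball z e" using dist_triangle[of z t s] by (simp add: d_def)
  qed
  moreover have "ball z e \<inter> I_ab a b \<in> sets M" using borel_open[OF open_I_ab[of a b]]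
    by (intro lf_sets[OF M]) auto
  ultimately have "emeasure M (ball s d \<inter> I_ab a b) \<le> emeasure M (ball z e \<inter> I_ab a b)"
    by (intro emeasure_mono) auto
  thus False using 0 s(1) d unfolding ssupp_pos by auto
qed

text \<open>Every point off the support has a null ball around it, and countably many of these balls
  already cover \<open>U\<close>.\<close>

lemma null_off_ssupp:
  assumes M: "lf_measure_on a b M" and U: "open U" "U \<subseteq> I_ab a b" and d: "U \<inter> ssupp a b (pos M) = {}"
  shows "emeasure M U = 0"
proof -
  define F where "F = {ball x e |x e. emeasure M (ball x e \<inter> I_ab a b) = 0}"
  have op: "\<And>S. S \<in> F \<Longrightarrow> open S" by (auto simp: F_def)
  obtain F' where F': "F' \<subseteq> F" "countable F'" "\<Union>F' = \<Union>F" using Lindelof[OF op] by blast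
  have bI: "I_ab a b \<in> sets borel" by (intro borel_open open_I_ab)
  have n: "S \<inter> I_ab a b \<in> null_sets M" if S: "S \<in> F'" for S
  proof -
    from S F'(1) obtain x e where "S = ball x e" "emeasure M (S \<inter> I_ab a b) = 0" unfolding F_def by blast
    moreover have "S \<inter> I_ab a b \<in> sets M" using calculation(1) bI by (intro lf_sets[OF M]) auto
    ultimately show ?thesis by blast
  qed
  have N: "(\<Union>S\<in>F'. S \<inter> I_ab a b) \<in> null_sets M" by (rule null_sets_UN'[OF F'(2) n])
  have "U \<subseteq> (\<Union>S\<in>F'. S \<inter> I_ab a b)"
  proof
    fix x assume x: "x \<in> U"
    hence "x \<in> I_ab a b" "x \<notin> ssupp a b (pos M)" using U d by auto
    then obtain e where e: "e > 0" "emeasure M (ball x e \<inter> I_ab a b) = 0" unfolding ssupp_pos by blast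
    hence "ball x e \<in> F" by (auto simp: F_def)
    hence "x \<in> \<Union>F" using e(1) by (intro UnionI[of "ball x e"]) auto
    hence "x \<in> \<Union>F'" using F'(3) by simp
    thus "x \<in> (\<Union>S\<in>F'. S \<inter> I_ab a b)" using \<open>x \<in> I_ab a b\<close> by auto
  qed
  moreover have "U \<in> sets M" using U by (intro lf_sets[OF M]) auto
  ultimately show ?thesis using null_sets_subset[OF N] by blast
qed

locale sturm_liouville_gaps = sturm_liouville +
  assumes rho_pts: "\<exists>x\<in>ssupp a b (pos \<rho>). \<exists>y\<in>ssupp a b (pos \<rho>). x \<noteq> y"
    and gaps: "\<forall>\<alpha> \<beta>. \<alpha> \<in> ssupp a b (pos \<rho>) \<and> \<beta> \<in> ssupp a b (pos \<rho>) \<and> \<alpha> < \<beta> \<and>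
                  {\<alpha><..<\<beta>} \<inter> ssupp a b (pos \<rho>) = {} \<longrightarrow>
               (\<forall>f. Dtau a b \<rho> \<sigma> \<kappa> f \<and> (f \<longlongrightarrow> 0) (at_left \<alpha>) \<and> (f \<longlongrightarrow> 0) (at_right \<beta>)
                  \<longrightarrow> (\<forall>x\<in>{\<alpha><..<\<beta>}. f x = 0))"
begin

abbreviation "X \<equiv> ssupp a b (pos \<rho>)"

lemma nonzero_null:
  assumes ae: "AE x in \<rho>. f x = (0::complex)" and B: "B \<in> sets borel" "B \<subseteq> I" and nz: "\<And>x. x \<in> B \<Longrightarrow> f x \<noteq> 0"
  shows "emeasure \<rho> B = 0"
proof -
  have "AE x in \<rho>. x \<notin> B" using ae by eventually_elim (use nz in blast)
  thus ?thesis using AE_iff_null_sets[OF lf_sets[OF rho B]] by blast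
qed

text \<open>The end points of the gap belong to the support while the gap is null. Hence mass lies
  at \<alpha> or accumulates there from the left, and left continuity gives
  \<open>f \<alpha> = 0\<close>. At \<beta> the mass accumulates from the right or sits in the
  point; an atom of \<rho> is a point of right continuity, so the right limit is 0 in both cases and
  the gap condition applies.\<close>

lemma zero_in_gap:
  assumes q: "qsol I f h g" and ae: "AE x in \<rho>. f x = 0"
    and ga: "\<alpha> \<in> X" "\<beta> \<in> X" "\<alpha> < \<beta>" "{\<alpha><..<\<beta>} \<inter> X = {}" and x: "\<alpha> < x" "x < \<beta>"
  shows "f x = 0"
proof -
  have I: "\<alpha> \<in> I" "\<beta> \<in> I" using ga by (auto simp: ssupp_def)
  have sub: "{\<alpha><..<\<beta>} \<subseteq> I" using I_ab_between[OF I] by auto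
  have n0: "emeasure \<rho> {\<alpha><..<\<beta>} = 0" by (rule null_off_ssupp[OF rho _ sub ga(4)]) simp
  have D: "Dtau a b \<rho> \<sigma> \<kappa> f" using qsol_qd_rel[OF q] by (auto simp: Dtau_def)
  have bI: "I \<in> sets borel" by (intro borel_open open_I_ab)
  have mono: "emeasure \<rho> A \<le> emeasure \<rho> B" if "A \<subseteq> B" "B \<in> sets borel" "B \<subseteq> I" for A B
    using lf_sets[OF rho that(2,3)] that by (intro emeasure_mono) auto
  have fa: "f \<alpha> = 0"
  proof (rule ccontr)
    assume nz: "f \<alpha> \<noteq> 0"
    obtain p where p: "p \<in> I" "p < \<alpha>" using I_left[OF I(1)] by blast
    obtain y where y: "p < y" "y < \<alpha>" "\<And>t. y < t \<Longrightarrow> t \<le> \<alpha> \<Longrightarrow> f t \<noteq> 0"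
      using left_cont_nonzero[OF qsol_left_cont(1)[OF q I(1)] nz p(2)] by blast
    have sub': "{y<..\<alpha>} \<subseteq> I" using I_ab_between[OF p(1) I(1)] y by auto
    have n1: "emeasure \<rho> {y<..\<alpha>} = 0" by (rule nonzero_null[OF ae _ sub']) (use y in auto)
    define e where "e = min (\<alpha> - y) (\<beta> - \<alpha>)"
    have e: "e > 0" using y ga by (simp add: e_def)
    have "ball \<alpha> e \<inter> I \<subseteq> {y<..\<alpha>} \<union> {\<alpha><..<\<beta>}" by (auto simp: e_def dist_real_def)
    hence "emeasure \<rho> (ball \<alpha> e \<inter> I) \<le> emeasure \<rho> ({y<..\<alpha>} \<union> {\<alpha><..<\<beta>})" using sub sub' by (intro mono) auto
    also have "\<dots> \<le> emeasure \<rho> {y<..\<alpha>} + emeasure \<rho> {\<alpha><..<\<beta>}"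
      using lf_sets[OF rho _ sub] lf_sets[OF rho _ sub'] by (intro emeasure_subadditive) auto
    finally show False using n0 n1 e ga(1) unfolding ssupp_pos by auto
  qed
  have la: "(f \<longlongrightarrow> 0) (at_left \<alpha>)" using qsol_left_cont(1)[OF q I(1)] fa by simp
  obtain L where L: "(f \<longlongrightarrow> L) (at_right \<beta>)" "measure \<rho> {\<beta>} \<noteq> 0 \<longrightarrow> L = f \<beta>"
    using qsol_right_lim[OF q I(2)] by blast
  have "L = 0"
  proof (rule ccontr)
    assume nz: "L \<noteq> 0"
    obtain p where p: "p \<in> I" "\<beta> < p" using I_right[OF I(2)] by blast
    have "eventually (\<lambda>t. f t \<noteq> 0) (at_right \<beta>)" by (rule tendsto_imp_eventually_ne[OF L(1) nz])
    then obtain y0 where y0: "\<beta> < y0" "\<And>t. \<beta> < t \<Longrightarrow> t < y0 \<Longrightarrow> f t \<noteq> 0"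
      unfolding eventually_at_right[OF p(2)] by blast
    define y where "y = min y0 p"
    have y: "\<beta> < y" "\<And>t. \<beta> < t \<Longrightarrow> t < y \<Longrightarrow> f t \<noteq> 0" using y0 p by (auto simp: y_def)
    have sub': "{\<beta><..<y} \<subseteq> I" using I_ab_between[OF I(2) p(1)] by (auto simp: y_def)
    have n1: "emeasure \<rho> {\<beta><..<y} = 0" by (rule nonzero_null[OF ae _ sub']) (use y in auto)
    define e where "e = min (y - \<beta>) (\<beta> - \<alpha>)"
    have e: "e > 0" using y ga by (simp add: e_def)
    have s: "{\<alpha><..<\<beta>} \<in> sets \<rho>" "{\<beta>} \<in> sets \<rho>" "{\<beta><..<y} \<in> sets \<rho>"
      using lf_sets[OF rho _ sub] lf_sets[OF rho _ sub'] lf_sets[OF rho, of "{\<beta>}"] I by auto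
    have "ball \<beta> e \<inter> I \<subseteq> {\<alpha><..<\<beta>} \<union> {\<beta>} \<union> {\<beta><..<y}" by (auto simp: e_def dist_real_def)
    hence "emeasure \<rho> (ball \<beta> e \<inter> I) \<le> emeasure \<rho> ({\<alpha><..<\<beta>} \<union> {\<beta>} \<union> {\<beta><..<y})"
      by (intro emeasure_mono sets.Un s)
    also have "\<dots> \<le> emeasure \<rho> ({\<alpha><..<\<beta>} \<union> {\<beta>}) + emeasure \<rho> {\<beta><..<y}"
      by (intro emeasure_subadditive sets.Un s)
    also have "\<dots> \<le> emeasure \<rho> {\<alpha><..<\<beta>} + emeasure \<rho> {\<beta>} + emeasure \<rho> {\<beta><..<y}"
      by (intro add_right_mono emeasure_subadditive s)
    finally have "emeasure \<rho> {\<beta>} \<noteq> 0" using n0 n1 e ga(2) unfolding ssupp_pos by auto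
    moreover have "emeasure \<rho> {\<beta>} < \<infinity>" using lf_finite(1)[OF rho I(2) I(2)] by simp
    ultimately have "measure \<rho> {\<beta>} \<noteq> 0" by (auto simp: measure_def enn2real_eq_0_iff)
    hence "f \<beta> \<noteq> 0" using L(2) nz by auto
    hence "emeasure \<rho> {\<beta>} = 0" using I by (intro nonzero_null[OF ae]) auto
    thus False using \<open>emeasure \<rho> {\<beta>} \<noteq> 0\<close> by simp
  qed
  hence lb: "(f \<longlongrightarrow> 0) (at_right \<beta>)" using L by simp
  have "\<forall>x\<in>{\<alpha><..<\<beta>}. f x = 0" using gaps ga D la lb by blast
  thus ?thesis using x by simp
qed

text \<open>The gap containing \<open>x\<close> reaches from the last point of the support before
  \<open>x\<close> to the first one after it. Both exist because the support is relatively closed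
  and has points on either side.\<close>

lemma zero_off_supp:
  assumes q: "qsol I f h g" and ae: "AE x in \<rho>. f x = 0"
    and X: "x0 \<in> X" "y0 \<in> X" and x: "x0 < x" "x < y0" "x \<notin> X"
  shows "f x = 0"
proof -
  have I: "x0 \<in> I" "y0 \<in> I" using X by (auto simp: ssupp_def)
  define A where "A = X \<inter> {x0..x}"
  define B where "B = X \<inter> {x..y0}"
  have A: "x0 \<in> A" "bdd_above A" and B: "y0 \<in> B" "bdd_below B" using X x by (auto simp: A_def B_def)
  define \<alpha> where "\<alpha> = Sup A"
  define \<beta> where "\<beta> = Inf B"
  have a1: "x0 \<le> \<alpha>" unfolding \<alpha>_def by (rule cSup_upper[OF A])
  have a2: "\<alpha> \<le> x" unfolding \<alpha>_def by (rule cSup_least) (use A in \<open>auto simp: A_def\<close>)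
  have b1: "\<beta> \<le> y0" unfolding \<beta>_def by (rule cInf_lower[OF B])
  have b2: "x \<le> \<beta>" unfolding \<beta>_def by (rule cInf_greatest) (use B in \<open>auto simp: B_def\<close>)
  have aX: "\<alpha> \<in> X"
  proof (rule ssupp_pos_closed[OF rho])
    show "\<alpha> \<in> I" using I_ab_between[OF I, of \<alpha>] a1 a2 x by auto
    fix e :: real assume "e > 0"
    hence "\<alpha> - e < Sup A" by (simp add: \<alpha>_def)
    then obtain s where s: "s \<in> A" "\<alpha> - e < s" using less_cSupD[of A "\<alpha> - e"] A by blast
    have "s \<le> \<alpha>" unfolding \<alpha>_def by (rule cSup_upper[OF s(1) A(2)])
    thus "\<exists>s\<in>X. dist \<alpha> s < e" using s by (intro bexI[of _ s]) (auto simp: A_def dist_real_def)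
  qed
  have bX: "\<beta> \<in> X"
  proof (rule ssupp_pos_closed[OF rho])
    show "\<beta> \<in> I" using I_ab_between[OF I, of \<beta>] b1 b2 x by auto
    fix e :: real assume "e > 0"
    hence "Inf B < \<beta> + e" by (simp add: \<beta>_def)
    then obtain s where s: "s \<in> B" "s < \<beta> + e" using cInf_lessD[of B "\<beta> + e"] B by blast
    have "\<beta> \<le> s" unfolding \<beta>_def by (rule cInf_lower[OF s(1) B(2)])
    thus "\<exists>s\<in>X. dist \<beta> s < e" using s by (intro bexI[of _ s]) (auto simp: B_def dist_real_def)
  qed
  have ne: "\<alpha> \<noteq> x" "\<beta> \<noteq> x" using aX bX x(3) by auto
  have "{\<alpha><..<\<beta>} \<inter> X = {}"
  proof (rule ccontr)
    assume "{\<alpha><..<\<beta>} \<inter> X \<noteq> {}"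
    then obtain s where s: "\<alpha> < s" "s < \<beta>" "s \<in> X" by auto
    show False
    proof (cases "s \<le> x")
      case True
      hence "s \<in> A" using s a1 by (auto simp: A_def)
      hence "s \<le> \<alpha>" unfolding \<alpha>_def by (rule cSup_upper[OF _ A(2)])
      thus False using s by simp
    next
      case False
      hence "s \<in> B" using s b1 by (auto simp: B_def)
      hence "\<beta> \<le> s" unfolding \<beta>_def by (rule cInf_lower[OF _ B(2)])
      thus False using s by simp
    qed
  qed
  thus ?thesis using zero_in_gap[OF q ae aX bX _ _, of x] ne a2 b2 by auto
qed

text \<open>Extends the vanishing to points of the support. A nonzero value at \<open>x\<close>
  persists on some \<open>(y, x)\<close>, which is then \<rho>-null and contains points off the
  support, where \<open>f\<close> is already known to vanish.\<close>

lemma zero_between: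
  assumes q: "qsol I f h g" and ae: "AE x in \<rho>. f x = 0"
    and X: "x0 \<in> X" "y0 \<in> X" and x: "x0 < x" "x < y0"
  shows "f x = 0"
proof (rule ccontr)
  assume nz: "f x \<noteq> 0"
  have I: "x0 \<in> I" "y0 \<in> I" using X by (auto simp: ssupp_def)
  have xI: "x \<in> I" using I_ab_between[OF I, of x] x by auto
  obtain y where y: "x0 < y" "y < x" "\<And>t. y < t \<Longrightarrow> t \<le> x \<Longrightarrow> f t \<noteq> 0"
    using left_cont_nonzero[OF qsol_left_cont(1)[OF q xI] nz x(1)] by blast
  have sub: "{y<..<x} \<subseteq> I" using I_ab_between[OF I] y x by auto
  have n1: "emeasure \<rho> {y<..<x} = 0" by (rule nonzero_null[OF ae _ sub]) (use y in auto)
  define m where "m = (y + x) / 2"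
  have m: "y < m" "m < x" using y(2) by (auto simp: m_def)
  have "ball m ((x - y) / 2) = {y<..<x}" by
    (auto simp: m_def ball_def dist_real_def abs_less_iff field_simps)
  moreover have "{y<..<x} \<inter> I = {y<..<x}" using sub by auto
  moreover have "(x - y) / 2 > 0" using y by simp
  ultimately have "m \<notin> X" using n1 unfolding ssupp_pos by (metis (mono_tags, lifting) mem_Collect_eq)
  hence "f m = 0" using zero_off_supp[OF q ae X, of m] m y x by auto
  thus False using y(3)[of m] m by auto
qed

text \<open>Between two points of the support the combination vanishes everywhere, hence so does its
  quasi-derivative, because \<sigma> has full support. One point with determinant 1 then forces both
  coefficients to be 0.\<close>

lemma fundamental_AE_independent:
  assumes F: "fundamental I u1 v1 u2 v2" and ae: "AE x in \<rho>. s * u1 x + t * u2 x = 0"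
  shows "s = 0 \<and> t = 0"
proof -
  obtain x0 y0 where X: "x0 \<in> X" "y0 \<in> X" "x0 < y0" using rho_pts by (metis linorder_neqE_linordered_idom)
  have I: "x0 \<in> I" "y0 \<in> I" using X by (auto simp: ssupp_def)
  have u: "qsol I u1 v1 (\<lambda>_. 0)" "qsol I u2 v2 (\<lambda>_. 0)" using F by (auto simp: fundamental_def)
  have q: "qsol I (\<lambda>x. s * u1 x + t * u2 x) (\<lambda>x. s * v1 x + t * v2 x) (\<lambda>x. s * 0 + t * 0)"
    by (intro qsol_add qsol_cmult u)
  have f0: "s * u1 x + t * u2 x = 0" if "x0 < x" "x < y0" for x using zero_between[OF q ae X(1,2) that] .
  define c where "c = (x0 + y0) / 2"
  have c: "x0 < c" "c < y0" using X by (auto simp: c_def)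
  have cI: "c \<in> I" using I_ab_between[OF I, of c] c by auto
  have "s * v1 c + t * v2 c = 0"
  proof (rule left_cont_sint_zero[OF I qsol_sI(1)[OF q I] _ _ c])
    fix x y assume xy: "x0 < x" "x \<le> y" "y < y0"
    have "x \<in> I" "y \<in> I" using I_ab_between[OF I] xy by auto
    thus "sint \<sigma> x y (\<lambda>x. s * v1 x + t * v2 x) = 0" using qsolD(4)[OF q _ _ xy(2)] f0[of x] f0[of y] xy
      by auto
  next
    fix x assume "x0 < x" "x < y0"
    hence "x \<in> I" using I_ab_between[OF I] by auto
    thus "((\<lambda>x. s * v1 x + t * v2 x) \<longlongrightarrow> s * v1 x + t * v2 x) (at_left x)" by (rule qsol_left_cont(2)[OF q])
  qed
  moreover have "s * u1 c + t * u2 c = 0" using f0[OF c] .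
  moreover have "u1 c * v2 c - v1 c * u2 c = 1" using F cI by (simp add: fundamental_def)
  ultimately have "s * 1 = 0" "t * 1 = 0" by algebra+
  thus ?thesis by simp
qed

end

section \<open>Square integrability and boundary limits\<close>

lemma L2_mult:
  assumes "L2 M f" "L2 M g" shows "integrable M (\<lambda>x. f x * g x)"
proof (rule Bochner_Integration.integrable_bound)
  show "integrable M (\<lambda>x. (cmod (f x))\<^sup>2 + (cmod (g x))\<^sup>2)" using assms by (auto simp: L2_def)
  show "(\<lambda>x. f x * g x) \<in> borel_measurable M" using assms by (auto simp: L2_def)
  have "cmod (f x * g x) \<le> (cmod (f x))\<^sup>2 + (cmod (g x))\<^sup>2" for x
    using sum_squares_bound[of "cmod (f x)" "cmod (g x)"] by
      (simp add: norm_mult mult_nonneg_nonneg order_trans[rotated])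
  thus "AE x in M. norm (f x * g x) \<le> norm ((cmod (f x))\<^sup>2 + (cmod (g x))\<^sup>2)" by simp
qed

lemma L2_cnj: "L2 M f \<Longrightarrow> L2 M (\<lambda>x. cnj (f x))"
  using measurable_compose[of f M borel cnj borel] borel_measurable_continuous_onI[of cnj]
  by (simp add: L2_def continuous_on_cnj)

text \<open>Domination by two functions at once is the shape in which Cramer's rule will bound a
  solution of the inhomogeneous equation.\<close>

lemma L2_mono:
  assumes "L2 M f" "L2 M g" "k \<in> borel_measurable M" "\<And>x. x \<in> space M \<Longrightarrow> cmod (k x) \<le> C * (cmod (f x)
    + cmod (g x))"
  shows "L2 M k"
  unfolding L2_def
proof
  show "integrable M (\<lambda>x. (cmod (k x))\<^sup>2)"
  proof (rule Bochner_Integration.integrable_bound)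
    show "integrable M (\<lambda>x. 2 * C\<^sup>2 * ((cmod (f x))\<^sup>2 + (cmod (g x))\<^sup>2))" using assms by (auto simp: L2_def)
    show "(\<lambda>x. (cmod (k x))\<^sup>2) \<in> borel_measurable M" using assms by auto
    have "(cmod (k x))\<^sup>2 \<le> 2 * C\<^sup>2 * ((cmod (f x))\<^sup>2 + (cmod (g x))\<^sup>2)" if "x \<in> space M" for x
    proof -
      have "(cmod (k x))\<^sup>2 \<le> (C * (cmod (f x) + cmod (g x)))\<^sup>2" using assms(4)[OF that]
        by (intro power_mono) auto
      also have "\<dots> = C\<^sup>2 * (cmod (f x) + cmod (g x))\<^sup>2" by (simp add: power_mult_distrib)
      also have "\<dots> \<le> C\<^sup>2 * (2 * ((cmod (f x))\<^sup>2 + (cmod (g x))\<^sup>2))"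
        using sum_squares_bound[of "cmod (f x)" "cmod (g x)"] by (intro mult_left_mono)
          (auto simp: power2_sum)
      finally show ?thesis by (simp only: mult.assoc mult.left_commute)
    qed
    thus "AE x in M. norm ((cmod (k x))\<^sup>2) \<le> norm (2 * C\<^sup>2 * ((cmod (f x))\<^sup>2 + (cmod (g x))\<^sup>2))"
      by (intro AE_I2) simp
  qed
qed (rule assms)

lemma L2_add:
  assumes "L2 M f" "L2 M g" shows "L2 M (\<lambda>x. f x + g x)"
  by (rule L2_mono[OF assms, of _ 1]) (use assms in \<open>auto simp: L2_def norm_triangle_ineq\<close>)

lemma L2_zero: "L2 M (\<lambda>_. 0)"
  by (simp add: L2_def)

lemma L2_cmult:
  assumes "L2 M f" shows "L2 M (\<lambda>x. c * f x)"
  by (rule L2_mono[OF assms L2_zero, of _ "cmod c"]) (use assms in \<open>auto simp: L2_def norm_mult\<close>)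

lemma integral_norm_sq_zero:
  assumes f: "L2 M f" and z: "(LINT x|M. f x * cnj (f x)) = 0"
  shows "AE x in M. f x = 0"
proof -
  have i: "integrable M (\<lambda>x. (cmod (f x))\<^sup>2)" using f by (simp add: L2_def)
  have "(LINT x|M. f x * cnj (f x)) = of_real (LINT x|M. (cmod (f x))\<^sup>2)"
    unfolding integral_complex_of_real[symmetric] by (simp only: complex_norm_square)
  hence "(LINT x|M. (cmod (f x))\<^sup>2) = 0" using z by simp
  hence "AE x in M. (cmod (f x))\<^sup>2 = 0" using integral_nonneg_eq_0_iff_AE[OF i] by simp
  thus ?thesis by eventually_elim simp
qed

section \<open>Wronskian limits at the endpoints\<close>

context sturm_liouville begin

lemma right_end_cases: "(b = \<infinity> \<and> right_end b = at_top) \<or> (\<exists>\<beta>. b = ereal \<beta> \<and> right_end b = at_left \<beta>)"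
  using ab by (cases b) (auto simp: right_end_def)

lemma left_end_cases: "(a = -\<infinity> \<and> left_end a = at_bot) \<or> (\<exists>\<alpha>. a = ereal \<alpha> \<and> left_end a = at_right \<alpha>)"
  using ab by (cases a) (auto simp: left_end_def)

lemma right_end_nontriv: "right_end b \<noteq> bot" and left_end_nontriv: "left_end a \<noteq> bot"
  using right_end_cases left_end_cases by auto

lemma eventually_right_end: assumes c: "c \<in> I" shows "eventually (\<lambda>x. x \<in> I \<and> c < x) (right_end b)"
  using right_end_cases
proof (elim disjE exE conjE)
  assume b: "b = \<infinity>" and r: "right_end b = at_top"
  show ?thesis unfolding r using eventually_gt_at_top[of c]
    by eventually_elim (use c b in \<open>auto simp: I_ab_def intro: less_trans[of a "ereal c"]\<close>)
next
  fix \<beta> assume b: "b = ereal \<beta>" and r: "right_end b = at_left \<beta>"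
  have "c < \<beta>" using c b by (simp add: I_ab_def)
  hence "eventually (\<lambda>x. c < x \<and> x < \<beta>) (at_left \<beta>)" using eventually_at_left by blast
  thus ?thesis unfolding r by eventually_elim
    (use c b in \<open>auto simp: I_ab_def intro: less_trans[of a "ereal c"]\<close>)
qed

lemma eventually_left_end: assumes c: "c \<in> I" shows "eventually (\<lambda>x. x \<in> I \<and> x < c) (left_end a)"
  using left_end_cases
proof (elim disjE exE conjE)
  assume b: "a = -\<infinity>" and r: "left_end a = at_bot"
  show ?thesis unfolding r using eventually_gt_at_bot[of c]
    by eventually_elim (use c b in \<open>auto simp: I_ab_def intro: less_trans[of _ "ereal c" b]\<close>)
next
  fix \<alpha> assume b: "a = ereal \<alpha>" and r: "left_end a = at_right \<alpha>"
  have "\<alpha> < c" using c b by (simp add: I_ab_def)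
  hence "eventually (\<lambda>x. \<alpha> < x \<and> x < c) (at_right \<alpha>)" using eventually_at_right by blast
  thus ?thesis unfolding r by eventually_elim
    (use c b in \<open>auto simp: I_ab_def intro: less_trans[of _ "ereal c" b]\<close>)
qed

lemma set_integrable_sub:
  fixes G :: "real \<Rightarrow> complex"
  assumes G: "integrable \<rho> G" and A: "A \<in> sets borel" shows "set_integrable \<rho> A G"
proof -
  have "(\<lambda>x. x) \<in> borel_measurable \<rho>" by (rule lf_id[OF rho])
  hence "A \<inter> space \<rho> \<in> sets \<rho>" using measurable_sets[of "\<lambda>x. x" \<rho> borel A] A by simp
  hence "integrable \<rho> (\<lambda>x. indicator (A \<inter> space \<rho>) x *\<^sub>R G x)" using G by (rule integrable_mult_indicator)
  thus ?thesis unfolding set_integrable_def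
    by (rule Bochner_Integration.integrable_cong[THEN iffD1, rotated 2]) (auto simp: indicator_def)
qed

lemma integral_seq_lim:
  fixes G :: "real \<Rightarrow> complex"
  assumes G: "integrable \<rho> G" and A: "\<And>n. A n \<in> sets borel" "B \<in> sets borel"
    and ev: "\<And>t. t \<in> I \<Longrightarrow> eventually (\<lambda>n. t \<in> A n \<longleftrightarrow> t \<in> B) sequentially"
  shows "(\<lambda>n. LINT t:A n|\<rho>. G t) \<longlonglongrightarrow> (LINT t:B|\<rho>. G t)"
  unfolding set_lebesgue_integral_def
proof (rule integral_dominated_convergence[where w="\<lambda>x. cmod (G x)"])
  show "(\<lambda>x. indicator B x *\<^sub>R G x) \<in> borel_measurable \<rho>"
    "(\<lambda>x. indicator (A n) x *\<^sub>R G x) \<in> borel_measurable \<rho>" for n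
    using set_integrable_sub[OF G] A unfolding set_integrable_def by auto
  show "integrable \<rho> (\<lambda>x. cmod (G x))" using G by simp
  show "AE x in \<rho>. norm (indicator (A n) x *\<^sub>R G x) \<le> cmod (G x)" for n by (auto simp: indicator_def)
  show "AE x in \<rho>. (\<lambda>n. indicator (A n) x *\<^sub>R G x) \<longlonglongrightarrow> indicator B x *\<^sub>R G x"
  proof (rule AE_I2)
    fix x assume "x \<in> space \<rho>"
    hence "x \<in> I" using lf_space[OF rho] by simp
    hence "eventually (\<lambda>n. indicator (A n) x *\<^sub>R G x = indicator B x *\<^sub>R G x) sequentially"
      by (intro eventually_mono[OF ev]) (auto simp: indicator_def)
    thus "(\<lambda>n. indicator (A n) x *\<^sub>R G x) \<longlonglongrightarrow> indicator B x *\<^sub>R G x" by (rule tendsto_eventually)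
  qed
qed

lemma integral_right_end:
  fixes G :: "real \<Rightarrow> complex"
  assumes G: "integrable \<rho> G"
  shows "((\<lambda>x. LINT t:{c..<x}|\<rho>. G t) \<longlongrightarrow> (LINT t:{c..}|\<rho>. G t)) (right_end b)"
  using right_end_cases
proof (elim disjE exE conjE)
  assume b: "b = \<infinity>" and r: "right_end b = at_top"
  show ?thesis unfolding r
  proof (rule tendsto_at_topI_sequentially)
    fix S :: "nat \<Rightarrow> real" assume S: "filterlim S at_top sequentially"
    show "(\<lambda>n. LINT t:{c..<S n}|\<rho>. G t) \<longlonglongrightarrow> (LINT t:{c..}|\<rho>. G t)"
    proof (rule integral_seq_lim[OF G])
      fix t show "eventually (\<lambda>n. t \<in> {c..<S n} \<longleftrightarrow> t \<in> {c..}) sequentially"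
        using S[unfolded filterlim_at_top_dense, rule_format, of t] by eventually_elim auto
    qed auto
  qed
next
  fix \<beta> assume b: "b = ereal \<beta>" and r: "right_end b = at_left \<beta>"
  show ?thesis unfolding r
  proof (rule tendsto_at_left_sequentially[of "\<beta> - 1"])
    fix S :: "nat \<Rightarrow> real" assume S: "S \<longlonglongrightarrow> \<beta>"
    show "(\<lambda>n. LINT t:{c..<S n}|\<rho>. G t) \<longlonglongrightarrow> (LINT t:{c..}|\<rho>. G t)"
    proof (rule integral_seq_lim[OF G])
      fix t assume "t \<in> I"
      hence "t < \<beta>" using b by (simp add: I_ab_def)
      from order_tendstoD(1)[OF S this] show "eventually (\<lambda>n. t \<in> {c..<S n} \<longleftrightarrow> t \<in> {c..}) sequentially"
        by eventually_elim auto
    qed auto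
  qed simp
qed

lemma integral_left_end:
  fixes G :: "real \<Rightarrow> complex"
  assumes G: "integrable \<rho> G"
  shows "((\<lambda>x. LINT t:{x..<c}|\<rho>. G t) \<longlongrightarrow> (LINT t:{..<c}|\<rho>. G t)) (left_end a)"
  using left_end_cases
proof (elim disjE exE conjE)
  assume b: "a = -\<infinity>" and r: "left_end a = at_bot"
  show ?thesis unfolding r
  proof (rule tendsto_at_botI_sequentially)
    fix S :: "nat \<Rightarrow> real" assume S: "filterlim S at_bot sequentially"
    show "(\<lambda>n. LINT t:{S n..<c}|\<rho>. G t) \<longlonglongrightarrow> (LINT t:{..<c}|\<rho>. G t)"
    proof (rule integral_seq_lim[OF G])
      fix t show "eventually (\<lambda>n. t \<in> {S n..<c} \<longleftrightarrow> t \<in> {..<c}) sequentially"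
        using S[unfolded filterlim_at_bot_dense, rule_format, of t] by eventually_elim auto
    qed auto
  qed
next
  fix \<alpha> assume b: "a = ereal \<alpha>" and r: "left_end a = at_right \<alpha>"
  show ?thesis unfolding r
  proof (rule tendsto_at_right_sequentially[of _ "\<alpha> + 1"])
    fix S :: "nat \<Rightarrow> real" assume S: "S \<longlonglongrightarrow> \<alpha>"
    show "(\<lambda>n. LINT t:{S n..<c}|\<rho>. G t) \<longlonglongrightarrow> (LINT t:{..<c}|\<rho>. G t)"
    proof (rule integral_seq_lim[OF G])
      fix t assume "t \<in> I"
      hence "\<alpha> < t" using b by (simp add: I_ab_def)
      from order_tendstoD(2)[OF S this] show "eventually (\<lambda>n. t \<in> {S n..<c} \<longleftrightarrow> t \<in> {..<c}) sequentially"
        by eventually_elim auto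
    qed auto
  qed simp
qed

abbreviation "T \<equiv> Tmax a b \<rho> \<sigma> \<kappa>"
abbreviation "W \<equiv> wronski a b \<rho> \<sigma> \<kappa>"

lemma Tmax_iff: "(f, g) \<in> T \<longleftrightarrow> (\<exists>h. qsol I f h g) \<and> L2 \<rho> f \<and> L2 \<rho> g"
  by (simp add: Tmax_def qd_rel_iff)

lemma Tmax_add: "(f, g) \<in> T \<Longrightarrow> (f', g') \<in> T \<Longrightarrow> (\<lambda>x. f x + f' x, \<lambda>x. g x + g' x) \<in> T"
  unfolding Tmax_iff using qsol_add[of I] L2_add[of \<rho>] by blast

lemma Tmax_cmult: "(f, g) \<in> T \<Longrightarrow> (\<lambda>x. c * f x, \<lambda>x. c * g x) \<in> T"
  unfolding Tmax_iff using qsol_cmult[of I] L2_cmult[of \<rho>] by blast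

lemma Tmax_cnj: "(f, g) \<in> T \<Longrightarrow> (cnjf f, cnjf g) \<in> T"
  unfolding Tmax_iff using qsol_cnj[of I] L2_cnj[of \<rho>] unfolding cnjf_def by blast

text \<open>Increments of the Wronskian are integrals of \<open>g * f' - f * g'\<close>, which as a
  combination of products of \<open>L2\<close> functions is integrable over the whole interval. This
  also certifies that \<open>Lim\<close> in \<open>W_a\<close> and \<open>W_b\<close> denotes an
  actual limit.\<close>

lemma wronski_limits:
  assumes 1: "(f, g) \<in> T" and 2: "(f', g') \<in> T"
  shows "(W f f' \<longlongrightarrow> W_a a b \<rho> \<sigma> \<kappa> f f') (left_end a)" "(W f f' \<longlongrightarrow> W_b a b \<rho> \<sigma> \<kappa> f f') (right_end b)"
    "W_b a b \<rho> \<sigma> \<kappa> f f' - W_a a b \<rho> \<sigma> \<kappa> f f' = (LINT t|\<rho>. g t * f' t - f t * g' t)"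
proof -
  obtain h h' where q: "qsol I f h g" and q': "qsol I f' h' g'" and L: "L2 \<rho> f" "L2 \<rho> g" "L2 \<rho> f'" "L2 \<rho> g'"
    using 1 2 unfolding Tmax_iff by blast
  obtain c where c: "c \<in> I" using I_nonempty by blast
  let ?G = "\<lambda>t. g t * f' t - f t * g' t"
  have G: "integrable \<rho> ?G" using L2_mult[OF L(2,3)] L2_mult[OF L(1,4)] by simp
  have lag: "W f f' y - W f f' x = (LINT t:{x..<y}|\<rho>. ?G t)" if "x \<in> I" "y \<in> I" "x \<le> y" for x y
    unfolding wronski_eq[OF q q' that(1)] wronski_eq[OF q q' that(2)]
    using qsol_lagrange(2)[OF order_refl q q' that] I_convex that by blast
  have ev: "eventually (\<lambda>x. W f f' c + (LINT t:{c..<x}|\<rho>. ?G t) = W f f' x) (right_end b)"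
    using eventually_right_end[OF c]
  proof eventually_elim
    case (elim x) thus ?case using lag[OF c, of x] by (simp add: algebra_simps)
  qed
  have "((\<lambda>x. W f f' c + (LINT t:{c..<x}|\<rho>. ?G t)) \<longlongrightarrow> W f f' c + (LINT t:{c..}|\<rho>. ?G t)) (right_end b)"
    by (intro tendsto_intros integral_right_end[OF G])
  hence Lb: "(W f f' \<longlongrightarrow> W f f' c + (LINT t:{c..}|\<rho>. ?G t)) (right_end b)" using ev
    by (rule Lim_transform_eventually)
  have ev: "eventually (\<lambda>x. W f f' c - (LINT t:{x..<c}|\<rho>. ?G t) = W f f' x) (left_end a)"
    using eventually_left_end[OF c]
  proof eventually_elim
    case (elim x) thus ?case using lag[OF _ c, of x] by (simp add: algebra_simps)
  qed
  have "((\<lambda>x. W f f' c - (LINT t:{x..<c}|\<rho>. ?G t)) \<longlongrightarrow> W f f' c - (LINT t:{..<c}|\<rho>. ?G t)) (left_end a)"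
    by (intro tendsto_intros integral_left_end[OF G])
  hence La: "(W f f' \<longlongrightarrow> W f f' c - (LINT t:{..<c}|\<rho>. ?G t)) (left_end a)" using ev
    by (rule Lim_transform_eventually)
  have ea: "W_a a b \<rho> \<sigma> \<kappa> f f' = W f f' c - (LINT t:{..<c}|\<rho>. ?G t)"
    unfolding W_a_def by (rule tendsto_Lim[OF left_end_nontriv La])
  have eb: "W_b a b \<rho> \<sigma> \<kappa> f f' = W f f' c + (LINT t:{c..}|\<rho>. ?G t)"
    unfolding W_b_def by (rule tendsto_Lim[OF right_end_nontriv Lb])
  show "(W f f' \<longlongrightarrow> W_a a b \<rho> \<sigma> \<kappa> f f') (left_end a)" "(W f f' \<longlongrightarrow> W_b a b \<rho> \<sigma> \<kappa> f f') (right_end b)"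
    unfolding ea eb by (rule La, rule Lb)
  have "(LINT t:{..<c} \<union> {c..}|\<rho>. ?G t) = (LINT t:{..<c}|\<rho>. ?G t) + (LINT t:{c..}|\<rho>. ?G t)"
    by (rule set_integral_Un) (auto intro!: set_integrable_sub G)
  moreover have "{..<c} \<union> {c..} = (UNIV :: real set)" by auto
  ultimately show "W_b a b \<rho> \<sigma> \<kappa> f f' - W_a a b \<rho> \<sigma> \<kappa> f f' = (LINT t|\<rho>. g t * f' t - f t * g' t)"
    unfolding ea eb by (simp add: set_lebesgue_integral_def)
qed

end

section \<open>Local integrability of solutions; alternating forms at an endpoint\<close>

context sturm_liouville begin

text \<open>\<open>f\<close> is a constant plus an indefinite \<sigma>-integral, and integration by
  parts already delivers the integrability of the product of the latter with \<psi>. So no local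
  bound on \<open>f\<close> has to be established.\<close>

lemma qsol_mult_integrable:
  assumes q: "qsol I f h g" and p: "p \<in> I" and r: "r \<in> I" and \<psi>: "sI (pos \<rho>) p r \<psi>"
  shows "sI (pos \<rho>) p r (\<lambda>t. f t * \<psi> t)"
proof (cases "p \<le> r")
  case True
  have 1: "sI (pos \<rho>) p r (\<lambda>t. f p * \<psi> t + sint \<sigma> p t h * \<psi> t)"
    by (intro sI_add sI_cmult \<psi> sint_parts(1)[OF lfs_sig lfs_rho nca_rho p r qsol_sI(1)[OF q p r] \<psi>])
  have e: "f p * \<psi> t + sint \<sigma> p t h * \<psi> t = f t * \<psi> t" if t: "p \<le> t" "t < r" for t
  proof -
    have "t \<in> I" using I_ab_between[OF p r, of t] t by simp
    thus ?thesis using qsolD(4)[OF q p _ t(1)] by (simp add: distrib_right)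
  qed
  have "sI (pos \<rho>) p r (\<lambda>t. f p * \<psi> t + sint \<sigma> p t h * \<psi> t) = sI (pos \<rho>) p r (\<lambda>t. f t * \<psi> t)"
    by (rule sI_cong) (rule e)
  thus ?thesis using 1 by simp
next
  case False
  hence "{p..<r} = {}" by auto
  thus ?thesis by (simp add: sI_def)
qed

lemma qsol_sq_integrable:
  assumes q: "qsol I f h g" and p: "p \<in> I" and r: "r \<in> I"
  shows "set_integrable \<rho> {p..<r} f" "set_integrable \<rho> {p..<r} (\<lambda>x. (cmod (f x))\<^sup>2)"
proof -
  have 1: "sI (pos \<rho>) p r (\<lambda>t. f t * 1)" by (rule qsol_mult_integrable[OF q p r sI_const[OF lfs_rho p r]])
  thus "set_integrable \<rho> {p..<r} f" by (simp add: sI_pos)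
  have "sI (pos \<rho>) p r (\<lambda>t. f t * cnj (f t))"
    by (rule qsol_mult_integrable[OF q p r sI_cnj]) (use 1 in simp)
  hence "set_integrable \<rho> {p..<r} (\<lambda>t. complex_of_real ((cmod (f t))\<^sup>2))"
    by (simp only: sI_pos complex_norm_square)
  hence "integrable \<rho> (\<lambda>t. Re (indicator {p..<r} t *\<^sub>R complex_of_real ((cmod (f t))\<^sup>2)))"
    unfolding set_integrable_def by (rule integrable_Re)
  thus "set_integrable \<rho> {p..<r} (\<lambda>x. (cmod (f x))\<^sup>2)" unfolding set_integrable_def
    by (rule Bochner_Integration.integrable_cong[THEN iffD1, rotated 2]) simp_all
qed

lemma qsol_measurable:
  assumes q: "qsol I f h g" shows "f \<in> borel_measurable \<rho>"
proof -
  \<comment> \<open>Integrability on compact pieces gives measurability there, and \<open>f\<close>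
    is the pointwise limit along an exhaustion of the interval.\<close>
  obtain u l :: "nat \<Rightarrow> real" where "einterval a b = (\<Union>i. {l i .. u i})" "incseq u" "decseq l"
    and ul: "\<And>i. l i < u i" "\<And>i. a < l i" "\<And>i. u i < b" "l \<longlonglongrightarrow> a" "u \<longlonglongrightarrow> b"
    by (blast intro: einterval_Icc_approximation[OF ab])
  have I: "l i \<in> I" "u i \<in> I" for i
    using ul(1,2,3)[of i] by (auto simp: I_ab_def intro: less_trans[of _ "ereal (u i)" b] less_trans[of a
      "ereal (l i)"])
  have m: "(\<lambda>x. indicator {l n..<u n} x *\<^sub>R f x) \<in> borel_measurable \<rho>" for n
    using qsol_sq_integrable(1)[OF q I] unfolding set_integrable_def by auto
  show ?thesis
  proof (rule borel_measurable_LIMSEQ_metric[OF m])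
    fix x assume "x \<in> space \<rho>"
    hence x: "a < ereal x" "ereal x < b" using lf_space[OF rho] by (auto simp: I_ab_def)
    have "eventually (\<lambda>n. indicator {l n..<u n} x *\<^sub>R f x = f x) sequentially"
      using order_tendstoD(2)[OF ul(4) x(1)] order_tendstoD(1)[OF ul(5) x(2)] by eventually_elim simp
    thus "(\<lambda>n. indicator {l n..<u n} x *\<^sub>R f x) \<longlonglongrightarrow> f x" by (rule tendsto_eventually)
  qed
qed

lemma L2_loc_rho:
  assumes k: "L2 \<rho> k" shows "loc_rho k"
  unfolding loc_rho_def sI_pos
proof (intro ballI)
  fix p q assume pq: "p \<in> I" "q \<in> I"
  have S: "{p..<q} \<in> sets \<rho>" using Ico_sub_I[OF pq] by (intro lf_sets[OF rho]) auto
  have "integrable \<rho> (\<lambda>x. indicator {p..<q} x + (cmod (k x))\<^sup>2)"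
    using S lf_finite(2)[OF rho pq] k by (auto simp: L2_def)
  thus "set_integrable \<rho> {p..<q} k" unfolding set_integrable_def
  proof (rule Bochner_Integration.integrable_bound)
    show "(\<lambda>x. indicator {p..<q} x *\<^sub>R k x) \<in> borel_measurable \<rho>" using S k by (auto simp: L2_def)
    have "cmod (indicator {p..<q} x *\<^sub>R k x) \<le> indicator {p..<q} x + (cmod (k x))\<^sup>2" for x
    proof -
      have "2 * cmod (k x) \<le> (cmod (k x))\<^sup>2 + 1" using sum_squares_bound[of "cmod (k x)" 1] by simp
      hence "cmod (k x) \<le> 1 + (cmod (k x))\<^sup>2" using norm_ge_zero[of "k x"] zero_le_power2[of "cmod (k x)"]
        by linarith
      thus ?thesis by (simp add: indicator_def)
    qed
    thus "AE x in \<rho>. norm (indicator {p..<q} x *\<^sub>R k x) \<le> norm (indicator {p..<q} x + (cmod (k x))\<^sup>2)"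
      by simp
  qed
qed

definition TD :: "(real \<Rightarrow> complex) \<Rightarrow> bool" where "TD f \<longleftrightarrow> (\<exists>g. (f, g) \<in> T)"

lemma TD_add: "TD f \<Longrightarrow> TD g \<Longrightarrow> TD (\<lambda>x. f x + g x)"
  unfolding TD_def using Tmax_add by blast

lemma TD_cmult: "TD f \<Longrightarrow> TD (\<lambda>x. c * f x)"
  unfolding TD_def using Tmax_cmult by blast

lemma TD_cnj: "TD f \<Longrightarrow> TD (cnjf f)"
  unfolding TD_def using Tmax_cnj by blast

lemma TD_qsol: "TD f \<Longrightarrow> \<exists>h g. qsol I f h g"
  unfolding TD_def Tmax_iff by blast

text \<open>Records about an endpoint only that the Wronskians converge along its filter. Any
  continuous identity between Wronskians inside the interval then becomes one for \<omega>.\<close>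

definition endform :: "real filter \<Rightarrow> ((real \<Rightarrow> complex) \<Rightarrow> (real \<Rightarrow> complex) \<Rightarrow> complex) \<Rightarrow> bool" where
  "endform E \<omega> \<longleftrightarrow> E \<noteq> bot \<and> eventually (\<lambda>x. x \<in> I) E \<and> (\<forall>f f'. TD f \<longrightarrow> TD f' \<longrightarrow> (W f f' \<longlongrightarrow> \<omega> f f') E)"

lemma endform_a: "endform (left_end a) (W_a a b \<rho> \<sigma> \<kappa>)"
  and endform_b: "endform (right_end b) (W_b a b \<rho> \<sigma> \<kappa>)"
proof -
  obtain c where c: "c \<in> I" using I_nonempty by blast
  show "endform (left_end a) (W_a a b \<rho> \<sigma> \<kappa>)" unfolding endform_def TD_def
    using left_end_nontriv eventually_left_end[OF c] wronski_limits(1) by (auto elim: eventually_mono)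
  show "endform (right_end b) (W_b a b \<rho> \<sigma> \<kappa>)" unfolding endform_def TD_def
    using right_end_nontriv eventually_right_end[OF c] wronski_limits(2) by (auto elim: eventually_mono)
qed

lemma endform_unique:
  assumes E: "endform E \<omega>" and f: "TD f" "TD f'" and l: "(F \<longlongrightarrow> l) E" and e: "\<And>x. x \<in> I \<Longrightarrow> W f f' x = F x"
  shows "\<omega> f f' = l"
proof -
  have ev: "eventually (\<lambda>x. x \<in> I) E" and nb: "E \<noteq> bot" and L: "(W f f' \<longlongrightarrow> \<omega> f f') E"
    using E f by (auto simp: endform_def)
  have "eventually (\<lambda>x. F x = W f f' x) E" using ev by eventually_elim (simp add: e)
  hence "(W f f' \<longlongrightarrow> l) E" by (rule Lim_transform_eventually[OF l])
  thus ?thesis using L nb tendsto_unique by blast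
qed

lemma endform_lim: "endform E \<omega> \<Longrightarrow> TD f \<Longrightarrow> TD f' \<Longrightarrow> (W f f' \<longlongrightarrow> \<omega> f f') E"
  by (auto simp: endform_def)

lemma endform_add:
  assumes E: "endform E \<omega>" and f: "TD f" "TD f'" "TD u"
  shows "\<omega> (\<lambda>x. f x + f' x) u = \<omega> f u + \<omega> f' u"
proof (rule endform_unique[OF E TD_add[OF f(1,2)] f(3) tendsto_add[OF endform_lim[OF E f(1,3)]
  endform_lim[OF E f(2,3)]]])
  obtain h g h' g' k m where q: "qsol I f h g" "qsol I f' h' g'" "qsol I u k m"
    using TD_qsol[OF f(1)] TD_qsol[OF f(2)] TD_qsol[OF f(3)] by blast
  fix x assume x: "x \<in> I"
  show "W (\<lambda>x. f x + f' x) u x = W f u x + W f' u x"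
    unfolding wronski_eq[OF qsol_add[OF q(1,2)] q(3) x] wronski_eq[OF q(1,3) x] wronski_eq[OF q(2,3) x]
      by algebra
qed

lemma endform_cmult:
  assumes E: "endform E \<omega>" and f: "TD f" "TD u"
  shows "\<omega> (\<lambda>x. c * f x) u = c * \<omega> f u"
proof (rule endform_unique[OF E TD_cmult[OF f(1)] f(2) tendsto_mult_left[OF endform_lim[OF E f(1,2)]]])
  obtain h g k m where q: "qsol I f h g" "qsol I u k m" using TD_qsol[OF f(1)] TD_qsol[OF f(2)] by blast
  fix x assume x: "x \<in> I"
  show "W (\<lambda>x. c * f x) u x = c * W f u x"
    unfolding wronski_eq[OF qsol_cmult[OF q(1)] q(2) x] wronski_eq[OF q(1,2) x] by algebra
qed

lemma endform_antisym:
  assumes E: "endform E \<omega>" and f: "TD f" "TD u"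
  shows "\<omega> u f = - \<omega> f u"
proof (rule endform_unique[OF E f(2,1) tendsto_minus[OF endform_lim[OF E f]]])
  obtain h g k m where q: "qsol I f h g" "qsol I u k m" using TD_qsol[OF f(1)] TD_qsol[OF f(2)] by blast
  fix x assume x: "x \<in> I"
  show "W u f x = - W f u x" unfolding wronski_eq[OF q x] wronski_eq[OF q(2,1) x] by algebra
qed

lemma endform_cnj:
  assumes E: "endform E \<omega>" and f: "TD f" "TD u"
  shows "\<omega> (cnjf f) (cnjf u) = cnj (\<omega> f u)"
proof (rule endform_unique[OF E TD_cnj[OF f(1)] TD_cnj[OF f(2)] tendsto_cnj[OF endform_lim[OF E f]]])
  obtain h g k m where q: "qsol I f h g" "qsol I u k m" using TD_qsol[OF f(1)] TD_qsol[OF f(2)] by blast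
  fix x assume x: "x \<in> I"
  show "W (cnjf f) (cnjf u) x = cnj (W f u x)"
    unfolding wronski_eq[OF q x] wronski_eq[OF qsol_cnj[OF q(1)] qsol_cnj[OF q(2)] x] by
      (simp add: cnjf_def)
qed

text \<open>The four vectors formed by a function and its quasi-derivative lie in a plane, so their
  determinants satisfy the Pluecker relation at every \<open>x\<close>. In the limit it expresses
  that \<omega> has rank at most two.\<close>

lemma endform_plucker:
  assumes E: "endform E \<omega>" and f: "TD f1" "TD f2" "TD f3" "TD f4"
  shows "\<omega> f1 f2 * \<omega> f3 f4 + \<omega> f1 f3 * \<omega> f4 f2 + \<omega> f1 f4 * \<omega> f2 f3 = 0"
proof -
  obtain h1 g1 h2 g2 h3 g3 h4 g4 where q: "qsol I f1 h1 g1" "qsol I f2 h2 g2" "qsol I f3 h3 g3"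
    "qsol I f4 h4 g4"
    using TD_qsol[OF f(1)] TD_qsol[OF f(2)] TD_qsol[OF f(3)] TD_qsol[OF f(4)] by blast
  let ?F = "\<lambda>x. W f1 f2 x * W f3 f4 x + W f1 f3 x * W f4 f2 x + W f1 f4 x * W f2 f3 x"
  have "?F x = 0" if x: "x \<in> I" for x
    unfolding wronski_eq[OF q(1,2) x] wronski_eq[OF q(3,4) x] wronski_eq[OF q(1,3) x] wronski_eq[OF q(4,2)
      x]
      wronski_eq[OF q(1,4) x] wronski_eq[OF q(2,3) x] by algebra
  hence "eventually (\<lambda>x. ?F x = 0) E" using E by (auto simp: endform_def elim: eventually_mono)
  hence 0: "(?F \<longlongrightarrow> 0) E" by (rule tendsto_eventually)
  have "(?F \<longlongrightarrow> \<omega> f1 f2 * \<omega> f3 f4 + \<omega> f1 f3 * \<omega> f4 f2 + \<omega> f1 f4 * \<omega> f2 f3) E"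
    by (intro tendsto_add tendsto_mult endform_lim[OF E] f)
  thus ?thesis using 0 E tendsto_unique unfolding endform_def by blast
qed

end

lemma solve_2x2:
  fixes p q r s :: complex
  assumes "\<And>\<alpha> \<beta>. \<alpha> * p + \<beta> * q = 0 \<Longrightarrow> \<alpha> * r + \<beta> * s = 0 \<Longrightarrow> \<alpha> = 0 \<and> \<beta> = 0"
  shows "\<exists>\<alpha> \<beta>. \<alpha> * p + \<beta> * q = x \<and> \<alpha> * r + \<beta> * s = y"
proof (cases "p * s - q * r = 0")
  case False
  define d where "d = p * s - q * r"
  have "d \<noteq> 0" using False by (simp add: d_def)
  moreover have "(x * s - y * q) * p + (y * p - x * r) * q = d * x" "(x * s - y * q) * r + (y * p
    - x * r) * s = d * y"
    unfolding d_def by algebra+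
  ultimately show ?thesis
    by (intro exI[of _ "(x * s - y * q) / d"] exI[of _ "(y * p - x * r) / d"])
      (simp add: add_divide_distrib[symmetric])
next
  case True
  have "q = 0 \<and> - p = 0" by (rule assms) (use True in \<open>auto simp: algebra_simps\<close>)
  moreover have "s = 0 \<and> - r = 0" by (rule assms) (use True in \<open>auto simp: algebra_simps\<close>)
  ultimately have "(1::complex) = 0 \<and> (0::complex) = 0" by (intro assms) auto
  thus ?thesis by simp
qed

section \<open>The limit-circle case: square integrable solutions\<close>

locale limit_circle = sturm_liouville_gaps +
  assumes LCa: "LC_left a b \<rho> \<sigma> \<kappa>" and LCb: "LC_right a b \<rho> \<sigma> \<kappa>"
begin

lemma qsol0_L2:
  assumes q: "qsol I u v (\<lambda>_. 0)" shows "L2 \<rho> u"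
proof -
  have m: "u \<in> borel_measurable \<rho>" by (rule qsol_measurable[OF q])
  \<comment> \<open>The limit-circle property at \<open>z = 0\<close> controls both ends; the part
    in between is covered by local square integrability.\<close>
  have ex: "\<exists>h. qd_rel a b \<rho> \<sigma> \<kappa> u h (\<lambda>x. 0 * u x)" using q by (auto simp: qd_rel_iff)
  obtain c1 where c1: "c1 \<in> I" "set_integrable \<rho> {x\<in>I. x \<le> c1} (\<lambda>x. (cmod (u x))\<^sup>2)"
    using LCa ex unfolding LC_left_def by blast
  obtain c2 where c2: "c2 \<in> I" "set_integrable \<rho> {x\<in>I. c2 \<le> x} (\<lambda>x. (cmod (u x))\<^sup>2)"
    using LCb ex unfolding LC_right_def by blast
  have mid: "set_integrable \<rho> {c1..<c2} (\<lambda>x. (cmod (u x))\<^sup>2)"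
    by (rule qsol_sq_integrable(2)[OF q c1(1) c2(1)])
  have bI: "I \<in> sets borel" by (intro borel_open open_I_ab)
  have s: "{x\<in>I. x \<le> c1} \<in> sets \<rho>" "{x\<in>I. c2 \<le> x} \<in> sets \<rho>" "{c1..<c2} \<in> sets \<rho>"
    using bI Ico_sub_I[OF c1(1) c2(1)] by (auto intro!: lf_sets[OF rho])
  have "set_integrable \<rho> ({x\<in>I. x \<le> c1} \<union> {x\<in>I. c2 \<le> x} \<union> {c1..<c2}) (\<lambda>x. (cmod (u x))\<^sup>2)"
    by (intro set_integrable_Un c1(2) c2(2) mid s sets.Un)
  moreover have "{x\<in>I. x \<le> c1} \<union> {x\<in>I. c2 \<le> x} \<union> {c1..<c2} = space \<rho>"
    using Ico_sub_I[OF c1(1) c2(1)] lf_space[OF rho] by auto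
  ultimately have "integrable \<rho> (\<lambda>x. (cmod (u x))\<^sup>2)"
    unfolding set_integrable_def by (subst (asm) Bochner_Integration.integrable_cong[OF refl]) auto
  thus ?thesis using m by (simp add: L2_def)
qed

text \<open>Cramer's rule against a fundamental system writes a solution of \<open>\<tau> f = k\<close> as a combination
  of two square integrable functions whose coefficients, being Wronskians, are bounded.\<close>
lemma qsol_L2:
  assumes q: "qsol I f h k" and k: "L2 \<rho> k" shows "L2 \<rho> f"
proof -
  obtain c where c: "c \<in> I" using I_nonempty by blast
  obtain u1 v1 u2 v2 where F: "fundamental I u1 v1 u2 v2" using fundamental_exists[OF c] by blast
  have u: "qsol I u1 v1 (\<lambda>_. 0)" "qsol I u2 v2 (\<lambda>_. 0)" "\<And>x. x \<in> I \<Longrightarrow> u1 x * v2 x - v1 x * u2 x = 1"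
    using F by (auto simp: fundamental_def)
  \<comment> \<open>By Lagrange the Wronskian differs from its value at \<open>c\<close> by plus or
    minus the integral of \<open>k * u\<close> over the points between \<open>c\<close> and
    \<open>x\<close>, which the integral of its modulus over the whole interval bounds.\<close>
  have bound: "\<exists>C. \<forall>x\<in>I. cmod (f x * v x - h x * u x) \<le> C" if qu: "qsol I u v (\<lambda>_. 0)" for u v
  proof (intro exI ballI)
    have int: "integrable \<rho> (\<lambda>x. k x * u x)" by (rule L2_mult[OF k qsol0_L2[OF qu]])
    fix x assume x: "x \<in> I"
    have b: "cmod (LINT t:A|\<rho>. k t * u t) \<le> (LINT t|\<rho>. cmod (k t * u t))" if "A \<in> sets borel" for A
      unfolding set_lebesgue_integral_def
      by (rule Bochner_Integration.integral_norm_bound_integral)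
         (use set_integrable_sub[OF int that] int in \<open>auto simp: set_integrable_def indicator_def\<close>)
    have "\<exists>A\<in>sets borel. cmod ((f x * v x - h x * u x) - (f c * v c - h c * u c))
      \<le> cmod (LINT t:A|\<rho>. k t * u t)"
    proof (cases "c \<le> x")
      case True
      have "{c..x} \<subseteq> I" using I_convex c x by blast
      from qsol_lagrange(2)[OF order_refl q qu c x True this] show ?thesis
        by (intro bexI[of _ "{c..<x}"]) auto
    next
      case False
      hence xc: "x \<le> c" by simp
      have "{x..c} \<subseteq> I" using I_convex c x by blast
      from qsol_lagrange(2)[OF order_refl q qu x c xc this] show ?thesis
        by (intro bexI[of _ "{x..<c}"]) (auto simp: norm_minus_commute)
    qed
    then obtain A where A: "A \<in> sets borel" "cmod ((f x * v x - h x * u x) - (f c * v c - h c * u c))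
      \<le> cmod (LINT t:A|\<rho>. k t * u t)" by blast
    have "cmod ((f x * v x - h x * u x) - (f c * v c - h c * u c)) \<le> (LINT t|\<rho>. cmod (k t * u t))"
      using A b[OF A(1)] by linarith
    thus "cmod (f x * v x - h x * u x) \<le> (LINT t|\<rho>. cmod (k t * u t)) + cmod (f c * v c - h c * u c)"
      using norm_triangle_sub[of "f x * v x - h x * u x" "f c * v c - h c * u c"] by linarith
  qed
  obtain C1 where C1: "\<And>x. x \<in> I \<Longrightarrow> cmod (f x * v1 x - h x * u1 x) \<le> C1" using bound[OF u(1)] by blast
  obtain C2 where C2: "\<And>x. x \<in> I \<Longrightarrow> cmod (f x * v2 x - h x * u2 x) \<le> C2" using bound[OF u(2)] by blast
  show ?thesis
  proof (rule L2_mono[OF qsol0_L2[OF u(1)] qsol0_L2[OF u(2)] qsol_measurable[OF q]])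
    fix x assume "x \<in> space \<rho>"
    hence x: "x \<in> I" using lf_space[OF rho] by simp
    have "cmod (f x) = cmod (u1 x * (f x * v2 x - h x * u2 x) - u2 x * (f x * v1 x - h x * u1 x))"
      using plucker_solve(1)[OF u(3)[OF x], of "f x" "h x"] by simp
    also have "\<dots> \<le> cmod (u1 x) * cmod (f x * v2 x - h x * u2 x) + cmod (u2 x) * cmod (f x * v1 x
      - h x * u1 x)"
      by (metis norm_mult norm_triangle_ineq4)
    also have "\<dots> \<le> cmod (u1 x) * max C1 C2 + cmod (u2 x) * max C1 C2"
      using C1[OF x] C2[OF x] by (intro add_mono mult_left_mono) auto
    finally show "cmod (f x) \<le> max C1 C2 * (cmod (u1 x) + cmod (u2 x))" by (simp add: algebra_simps)
  qed
qed

lemma Tmax_solve: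
  assumes k: "L2 \<rho> k" shows "\<exists>f. (f, k) \<in> T"
proof -
  obtain c where c: "c \<in> I" using I_nonempty by blast
  obtain f h where "qsol I f h k" using qsol_exists[OF c L2_loc_rho[OF k], of 0 0] by blast
  thus ?thesis using qsol_L2[OF _ k] k unfolding Tmax_iff by blast
qed

end

section \<open>Tmax and its adjoint in the limit-circle case\<close>

context limit_circle begin

text \<open>Supplies right-hand sides with prescribed moments against \<open>u1\<close> and
  \<open>u2\<close>. By Lagrange these moments are the Wronskians at \<open>b\<close> of a solution
  that has zero data at \<open>a\<close>. The conjugates in the ansatz turn the 2x2 system into a
  Gram system: a kernel vector gives a function orthogonal to itself.\<close>

lemma gram_solve:
  assumes F: "fundamental I u1 v1 u2 v2"
  shows "\<exists>\<alpha> \<beta>. (LINT x|\<rho>. (\<alpha> * cnjf u1 x + \<beta> * cnjf u2 x) * u1 x) = s \<and> (LINT x|\<rho>. (\<alpha> * cnjf u1 x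
    + \<beta> * cnjf u2 x) * u2 x) = t"
proof -
  have u: "qsol I u1 v1 (\<lambda>_. 0)" "qsol I u2 v2 (\<lambda>_. 0)" using F by (auto simp: fundamental_def)
  have L: "L2 \<rho> u1" "L2 \<rho> u2" using u qsol0_L2 by auto
  have Lc: "L2 \<rho> (cnjf u1)" "L2 \<rho> (cnjf u2)" using L L2_cnj unfolding cnjf_def by auto
  define p where "p = (LINT x|\<rho>. cnjf u1 x * u1 x)"
  define q where "q = (LINT x|\<rho>. cnjf u2 x * u1 x)"
  define r where "r = (LINT x|\<rho>. cnjf u1 x * u2 x)"
  define w where "w = (LINT x|\<rho>. cnjf u2 x * u2 x)"
  note i = L2_mult[OF Lc(1) L(1)] L2_mult[OF Lc(2) L(1)] L2_mult[OF Lc(1) L(2)] L2_mult[OF Lc(2) L(2)]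
  have e1: "(LINT x|\<rho>. (\<alpha> * cnjf u1 x + \<beta> * cnjf u2 x) * u1 x) = \<alpha> * p + \<beta> * q" for \<alpha> \<beta>
    unfolding p_def q_def distrib_right mult.assoc using i by simp
  have e2: "(LINT x|\<rho>. (\<alpha> * cnjf u1 x + \<beta> * cnjf u2 x) * u2 x) = \<alpha> * r + \<beta> * w" for \<alpha> \<beta>
    unfolding r_def w_def distrib_right mult.assoc using i by simp
  show ?thesis unfolding e1 e2
  proof (rule solve_2x2)
    fix \<alpha> \<beta> assume z: "\<alpha> * p + \<beta> * q = 0" "\<alpha> * r + \<beta> * w = 0"
    let ?f = "\<lambda>x. \<alpha> * cnjf u1 x + \<beta> * cnjf u2 x"
    have Lf: "L2 \<rho> ?f" by (intro L2_add L2_cmult Lc)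
    have "(\<lambda>x. ?f x * cnj (?f x)) = (\<lambda>x. cnj \<alpha> * (?f x * u1 x) + cnj \<beta> * (?f x * u2 x))"
      by (rule ext) (simp add: cnjf_def algebra_simps)
    hence "(LINT x|\<rho>. ?f x * cnj (?f x)) = cnj \<alpha> * (LINT x|\<rho>. ?f x * u1 x)
      + cnj \<beta> * (LINT x|\<rho>. ?f x * u2 x)"
      using L2_mult[OF Lf L(1)] L2_mult[OF Lf L(2)] by simp
    also have "\<dots> = 0" unfolding e1 e2 z by simp
    finally have "AE x in \<rho>. ?f x = 0" by (rule integral_norm_sq_zero[OF Lf])
    hence "AE x in \<rho>. cnj \<alpha> * u1 x + cnj \<beta> * u2 x = 0"
    proof eventually_elim
      case (elim x)
      hence "cnj (\<alpha> * cnjf u1 x + \<beta> * cnjf u2 x) = 0" by simp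
      thus ?case by (simp add: cnjf_def)
    qed
    hence "cnj \<alpha> = 0 \<and> cnj \<beta> = 0" by (rule fundamental_AE_independent[OF F])
    thus "\<alpha> = 0 \<and> \<beta> = 0" by simp
  qed
qed

lemma fundamental_TD:
  assumes F: "fundamental I u1 v1 u2 v2"
  shows "(u1, \<lambda>_. 0) \<in> T" "(u2, \<lambda>_. 0) \<in> T"
  using F qsol0_L2 L2_zero unfolding fundamental_def Tmax_iff by blast+

lemma fundamental_endform:
  assumes F: "fundamental I u1 v1 u2 v2" and E: "endform E \<omega>"
  shows "\<omega> u1 u2 = 1"
proof -
  have u: "qsol I u1 v1 (\<lambda>_. 0)" "qsol I u2 v2 (\<lambda>_. 0)" using F by (auto simp: fundamental_def)
  have t: "TD u1" "TD u2" using fundamental_TD[OF F] by (auto simp: TD_def)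
  show ?thesis
  proof (rule endform_unique[OF E t tendsto_const])
    fix x assume "x \<in> I" thus "W u1 u2 x = 1" using F by (simp add: wronski_eq[OF u] fundamental_def)
  qed
qed

lemma endform_self:
  assumes E: "endform E \<omega>" and f: "TD f" shows "\<omega> f f = 0"
  using endform_antisym[OF E f f] by simp

text \<open>As \<open>\<omega> u1 u2 = 1\<close>, the Pluecker relation expresses
  \<open>\<omega> f g\<close> through the values of \<open>f\<close> and \<open>g\<close> against
  \<open>u1\<close> and \<open>u2\<close>; these two values are the data of a function at the
  endpoint.\<close>

lemma endform_zero:
  assumes F: "fundamental I u1 v1 u2 v2" and E: "endform E \<omega>" and f: "TD f" "\<omega> f u1 = 0" "\<omega> f u2 = 0"
    and g: "TD g"
  shows "\<omega> f g = 0"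
proof -
  have t: "TD u1" "TD u2" using fundamental_TD[OF F] by (auto simp: TD_def)
  show ?thesis using endform_plucker[OF E f(1) g t] f fundamental_endform[OF F E] by simp
qed

lemma Tmax_solve_left:
  assumes F: "fundamental I u1 v1 u2 v2" and k: "L2 \<rho> k"
  shows "\<exists>f. (f, k) \<in> T \<and> W_a a b \<rho> \<sigma> \<kappa> f u1 = 0 \<and> W_a a b \<rho> \<sigma> \<kappa> f u2 = 0"
proof -
  let ?w = "W_a a b \<rho> \<sigma> \<kappa>"
  obtain f0 where f0: "(f0, k) \<in> T" using Tmax_solve[OF k] by blast
  have f0': "TD f0" using f0 by (auto simp: TD_def)
  note tT = fundamental_TD[OF F]
  have t: "TD u1" "TD u2" using tT by (auto simp: TD_def)
  note E = endform_a
  \<comment> \<open>Adding multiples of \<open>u1\<close> and \<open>u2\<close> leaves the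
    right-hand side alone. Since \<open>?w u1 u2 = 1\<close> and the diagonal values are 0,
    \<open>s\<close> changes only the value against \<open>u2\<close> and \<open>r\<close> only the
    value against \<open>u1\<close>.\<close>
  define s where "s = - ?w f0 u2"
  define r where "r = ?w f0 u1"
  let ?f = "\<lambda>x. f0 x + (s * u1 x + r * u2 x)"
  have "(?f, \<lambda>x. k x + (s * 0 + r * 0)) \<in> T" by (intro Tmax_add Tmax_cmult f0 tT)
  hence "(?f, k) \<in> T" by simp
  moreover have w: "?w ?f u = ?w f0 u + (s * ?w u1 u + r * ?w u2 u)" if u: "TD u" for u
    by (simp add: endform_add[OF E f0' TD_add[OF TD_cmult[OF t(1)] TD_cmult[OF t(2)]] u]
       endform_add[OF E TD_cmult[OF t(1)] TD_cmult[OF t(2)] u] endform_cmult[OF E t(1) u] endform_cmult[OF E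
         t(2) u])
  have o: "?w u1 u2 = 1" "?w u2 u1 = -1" using fundamental_endform[OF F E] endform_antisym[OF E t] by auto
  have "?w ?f u1 = 0" "?w ?f u2 = 0"
    using w[OF t(1)] w[OF t(2)] o endform_self[OF E t(1)] endform_self[OF E t(2)] by
      (simp_all add: s_def r_def)
  ultimately show ?thesis by blast
qed

text \<open>Plays the part of multiplying \<open>w\<close> by a cutoff function. The right-hand side
  is chosen so that the solution with zero data at \<open>a\<close> arrives at \<open>b\<close> with
  the data of \<open>w\<close>.\<close>

lemma cutoff_left:
  assumes w: "TD w"
  shows "\<exists>f. TD f \<and> (\<forall>g. TD g \<longrightarrow> W_a a b \<rho> \<sigma> \<kappa> f g = 0 \<and> W_b a b \<rho> \<sigma> \<kappa> f g = W_b a b \<rho> \<sigma> \<kappa> w g)"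
proof -
  let ?wa = "W_a a b \<rho> \<sigma> \<kappa>" and ?wb = "W_b a b \<rho> \<sigma> \<kappa>"
  note Ea = endform_a and Eb = endform_b
  obtain c where c: "c \<in> I" using I_nonempty by blast
  obtain u1 v1 u2 v2 where F: "fundamental I u1 v1 u2 v2" using fundamental_exists[OF c] by blast
  note tT = fundamental_TD[OF F]
  have t: "TD u1" "TD u2" using tT by (auto simp: TD_def)
  obtain \<alpha> \<beta> where g: "(LINT x|\<rho>. (\<alpha> * cnjf u1 x + \<beta> * cnjf u2 x) * u1 x) = ?wb w u1"
    "(LINT x|\<rho>. (\<alpha> * cnjf u1 x + \<beta> * cnjf u2 x) * u2 x) = ?wb w u2" using gram_solve[OF F] by blast
  let ?v = "\<lambda>x. \<alpha> * cnjf u1 x + \<beta> * cnjf u2 x"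
  have "L2 \<rho> u1" "L2 \<rho> u2" using tT by (auto simp: Tmax_iff)
  hence v: "L2 \<rho> ?v" unfolding cnjf_def by (intro L2_add L2_cmult L2_cnj)
  obtain f where f: "(f, ?v) \<in> T" "?wa f u1 = 0" "?wa f u2 = 0" using Tmax_solve_left[OF F v] by blast
  have fT: "TD f" using f by (auto simp: TD_def)
  have b: "?wb f u1 = ?wb w u1" "?wb f u2 = ?wb w u2"
    using wronski_limits(3)[OF f(1) tT(1)] wronski_limits(3)[OF f(1) tT(2)] f g by simp_all
  show ?thesis
  proof (intro exI[of _ f] conjI allI impI fT)
    fix g assume g: "TD g"
    show "?wa f g = 0" by (rule endform_zero[OF F Ea fT f(2,3) g])
    let ?d = "\<lambda>x. f x + -1 * w x"
    have d: "?wb ?d u = ?wb f u - ?wb w u" if "TD u" for u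
      by (simp only: endform_add[OF Eb fT TD_cmult[OF w] that] endform_cmult[OF Eb w that]) simp
    have dT: "TD ?d" by (intro TD_add fT TD_cmult w)
    have "?wb ?d g = 0" by (rule endform_zero[OF F Eb dT _ _ g]) (use d[OF t(1)] d[OF t(2)] b in simp_all)
    thus "?wb f g = ?wb w g" using d[OF g] by simp
  qed
qed

text \<open>The adjoint of the minimal relation lies in the maximal one. If \<tau> h0 = k, then
  \<open>f - h0\<close> should lie in the span of the conjugated fundamental solutions, all of which
  solve \<tau> u = 0. Subtracting the projection \<open>e\<close> onto this span leaves
  \<open>d\<close>, which is shown to be orthogonal to itself.\<close>

lemma adjoint_kernel_sub_Tmax:
  assumes f: "L2 \<rho> f" and k: "L2 \<rho> k"
    and adj: "\<And>u v. (u, v) \<in> T \<Longrightarrow> (\<And>g. TD g \<Longrightarrow> W_a a b \<rho> \<sigma> \<kappa> u g = 0 \<and> W_b a b \<rho> \<sigma> \<kappa> u g = 0) \<Longrightarrow>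
       (LINT x|\<rho>. v x * cnj (f x)) = (LINT x|\<rho>. u x * cnj (k x))"
  shows "\<exists>f'. (f', k) \<in> T \<and> (AE x in \<rho>. f x = f' x)"
proof -
  let ?wa = "W_a a b \<rho> \<sigma> \<kappa>" and ?wb = "W_b a b \<rho> \<sigma> \<kappa>"
  note Ea = endform_a and Eb = endform_b
  obtain c where c: "c \<in> I" using I_nonempty by blast
  obtain u1 v1 u2 v2 where F: "fundamental I u1 v1 u2 v2" using fundamental_exists[OF c] by blast
  note tT = fundamental_TD[OF F]
  have t: "TD u1" "TD u2" using tT by (auto simp: TD_def)
  have Lu: "L2 \<rho> u1" "L2 \<rho> u2" using tT by (auto simp: Tmax_iff)
  obtain h0 where h0: "(h0, k) \<in> T" using Tmax_solve[OF k] by blast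
  have Lh: "L2 \<rho> h0" using h0 by (simp add: Tmax_iff)
  define D where "D x = f x + -1 * h0 x" for x
  have LD: "L2 \<rho> D" unfolding D_def by (intro L2_add L2_cmult f Lh)
  obtain \<alpha> \<beta> where g: "(LINT x|\<rho>. (\<alpha> * cnjf u1 x + \<beta> * cnjf u2 x) * u1 x) = (LINT x|\<rho>. D x * u1 x)"
    "(LINT x|\<rho>. (\<alpha> * cnjf u1 x + \<beta> * cnjf u2 x) * u2 x) = (LINT x|\<rho>. D x * u2 x)" using gram_solve[OF F]
      by blast
  define e where "e x = \<alpha> * cnjf u1 x + \<beta> * cnjf u2 x" for x
  have Le: "L2 \<rho> e" using Lu unfolding e_def cnjf_def by (intro L2_add L2_cmult L2_cnj)
  define d where "d x = D x + -1 * e x" for x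
  have Ld: "L2 \<rho> d" unfolding d_def by (intro L2_add L2_cmult LD Le)
  have orth: "(LINT x|\<rho>. d x * u x) = (LINT x|\<rho>. D x * u x) - (LINT x|\<rho>. e x * u x)" if "L2 \<rho> u" for u
    unfolding d_def distrib_right mult.assoc using L2_mult[OF LD that] L2_mult[OF Le that] by simp
  have d1: "(LINT x|\<rho>. d x * u1 x) = 0" "(LINT x|\<rho>. d x * u2 x) = 0"
    using orth[OF Lu(1)] orth[OF Lu(2)] g unfolding e_def by simp_all
  \<comment> \<open>The decisive test function has \<open>d\<close> itself as right-hand side. The
    moments of \<open>d\<close> against \<open>u1\<close> and \<open>u2\<close> are 0, so by
    Lagrange its data vanish at \<open>b\<close> too, and it is admissible in
    \<open>adj\<close>.\<close>
  obtain \<phi> where \<phi>: "(\<phi>, d) \<in> T" "?wa \<phi> u1 = 0" "?wa \<phi> u2 = 0" using Tmax_solve_left[OF F Ld] by blast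
  have \<phi>T: "TD \<phi>" and L\<phi>: "L2 \<rho> \<phi>" using \<phi> by (auto simp: TD_def Tmax_iff)
  have b: "?wb \<phi> u1 = 0" "?wb \<phi> u2 = 0"
    using wronski_limits(3)[OF \<phi>(1) tT(1)] wronski_limits(3)[OF \<phi>(1) tT(2)] \<phi> d1 by simp_all
  have z: "?wa \<phi> g = 0 \<and> ?wb \<phi> g = 0" if "TD g" for g
    using endform_zero[OF F Ea \<phi>T \<phi>(2,3) that] endform_zero[OF F Eb \<phi>T b that] by simp
  have A: "(LINT x|\<rho>. d x * cnj (f x)) = (LINT x|\<rho>. \<phi> x * cnj (k x))" by (rule adj[OF \<phi>(1)]) (rule z)
  have hc: "(cnjf h0, cnjf k) \<in> T" by (rule Tmax_cnj[OF h0])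
  have "(LINT x|\<rho>. d x * cnjf h0 x - \<phi> x * cnjf k x) = 0"
  proof -
    have "TD (cnjf h0)" using hc by (auto simp: TD_def)
    thus ?thesis using wronski_limits(3)[OF \<phi>(1) hc] z[of "cnjf h0"] by simp
  qed
  hence B: "(LINT x|\<rho>. d x * cnj (h0 x)) = (LINT x|\<rho>. \<phi> x * cnj (k x))"
    unfolding cnjf_def using L2_mult[OF Ld L2_cnj[OF Lh]] L2_mult[OF L\<phi> L2_cnj[OF k]] by simp
  have "(\<lambda>x. d x * cnj (d x)) = (\<lambda>x. (d x * cnj (f x) - d x * cnj (h0 x)) - (cnj \<alpha> * (d x * u1 x)
    + cnj \<beta> * (d x * u2 x)))"
    by (rule ext) (simp add: d_def D_def e_def cnjf_def algebra_simps)
  hence "(LINT x|\<rho>. d x * cnj (d x)) = ((LINT x|\<rho>. d x * cnj (f x)) - (LINT x|\<rho>. d x * cnj (h0 x)))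
    - (cnj \<alpha> * (LINT x|\<rho>. d x * u1 x) + cnj \<beta> * (LINT x|\<rho>. d x * u2 x))"
    using L2_mult[OF Ld L2_cnj[OF f]] L2_mult[OF Ld L2_cnj[OF Lh]] L2_mult[OF Ld Lu(1)] L2_mult[OF Ld Lu(2)]
      by simp
  hence "(LINT x|\<rho>. d x * cnj (d x)) = 0" unfolding A B d1 by simp
  hence ae: "AE x in \<rho>. d x = 0" by (rule integral_norm_sq_zero[OF Ld])
  have "(\<lambda>x. h0 x + (\<alpha> * cnjf u1 x + \<beta> * cnjf u2 x), \<lambda>x. k x + (\<alpha> * cnjf (\<lambda>_. 0) x
    + \<beta> * cnjf (\<lambda>_. 0) x)) \<in> T"
    by (intro Tmax_add Tmax_cmult Tmax_cnj h0 tT)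
  hence "(\<lambda>x. h0 x + e x, k) \<in> T" by (simp add: cnjf_def e_def)
  moreover have "AE x in \<rho>. f x = h0 x + e x" using ae by eventually_elim
    (simp add: d_def D_def algebra_simps)
  ultimately show ?thesis by blast
qed

end

section \<open>Lagrangian planes and boundary matrices\<close>

text \<open>The form \<open>(f, g) \<mapsto> W(f, g\<^sup>*)(b) - W(f, g\<^sup>*)(a)\<close> in the coordinates
  \<open>(BC\<^sub>a\<^sup>1, BC\<^sub>a\<^sup>2, BC\<^sub>b\<^sup>1, BC\<^sub>b\<^sup>2)\<close>.\<close>
definition bform :: "complex^4 \<Rightarrow> complex^4 \<Rightarrow> complex" where
  "bform y z = (y$3 * cnj (z$4) - y$4 * cnj (z$3)) - (y$1 * cnj (z$2) - y$2 * cnj (z$1))"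

definition lin_indep2 :: "complex^4 \<Rightarrow> complex^4 \<Rightarrow> bool" where
  "lin_indep2 p q \<longleftrightarrow> (\<forall>s t. s *s p + t *s q = 0 \<longrightarrow> s = 0 \<and> t = 0)"

lemma bform_add: "bform (x + y) z = bform x z + bform y z"
  and bform_scale: "bform (c *s x) z = c * bform x z"
  and bform_swap: "bform z x = - cnj (bform x z)"
  and bform_zero: "bform 0 z = 0"
  by (simp_all add: bform_def algebra_simps)

lemma bform_add_right: "bform z (x + y) = bform z x + bform z y"
  and bform_scale_right: "bform z (c *s x) = cnj c * bform z x"
  by (simp_all add: bform_def algebra_simps)

lemma sum_norm_sq_zero4:
  fixes x1 x2 x3 x4 :: complex
  assumes "x1 * cnj x1 + x2 * cnj x2 + x3 * cnj x3 + x4 * cnj x4 = 0"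
  shows "x1 = 0 \<and> x2 = 0 \<and> x3 = 0 \<and> x4 = 0"
proof -
  have "complex_of_real ((cmod x1)\<^sup>2 + (cmod x2)\<^sup>2 + (cmod x3)\<^sup>2 + (cmod x4)\<^sup>2) = 0"
    using assms by (simp only: of_real_add complex_norm_square)
  hence "(cmod x1)\<^sup>2 + (cmod x2)\<^sup>2 + (cmod x3)\<^sup>2 + (cmod x4)\<^sup>2 = 0" by (simp only: of_real_eq_0_iff)
  hence "(cmod x1)\<^sup>2 = 0 \<and> (cmod x2)\<^sup>2 = 0 \<and> (cmod x3)\<^sup>2 = 0 \<and> (cmod x4)\<^sup>2 = 0"
    using zero_le_power2[of "cmod x1"] zero_le_power2[of "cmod x2"] zero_le_power2[of "cmod x3"]
      zero_le_power2[of "cmod x4"] by linarith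
  thus ?thesis by simp
qed

lemma bform_dual:
  assumes i: "lin_indep2 p q"
  shows "\<exists>c. bform c p = s \<and> bform c q = t"
proof -
  \<comment> \<open>Chosen so that \<open>bform (n y) z\<close> is the standard Hermitian product of
    \<open>y\<close> and \<open>z\<close>. The linear system for the coefficients thus has the Gram
    matrix of \<open>p\<close> and \<open>q\<close>.\<close>
  define n :: "complex^4 \<Rightarrow> complex^4" where "n z = vector [- z$2, z$1, z$4, - z$3]" for z
  have n: "n z $ 1 = - z$2" "n z $ 2 = z$1" "n z $ 3 = z$4" "n z $ 4 = - z$3" for z
    by (simp_all add: n_def vector_def)
  have "\<exists>\<alpha> \<beta>. \<alpha> * bform (n p) p + \<beta> * bform (n q) p = s \<and> \<alpha> * bform (n p) q + \<beta> * bform (n q) q = t"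
  proof (rule solve_2x2)
    fix \<alpha> \<beta> assume z: "\<alpha> * bform (n p) p + \<beta> * bform (n q) p = 0" "\<alpha> * bform (n p) q + \<beta> * bform (n q) q
      = 0"
    let ?x = "\<lambda>j::4. \<alpha> * p$j + \<beta> * q$j"
    have "?x 1 * cnj (?x 1) + ?x 2 * cnj (?x 2) + ?x 3 * cnj (?x 3) + ?x 4 * cnj (?x 4) =
       cnj \<alpha> * (\<alpha> * bform (n p) p + \<beta> * bform (n q) p) + cnj \<beta> * (\<alpha> * bform (n p) q + \<beta> * bform (n q) q)"
      unfolding bform_def n by (simp add: algebra_simps)
    also have "\<dots> = 0" unfolding z by simp
    finally have "?x 1 = 0 \<and> ?x 2 = 0 \<and> ?x 3 = 0 \<and> ?x 4 = 0" by (rule sum_norm_sq_zero4)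
    hence "\<alpha> *s p + \<beta> *s q = 0" by (simp add: vec_eq_iff forall_4)
    thus "\<alpha> = 0 \<and> \<beta> = 0" using i unfolding lin_indep2_def by blast
  qed
  then obtain \<alpha> \<beta> where "\<alpha> * bform (n p) p + \<beta> * bform (n q) p = s" "\<alpha> * bform (n p) q + \<beta> * bform (n q) q
    = t" by blast
  thus ?thesis by (intro exI[of _ "\<alpha> *s n p + \<beta> *s n q"]) (simp add: bform_add bform_scale)
qed

text \<open>An isotropic plane is its own annihilator: with dual vectors \<open>c\<close>, \<open>d\<close> the four vectors
  \<open>p, q, c, d\<close> form a basis.\<close>
lemma isotropic_plane_maximal:
  assumes i: "lin_indep2 p q" and iso: "bform p p = 0" "bform p q = 0" "bform q p = 0" "bform q q = 0"
    and y: "bform y p = 0" "bform y q = 0"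
  shows "\<exists>s t. y = s *s p + t *s q"
proof -
  obtain c where c: "bform c p = 1" "bform c q = 0" using bform_dual[OF i] by blast
  obtain d where d: "bform d p = 0" "bform d q = 1" using bform_dual[OF i] by blast
  define L :: "complex^4 \<Rightarrow> complex^4" where "L v = v$1 *s p + v$2 *s q + v$3 *s c + v$4 *s d" for v
  have lin: "Vector_Spaces.linear (*s) (*s) L"
    by unfold_locales (simp_all add: L_def vec_eq_iff algebra_simps)
  have bL: "bform (L v) p = v$3" "bform (L v) q = v$4" for v
    unfolding L_def by (simp_all add: bform_add bform_scale iso c d)
  have "inj L"
  proof (subst vec.linear_inj_iff_eq_0[OF lin], intro allI impI)
    fix v assume v: "L v = 0"
    have "v$3 = 0" "v$4 = 0" using bL[of v] v by (simp_all add: bform_zero)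
    moreover from this have "v$1 *s p + v$2 *s q = 0" using v by (simp add: L_def)
    hence "v$1 = 0 \<and> v$2 = 0" using i unfolding lin_indep2_def by blast
    ultimately show "v = 0" by (simp add: vec_eq_iff forall_4)
  qed
  hence "surj L" by (intro vec.linear_injective_imp_surjective[OF lin]) simp_all
  then obtain v where v: "y = L v" by (metis surjD)
  have "v$3 = 0" "v$4 = 0" using bL[of v] y v by simp_all
  thus ?thesis using v by (auto simp: L_def)
qed

section \<open>Boundary matrices and self-annihilating planes\<close>

text \<open>The vector that represents row \<open>i\<close> of the boundary condition:
  \<open>bform y (coker_vec Ba Bb i)\<close> is row \<open>i\<close> of \<open>Bb\<close> applied to
  the values at \<open>b\<close> minus row \<open>i\<close> of \<open>Ba\<close> applied to those at
  \<open>a\<close>. The conjugations compensate the conjugate-linear second argument of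
  \<open>bform\<close>.\<close>

definition coker_vec :: "complex^2^2 \<Rightarrow> complex^2^2 \<Rightarrow> 2 \<Rightarrow> complex^4" where
  "coker_vec Ba Bb i = vector [- cnj (Ba$i$2), cnj (Ba$i$1), - cnj (Bb$i$2), cnj (Bb$i$1)]"

lemma coker_vec_nth: "coker_vec Ba Bb i $ 1 = - cnj (Ba$i$2)" "coker_vec Ba Bb i $ 2 = cnj (Ba$i$1)"
  "coker_vec Ba Bb i $ 3 = - cnj (Bb$i$2)" "coker_vec Ba Bb i $ 4 = cnj (Bb$i$1)"
  by (simp_all add: coker_vec_def vector_def)

lemma bc_iff_bform:
  "Ba *v vector [y$1, y$2] = Bb *v vector [y$3, y$4] \<longleftrightarrow> bform y (coker_vec Ba Bb 1) = 0
    \<and> bform y (coker_vec Ba Bb 2) = 0"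
  unfolding bform_def coker_vec_nth
  by (auto simp: vec_eq_iff forall_2 matrix_vector_mult_def sum_2 vector_2 algebra_simps)

text \<open>The form of the vectors \<open>i\<close> and \<open>j\<close> is the conjugate of entry
  \<open>(i, j)\<close> of \<open>Ba ** Jmat ** cadj Ba - Bb ** Jmat ** cadj Bb\<close>.\<close>

lemma matrix_identity_iff:
  "Ba ** Jmat ** cadj Ba = Bb ** Jmat ** cadj Bb \<longleftrightarrow> (\<forall>i j. bform (coker_vec Ba Bb i) (coker_vec Ba Bb j)
    = 0)"
  unfolding bform_def coker_vec_nth
  by (auto simp: vec_eq_iff forall_2 matrix_matrix_mult_def sum_2 Jmat_def cadj_def algebra_simps)

text \<open>Up to signs, conjugation and a permutation of the entries, the two vectors are the rows
  of the block matrix, and rank 2 means that these rows are independent.\<close>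

lemma rank_block_iff:
  "rank (block Ba Bb) = 2 \<longleftrightarrow> lin_indep2 (coker_vec Ba Bb 1) (coker_vec Ba Bb 2)"
proof -
  let ?M = "block Ba Bb"
  let ?r = "row 1 ?M" and ?q = "row 2 ?M"
  have rows: "rows ?M = {?r, ?q}" by (auto simp: rows_def) (metis exhaust_2)
  have li: "lin_indep2 (coker_vec Ba Bb 1) (coker_vec Ba Bb 2) \<longleftrightarrow> (\<forall>s t. s *s ?r + t *s ?q = 0 \<longrightarrow> s = 0 \<and> t
    = 0)"
  proof -
    have e: "s *s ?r + t *s ?q = 0 \<longleftrightarrow> cnj s *s coker_vec Ba Bb 1 + cnj t *s coker_vec Ba Bb 2 = 0" for s t
    proof -
      have "s *s ?r + t *s ?q = 0 \<longleftrightarrow> (\<forall>k. s * Ba$1$k + t * Ba$2$k = 0) \<and> (\<forall>k. s * Bb$1$k + t * Bb$2$k = 0)"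
      proof
        assume z: "s *s ?r + t *s ?q = 0"
        have "(s *s ?r + t *s ?q) $ (Inl k) = 0" "(s *s ?r + t *s ?q) $ (Inr k) = 0" for k unfolding z
          by simp_all
        thus "(\<forall>k. s * Ba$1$k + t * Ba$2$k = 0) \<and> (\<forall>k. s * Bb$1$k + t * Bb$2$k = 0)"
          by (simp add: row_def block_def)
      next
        assume z: "(\<forall>k. s * Ba$1$k + t * Ba$2$k = 0) \<and> (\<forall>k. s * Bb$1$k + t * Bb$2$k = 0)"
        show "s *s ?r + t *s ?q = 0"
        proof (subst vec_eq_iff, rule allI)
          fix j :: "2 + 2" show "(s *s ?r + t *s ?q) $ j = 0 $ j"
            using z by (cases j) (simp_all add: row_def block_def)
        qed
      qed
      also have "\<dots> \<longleftrightarrow> cnj s *s coker_vec Ba Bb 1 + cnj t *s coker_vec Ba Bb 2 = 0"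
      proof -
        have m: "cnj x * cnj y + cnj z * cnj w = 0 \<longleftrightarrow> x * y + z * w = 0" for x y z w
        proof -
          have "cnj x * cnj y + cnj z * cnj w = cnj (x * y + z * w)" by simp
          thus ?thesis by (simp only: complex_cnj_zero_iff)
        qed
        have m': "- (cnj x * cnj y) = cnj z * cnj w \<longleftrightarrow> x * y + z * w = 0" for x y z w
          using m[of x y z w] by (metis add_eq_0_iff)
        show ?thesis by (auto simp: vec_eq_iff forall_4 forall_2 coker_vec_nth m m')
      qed
      finally show ?thesis .
    qed
    show ?thesis unfolding lin_indep2_def e by (metis complex_cnj_cnj complex_cnj_zero_iff)
  qed
  show ?thesis unfolding li
  proof
    assume rk: "rank ?M = 2"
    show "\<forall>s t. s *s ?r + t *s ?q = 0 \<longrightarrow> s = 0 \<and> t = 0"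
    proof (rule ccontr)
      assume "\<not> (\<forall>s t. s *s ?r + t *s ?q = 0 \<longrightarrow> s = 0 \<and> t = 0)"
      then obtain s t where z: "s *s ?r + t *s ?q = 0" and nz: "s \<noteq> 0 \<or> t \<noteq> 0" by blast
      have "\<exists>w. {?r, ?q} \<subseteq> vec.span {w}"
        using nz
      proof
        assume s: "s \<noteq> 0"
        have "s *s ?r = (- t) *s ?q" using z by (simp add: add_eq_0_iff)
        hence "inverse s *s (s *s ?r) = inverse s *s ((- t) *s ?q)" by simp
        hence "?r = (- t / s) *s ?q" using s by (simp add: vector_smult_assoc divide_inverse mult.commute)
        hence "?r \<in> vec.span {?q}" by (simp only: vec.span_scale vec.span_base insertI1)
        thus ?thesis by (intro exI[of _ ?q]) (simp add: vec.span_base)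
      next
        assume t: "t \<noteq> 0"
        have "t *s ?q = (- s) *s ?r" using z by (simp add: add_eq_0_iff2)
        hence "inverse t *s (t *s ?q) = inverse t *s ((- s) *s ?r)" by simp
        hence "?q = (- s / t) *s ?r" using t by (simp add: vector_smult_assoc divide_inverse mult.commute)
        hence "?q \<in> vec.span {?r}" by (simp only: vec.span_scale vec.span_base insertI1)
        thus ?thesis by (intro exI[of _ ?r]) (simp add: vec.span_base)
      qed
      then obtain w where "{?r, ?q} \<subseteq> vec.span {w}" by blast
      hence "vec.dim {?r, ?q} \<le> card {w}" by (rule vec.dim_le_card) simp
      thus False using rk by (simp add: row_rank_def_gen rows)
    qed
  next
    assume ind: "\<forall>s t. s *s ?r + t *s ?q = 0 \<longrightarrow> s = 0 \<and> t = 0"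
    have ne: "?r \<noteq> ?q"
    proof
      assume "?r = ?q"
      hence "1 *s ?r + (-1) *s ?q = 0" by simp
      thus False using ind by (metis one_neq_zero)
    qed
    have q0: "?q \<noteq> 0"
    proof
      assume "?q = 0"
      hence "0 *s ?r + 1 *s ?q = 0" by simp
      thus False using ind by (metis one_neq_zero)
    qed
    have "?r \<notin> vec.span {?q}"
    proof
      assume "?r \<in> vec.span {?q}"
      then obtain k where "?r = k *s ?q" unfolding vec.span_singleton by auto
      hence "1 *s ?r + (- k) *s ?q = 0" by simp
      thus False using ind by (metis one_neq_zero)
    qed
    hence "vec.independent {?r, ?q}" using q0 ne by (simp add: vec.independent_insert)
    hence "vec.dim {?r, ?q} = card {?r, ?q}" by (rule vec.dim_eq_card_independent)
    thus "rank ?M = 2" using ne by (simp add: row_rank_def_gen rows)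
  qed
qed

text \<open>The solution set is the annihilator of the plane spanned by the two row vectors. The
  matrix identity makes this plane isotropic, so by maximality the solution set is the plane
  itself.\<close>

lemma lagrangian_of_matrices:
  assumes r: "rank (block Ba Bb) = 2" and m: "Ba ** Jmat ** cadj Ba = Bb ** Jmat ** cadj Bb"
  defines "L \<equiv> {y. Ba *v vector [y$1, y$2] = Bb *v vector [y$3, y$4]}"
  shows "y \<in> L \<longleftrightarrow> (\<forall>z\<in>L. bform y z = 0)"
proof -
  let ?p = "coker_vec Ba Bb 1" and ?q = "coker_vec Ba Bb 2"
  have i: "lin_indep2 ?p ?q" using r rank_block_iff by blast
  have iso: "bform (coker_vec Ba Bb i) (coker_vec Ba Bb j) = 0" for i j using m matrix_identity_iff by blast
  have L: "y \<in> L \<longleftrightarrow> bform y ?p = 0 \<and> bform y ?q = 0" for y by (simp add: L_def bc_iff_bform)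
  show ?thesis
  proof
    assume y: "y \<in> L"
    show "\<forall>z\<in>L. bform y z = 0"
    proof
      fix z assume "z \<in> L"
      then obtain s t where "z = s *s ?p + t *s ?q" using isotropic_plane_maximal[OF i iso iso iso iso] L
        by blast
      thus "bform y z = 0" using y by (simp add: L bform_add_right bform_scale_right)
    qed
  next
    assume "\<forall>z\<in>L. bform y z = 0"
    thus "y \<in> L" using iso by (simp add: L)
  qed
qed

text \<open>One linear equation in four unknowns has a solution space of dimension three, which no
  line can contain. It is used to exclude one-dimensional candidates.\<close>

lemma isotropic_not_line:
  assumes "b \<noteq> 0" shows "\<exists>y. bform y b = 0 \<and> (\<forall>s. y \<noteq> s *s b)"
proof (rule ccontr)
  assume "\<not> ?thesis"
  hence H: "bform y b = 0 \<Longrightarrow> \<exists>s. y = s *s b" for y by blast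
  have v: "vector [w, x, y, z] $ (1::4) = (w::complex)" "vector [w, x, y, z] $ (2::4)
    = x" "vector [w, x, y, z] $ (3::4) = y" "vector [w, x, y, z] $ (4::4) = z" for w x y z :: complex
    by (simp_all add: vector_def)
  \<comment> \<open>The coefficients of the linear equation \<open>bform y b = 0\<close>. Each test
    vector below fills two coordinates so that their two terms cancel.\<close>
  define n1 n2 n3 n4 where n: "n1 = - cnj (b$2)" "n2 = cnj (b$1)" "n3 = cnj (b$4)" "n4 = - cnj (b$3)"
  have bf: "bform y b = y$1 * n1 + y$2 * n2 + y$3 * n3 + y$4 * n4" for y by
    (simp add: bform_def n algebra_simps)
  have nz: "n1 \<noteq> 0 \<or> n2 \<noteq> 0 \<or> n3 \<noteq> 0 \<or> n4 \<noteq> 0" using assms by (auto simp: n vec_eq_iff forall_4)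
  obtain s1 where s1: "vector [n2, - n1, 0, 0] = s1 *s b" using H[of "vector [n2, - n1, 0, 0]"] by
    (auto simp: bf v)
  obtain s2 where s2: "vector [n3, 0, - n1, 0] = s2 *s b" using H[of "vector [n3, 0, - n1, 0]"] by
    (auto simp: bf v)
  obtain s3 where s3: "vector [0, 0, n4, - n3] = s3 *s b" using H[of "vector [0, 0, n4, - n3]"] by
    (auto simp: bf v)
  obtain s4 where s4: "vector [0, n3, - n2, 0] = s4 *s b" using H[of "vector [0, n3, - n2, 0]"] by
    (auto simp: bf v)
  obtain s5 where s5: "vector [0, n4, 0, - n2] = s5 *s b" using H[of "vector [0, n4, 0, - n2]"] by
    (auto simp: bf v)
  have e1: "n2 = s1 * b$1" "- n1 = s1 * b$2" "0 = s1 * b$3" "0 = s1 * b$4"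
    using arg_cong[OF s1, of "\<lambda>w. w $ 1"] arg_cong[OF s1, of "\<lambda>w. w $ 2"] arg_cong[OF s1, of "\<lambda>w. w $ 3"]
    arg_cong[OF s1, of "\<lambda>w. w $ 4"] by (simp_all add: v)
  have e2: "- n1 = s2 * b$3" using arg_cong[OF s2, of "\<lambda>w. w $ 3"] by (simp add: v)
  have e3: "n4 = s3 * b$3" "- n3 = s3 * b$4" "0 = s3 * b$2"
    using arg_cong[OF s3, of "\<lambda>w. w $ 3"] arg_cong[OF s3, of "\<lambda>w. w $ 4"] arg_cong[OF s3, of "\<lambda>w. w $ 2"] by
    (simp_all add: v)
  have e4: "n3 = s4 * b$2" "- n2 = s4 * b$3"
    using arg_cong[OF s4, of "\<lambda>w. w $ 2"] arg_cong[OF s4, of "\<lambda>w. w $ 3"] by (simp_all add: v)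
  have e5: "n4 = s5 * b$2" using arg_cong[OF s5, of "\<lambda>w. w $ 2"] by (simp add: v)
  show False
  proof (cases "s1 = 0")
    case True
    hence 12: "n1 = 0" "n2 = 0" using e1 by auto
    hence "b$2 = 0" by (simp add: n)
    thus False using 12 e4 e5 nz by auto
  next
    case False
    hence "b$3 = 0" "b$4 = 0" using e1 by auto
    hence "n3 = 0" "n4 = 0" "n1 = 0" "n2 = 0" using e2 e4 by (auto simp: n)
    thus False using nz by auto
  qed
qed

text \<open>\<open>L\<close> cannot be \<open>{0}\<close>, whose annihilator is everything, nor lie
  in a line through some nonzero \<open>p\<close>, whose annihilator is larger. So it contains two
  independent vectors; they annihilate each other, and by maximality their span is all of
  \<open>L\<close>.\<close>

lemma matrices_of_lagrangian:
  assumes L: "\<And>y. y \<in> L \<longleftrightarrow> (\<forall>z\<in>L. bform y z = 0)"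
  shows "\<exists>Ba Bb. rank (block Ba Bb) = 2 \<and> Ba ** Jmat ** cadj Ba = Bb ** Jmat ** cadj Bb \<and>
     L = {y. Ba *v vector [y$1, y$2] = Bb *v vector [y$3, y$4]}"
proof -
  have "\<exists>p\<in>L. p \<noteq> 0"
  proof (rule ccontr)
    assume no: "\<not> (\<exists>p\<in>L. p \<noteq> 0)"
    hence "y \<in> L" for y unfolding L[of y] by (auto simp: bform_def)
    moreover have "(vector [1, 0, 0, 0] :: complex^4) \<noteq> 0" by (simp add: vec_eq_iff forall_4 vector_def)
    ultimately show False using no by blast
  qed
  then obtain p where p: "p \<in> L" "p \<noteq> 0" by blast
  have "\<exists>q\<in>L. \<forall>s. q \<noteq> s *s p"
  proof (rule ccontr)
    assume "\<not> ?thesis"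
    hence H: "\<And>q. q \<in> L \<Longrightarrow> \<exists>s. q = s *s p" by blast
    obtain y where y: "bform y p = 0" "\<And>s. y \<noteq> s *s p" using isotropic_not_line[OF p(2)] by blast
    have "y \<in> L"
      unfolding L[of y]
    proof
      fix z assume "z \<in> L"
      then obtain s where "z = s *s p" using H by blast
      thus "bform y z = 0" using y(1) by (simp add: bform_scale_right)
    qed
    thus False using H y(2) by blast
  qed
  then obtain q where q: "q \<in> L" "\<And>s. q \<noteq> s *s p" by blast
  have i: "lin_indep2 p q" unfolding lin_indep2_def
  proof (intro allI impI)
    fix s t assume z: "s *s p + t *s q = 0"
    have t: "t = 0"
    proof (rule ccontr)
      assume t: "t \<noteq> 0"
      have "q = (- s / t) *s p"
      proof (subst vec_eq_iff, rule allI)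
        fix j
        have "(s *s p + t *s q) $ j = 0" unfolding z by simp
        hence "t * q$j = - (s * p$j)" by (simp add: add_eq_0_iff)
        thus "q$j = ((- s / t) *s p) $ j" using t by (simp add: field_simps)
      qed
      thus False using q(2) by blast
    qed
    hence "s *s p = 0" using z by simp
    thus "s = 0 \<and> t = 0" using p(2) t by (simp add: vec.scale_eq_0_iff)
  qed
  have iso: "bform p p = 0" "bform p q = 0" "bform q p = 0" "bform q q = 0" using L[of p] L[of q] p q
    by auto
  have LL: "y \<in> L \<longleftrightarrow> bform y p = 0 \<and> bform y q = 0" for y
  proof
    assume "y \<in> L" thus "bform y p = 0 \<and> bform y q = 0" using L[of y] p q by auto
  next
    assume "bform y p = 0 \<and> bform y q = 0"
    then obtain s t where y: "y = s *s p + t *s q" using isotropic_plane_maximal[OF i iso] by blast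
    show "y \<in> L" unfolding L[of y] unfolding y using L[of p] L[of q] p(1) q(1) by
      (simp add: bform_add bform_scale)
  qed
  \<comment> \<open>The matrices are obtained by inverting \<open>coker_vec\<close>, so that its
    values are \<open>p\<close> and \<open>q\<close>.\<close>
  define Ba :: "complex^2^2" where "Ba = (\<chi> i. if i = 1 then vector [cnj (p$2),
    - cnj (p$1)] else vector [cnj (q$2), - cnj (q$1)])"
  define Bb :: "complex^2^2" where "Bb = (\<chi> i. if i = 1 then vector [cnj (p$4),
    - cnj (p$3)] else vector [cnj (q$4), - cnj (q$3)])"
  have c: "coker_vec Ba Bb 1 = p" "coker_vec Ba Bb 2 = q"
    by (simp_all add: vec_eq_iff forall_4 coker_vec_nth Ba_def Bb_def vector_2)
  have "rank (block Ba Bb) = 2" using i unfolding rank_block_iff c .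
  moreover have "Ba ** Jmat ** cadj Ba = Bb ** Jmat ** cadj Bb"
    unfolding matrix_identity_iff forall_2 c using iso by simp
  moreover have "L = {y. Ba *v vector [y$1, y$2] = Bb *v vector [y$3, y$4]}"
    unfolding bc_iff_bform c using LL by auto
  ultimately show ?thesis by blast
qed

section \<open>Self-adjoint restrictions\<close>

lemma cnjf_cnjf [simp]: "cnjf (cnjf f) = f"
  by (simp add: cnjf_def)

lemma aecl_superset: "(f, g) \<in> R \<Longrightarrow> L2 M f \<Longrightarrow> L2 M g \<Longrightarrow> (f, g) \<in> aecl M R"
  unfolding aecl_def by fastforce

lemma aecl_AE_closed:
  assumes "(f', g') \<in> aecl M R" "L2 M f" "L2 M g" "AE x in M. f x = f' x \<and> g x = g' x"
  shows "(f, g) \<in> aecl M R"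
proof -
  from assms(1) obtain f'' g'' where r: "(f'', g'') \<in> R" "AE x in M. f' x = f'' x \<and> g' x = g'' x"
    unfolding aecl_def by blast
  have "AE x in M. f x = f'' x \<and> g x = g'' x" using assms(4) r(2) by eventually_elim simp
  thus ?thesis using r(1) assms(2,3) unfolding aecl_def by blast
qed

lemma aeclE:
  assumes "(f, g) \<in> aecl M R"
  obtains f' g' where "(f', g') \<in> R" "AE x in M. f x = f' x" "AE x in M. g x = g' x" "L2 M f" "L2 M g"
  using assms unfolding aecl_def by fastforce

lemma aecl_mono: "R \<subseteq> R' \<Longrightarrow> aecl M R \<subseteq> aecl M R'"
  unfolding aecl_def by blast

lemma L2_integral_cong:
  assumes "L2 M f" "L2 M g" "L2 M f'" "L2 M g'" "AE x in M. f x = f' x" "AE x in M. g x = g' x"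
  shows "(LINT x|M. f x * cnj (g x)) = (LINT x|M. f' x * cnj (g' x))"
proof (rule integral_cong_AE)
  show "(\<lambda>x. f x * cnj (g x)) \<in> borel_measurable M" "(\<lambda>x. f' x * cnj (g' x)) \<in> borel_measurable M"
    using L2_mult[OF assms(1) L2_cnj[OF assms(2)]] L2_mult[OF assms(3) L2_cnj[OF assms(4)]] by auto
  show "AE x in M. f x * cnj (g x) = f' x * cnj (g' x)" using assms(5,6) by eventually_elim simp
qed

section \<open>Boundary coordinates and self-adjoint restrictions\<close>

locale boundary_functionals = limit_circle +
  fixes w1 w2 :: "real \<Rightarrow> complex"
  assumes w1: "\<exists>g. (w1, g) \<in> Tmax a b \<rho> \<sigma> \<kappa>"
    and w2: "\<exists>g. (w2, g) \<in> Tmax a b \<rho> \<sigma> \<kappa>"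
    and wa: "W_a a b \<rho> \<sigma> \<kappa> w1 (cnjf w2) = 1" "W_a a b \<rho> \<sigma> \<kappa> w1 (cnjf w1) = 0"
            "W_a a b \<rho> \<sigma> \<kappa> w2 (cnjf w2) = 0"
    and wb: "W_b a b \<rho> \<sigma> \<kappa> w1 (cnjf w2) = 1" "W_b a b \<rho> \<sigma> \<kappa> w1 (cnjf w1) = 0"
            "W_b a b \<rho> \<sigma> \<kappa> w2 (cnjf w2) = 0"
begin

abbreviation "Wa \<equiv> W_a a b \<rho> \<sigma> \<kappa>"
abbreviation "Wb \<equiv> W_b a b \<rho> \<sigma> \<kappa>"

lemma w_TD: "TD w1" "TD w2" "TD (cnjf w1)" "TD (cnjf w2)"
  using w1 w2 TD_cnj by (auto simp: TD_def)

text \<open>Modulo its radical \<open>\<omega>\<close> lives on a symplectic plane with basis \<open>w1, w2\<^sup>*\<close>, and there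
  \<open>w1\<^sup>*\<close> and \<open>w2\<^sup>*\<close> are multiples of \<open>w1\<close> and \<open>w2\<close> by the same factor \<open>\<omega> w1\<^sup>* w2\<^sup>*\<close>.\<close>
lemma endform_boundary_values:
  assumes E: "endform E \<omega>" and w: "\<omega> w1 (cnjf w2) = 1" "\<omega> w1 (cnjf w1) = 0" "\<omega> w2 (cnjf w2) = 0"
    and f: "TD f" and u: "TD u"
  shows "\<omega> f (cnjf u) = \<omega> f (cnjf w2) * cnj (\<omega> (cnjf w1) u) - \<omega> (cnjf w1) f * cnj (\<omega> u (cnjf w2))"
proof -
  note t = w_TD
  let ?x = "cnjf u" and ?c1 = "cnjf w1" and ?c2 = "cnjf w2"
  have x: "TD ?x" by (rule TD_cnj[OF u])
  note as = endform_antisym[OF E]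
  have c12: "\<omega> ?c1 w2 = 1" using endform_cnj[OF E t(1,4)] w by simp
  have k: "cnj (\<omega> ?c1 u) = \<omega> w1 ?x" "cnj (\<omega> u ?c2) = \<omega> ?x w2"
    using endform_cnj[OF E t(3) u] endform_cnj[OF E u t(4)] by simp_all
  define m where "m = \<omega> ?c1 ?c2"
  have 1: "\<omega> f ?c1 = m * \<omega> f w1"
    using endform_plucker[OF E f t(1) t(3) t(4)] as[OF t(1,4)] w by (simp add: m_def mult.commute)
  have 2: "\<omega> ?x ?c2 = m * \<omega> ?x w2"
    using endform_plucker[OF E x t(2) t(4) t(3)] as[OF t(3,4)] c12 w by (simp add: m_def mult.commute)
  \<comment> \<open>The Pluecker relation for \<open>f\<close>, \<open>cnjf u\<close>,
    \<open>w1\<close>, \<open>cnjf w2\<close> expands \<open>\<omega> f ?x\<close> in the basis. The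
    two proportionalities with the common factor \<open>m\<close> then replace \<open>w1\<close> by
    \<open>cnjf w1\<close> in one factor and \<open>cnjf w2\<close> by \<open>w2\<close> in the
    other.\<close>
  have "\<omega> f ?x * 1 + \<omega> f w1 * \<omega> ?c2 ?x + \<omega> f ?c2 * \<omega> ?x w1 = 0"
    using endform_plucker[OF E f x t(1) t(4)] w by simp
  moreover have "\<omega> ?c2 ?x = - (m * \<omega> ?x w2)" "\<omega> ?x w1 = - \<omega> w1 ?x" "\<omega> ?c1 f = - (m * \<omega> f w1)"
    using as[OF x t(4)] as[OF t(1) x] as[OF f t(3)] 1 2 by simp_all
  ultimately show ?thesis unfolding k by algebra
qed

definition \<Gamma> :: "(real \<Rightarrow> complex) \<Rightarrow> complex^4" where
  "\<Gamma> f = vector [Wa f (cnjf w2), Wa (cnjf w1) f, Wb f (cnjf w2), Wb (cnjf w1) f]"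

lemma \<Gamma>_nth: "\<Gamma> f $ 1 = Wa f (cnjf w2)" "\<Gamma> f $ 2 = Wa (cnjf w1) f" "\<Gamma> f $ 3 = Wb f (cnjf w2)" "\<Gamma> f $ 4
  = Wb (cnjf w1) f"
  by (simp_all add: \<Gamma>_def vector_def)

lemma lagrange_bform:
  assumes f: "(f, g) \<in> T" and u: "(u, v) \<in> T"
  shows "(LINT x|\<rho>. g x * cnj (u x)) - (LINT x|\<rho>. f x * cnj (v x)) = bform (\<Gamma> f) (\<Gamma> u)"
proof -
  have t: "TD f" "TD u" using f u by (auto simp: TD_def)
  have L: "L2 \<rho> f" "L2 \<rho> g" "L2 \<rho> u" "L2 \<rho> v" using f u by (auto simp: Tmax_iff)
  have "(LINT x|\<rho>. g x * cnj (u x)) - (LINT x|\<rho>. f x * cnj (v x)) = (LINT x|\<rho>. g x * cnjf u x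
    - f x * cnjf v x)"
    unfolding cnjf_def using L2_mult[OF L(2) L2_cnj[OF L(3)]] L2_mult[OF L(1) L2_cnj[OF L(4)]] by simp
  also have "\<dots> = Wb f (cnjf u) - Wa f (cnjf u)" using wronski_limits(3)[OF f Tmax_cnj[OF u]] by simp
  also have "\<dots> = bform (\<Gamma> f) (\<Gamma> u)"
    unfolding bform_def \<Gamma>_nth endform_boundary_values[OF endform_a wa t] endform_boundary_values[OF
      endform_b wb t] ..
  finally show ?thesis .
qed

lemma \<Gamma>_zero:
  assumes "TD u" "\<And>g. TD g \<Longrightarrow> Wa u g = 0 \<and> Wb u g = 0"
  shows "\<Gamma> u = 0"
proof -
  have "Wa (cnjf w1) u = - Wa u (cnjf w1)" "Wb (cnjf w1) u = - Wb u (cnjf w1)"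
    using endform_antisym[OF endform_a assms(1) w_TD(3)] endform_antisym[OF endform_b assms(1) w_TD(3)]
      by auto
  thus ?thesis using assms(2)[OF w_TD(3)] assms(2)[OF w_TD(4)] by (simp add: vec_eq_iff forall_4 \<Gamma>_nth)
qed

lemma \<Gamma>_surj: "\<exists>f g. (f, g) \<in> T \<and> \<Gamma> f = y"
proof -
  note t = w_TD
  obtain F1 where F1: "TD F1" "\<And>g. TD g \<Longrightarrow> Wa F1 g = 0 \<and> Wb F1 g = Wb w1 g" using cutoff_left[OF t(1)]
    by blast
  obtain F2 where F2: "TD F2" "\<And>g. TD g \<Longrightarrow> Wa F2 g = 0 \<and> Wb F2 g = Wb w2 g" using cutoff_left[OF t(2)]
    by blast
  \<comment> \<open>At either end \<open>w1\<close> and \<open>w2\<close> have boundary values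
    \<open>(1, 0)\<close> and \<open>(0, 1)\<close>. They settle the values at \<open>a\<close>;
    \<open>F1\<close> and \<open>F2\<close> are invisible at \<open>a\<close> and behave like
    \<open>w1\<close> and \<open>w2\<close> at \<open>b\<close>, where they correct by the
    differences.\<close>
  let ?f = "\<lambda>x. y$1 * w1 x + (y$2 * w2 x + ((y$3 - y$1) * F1 x + (y$4 - y$2) * F2 x))"
  have fT: "TD ?f" by (intro TD_add TD_cmult t F1 F2)
  have lin: "\<omega> ?f u = y$1 * \<omega> w1 u + (y$2 * \<omega> w2 u + ((y$3 - y$1) * \<omega> F1 u + (y$4 - y$2) * \<omega> F2 u))"
    if E: "endform E \<omega>" and u: "TD u" for E \<omega> u
    by (simp only: endform_add[OF E TD_cmult[OF t(1)] TD_add[OF TD_cmult[OF t(2)] TD_add[OF TD_cmult[OF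
      F1(1)] TD_cmult[OF F2(1)]]] u]
      endform_add[OF E TD_cmult[OF t(2)] TD_add[OF TD_cmult[OF F1(1)] TD_cmult[OF F2(1)]] u]
      endform_add[OF E TD_cmult[OF F1(1)] TD_cmult[OF F2(1)] u] endform_cmult[OF E t(1) u] endform_cmult[OF
        E t(2) u]
      endform_cmult[OF E F1(1) u] endform_cmult[OF E F2(1) u])
  have a: "Wa w2 (cnjf w1) = -1" "Wb w2 (cnjf w1) = -1"
    using endform_cnj[OF endform_a t(1,4)] endform_cnj[OF endform_b t(1,4)] wa wb
      endform_antisym[OF endform_a t(3,2)] endform_antisym[OF endform_b t(3,2)] by simp_all
  have "Wa ?f (cnjf w2) = y$1" "Wb ?f (cnjf w2) = y$3" "Wa ?f (cnjf w1) = - (y$2)" "Wb ?f (cnjf w1) =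
    - (y$4)"
    unfolding lin[OF endform_a t(4)] lin[OF endform_b t(4)] lin[OF endform_a t(3)] lin[OF endform_b t(3)]
    using F1(2)[OF t(3)] F1(2)[OF t(4)] F2(2)[OF t(3)] F2(2)[OF t(4)] wa wb a by simp_all
  hence "\<Gamma> ?f = y" using endform_antisym[OF endform_a fT t(3)] endform_antisym[OF endform_b fT t(3)]
    by (simp add: vec_eq_iff forall_4 \<Gamma>_nth)
  thus ?thesis using fT unfolding TD_def by blast
qed

text \<open>The left side depends only on classes modulo \<rho>-null sets, the right side on
  representatives in \<open>T\<close>. Boundary vectors may therefore be computed from whichever
  representatives are at hand.\<close>

lemma adjoint_pairing:
  assumes f: "(f', g') \<in> T" "AE x in \<rho>. f x = f' x" "AE x in \<rho>. g x = g' x" "L2 \<rho> f" "L2 \<rho> g"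
    and u: "(u', v') \<in> T" "AE x in \<rho>. u x = u' x" "AE x in \<rho>. v x = v' x" "L2 \<rho> u" "L2 \<rho> v"
  shows "(LINT x|\<rho>. v x * cnj (f x)) = (LINT x|\<rho>. u x * cnj (g x)) \<longleftrightarrow> bform (\<Gamma> f') (\<Gamma> u') = 0"
proof -
  have L: "L2 \<rho> f'" "L2 \<rho> g'" "L2 \<rho> u'" "L2 \<rho> v'" using f(1) u(1) by (auto simp: Tmax_iff)
  have "(LINT x|\<rho>. v x * cnj (f x)) = (LINT x|\<rho>. v' x * cnj (f' x))" "(LINT x|\<rho>. u x * cnj (g x))
    = (LINT x|\<rho>. u' x * cnj (g' x))"
    by (intro L2_integral_cong f u L)+
  moreover have "bform (\<Gamma> f') (\<Gamma> u') = 0 \<longleftrightarrow> bform (\<Gamma> u') (\<Gamma> f') = 0" using bform_swap[of "\<Gamma> f'" "\<Gamma> u'"]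
    by simp
  ultimately show ?thesis using lagrange_bform[OF u(1) f(1)] by auto
qed

lemma selfadjoint_imp_boundary_conditions:
  assumes sub: "aecl \<rho> S \<subseteq> aecl \<rho> T" and sa: "aecl \<rho> S = adj \<rho> (aecl \<rho> S)"
  shows "\<exists>L. (\<forall>y. y \<in> L \<longleftrightarrow> (\<forall>z\<in>L. bform y z = 0)) \<and> aecl \<rho> S = aecl \<rho> {(f, g) \<in> T. \<Gamma> f \<in> L}"
proof -
  let ?A = "aecl \<rho> S"
  \<comment> \<open>All boundary vectors of all representatives in \<open>T\<close> of the
    relation.\<close>
  define L where "L = {\<Gamma> f |f g. (f, g) \<in> T \<and> (f, g) \<in> ?A}"
  have rep: "\<exists>u' v'. (u', v') \<in> T \<and> (u', v') \<in> ?A \<and> (AE x in \<rho>. u x = u' x) \<and> (AE x in \<rho>. v x = v' x)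
    \<and> L2 \<rho> u \<and> L2 \<rho> v"
    if uv: "(u, v) \<in> ?A" for u v
  proof -
    have "(u, v) \<in> aecl \<rho> T" using uv sub by blast
    then obtain u' v' where r: "(u', v') \<in> T" "AE x in \<rho>. u x = u' x" "AE x in \<rho>. v x
      = v' x" "L2 \<rho> u" "L2 \<rho> v" by (rule aeclE)
    have "AE x in \<rho>. u' x = u x \<and> v' x = v x" using r(2,3) by eventually_elim simp
    hence "(u', v') \<in> ?A" using r(1) by (intro aecl_AE_closed[OF uv]) (auto simp: Tmax_iff)
    thus ?thesis using r by blast
  qed
  \<comment> \<open>By self-adjointness, membership is membership in the adjoint, which Lagrange
    turns into a condition on the boundary vector alone. Surjectivity of \<Gamma> then makes it a
    statement about all of \<open>complex^4\<close>.\<close>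
  have char: "(f, g) \<in> ?A \<longleftrightarrow> (\<forall>z\<in>L. bform (\<Gamma> f) z = 0)" if fg: "(f, g) \<in> T" for f g
  proof
    assume A: "(f, g) \<in> ?A"
    show "\<forall>z\<in>L. bform (\<Gamma> f) z = 0"
    proof
      fix z assume "z \<in> L"
      then obtain u v where uv: "z = \<Gamma> u" "(u, v) \<in> T" "(u, v) \<in> ?A" unfolding L_def by blast
      have "(LINT x|\<rho>. v x * cnj (f x)) = (LINT x|\<rho>. u x * cnj (g x))"
        using A uv(3) sa unfolding adj_def by blast
      thus "bform (\<Gamma> f) z = 0"
        using adjoint_pairing[OF fg _ _ _ _ uv(2), of f g u v] fg uv by (simp add: Tmax_iff)
    qed
  next
    assume z: "\<forall>z\<in>L. bform (\<Gamma> f) z = 0"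
    have Lf: "L2 \<rho> f" "L2 \<rho> g" using fg by (auto simp: Tmax_iff)
    have "(LINT x|\<rho>. v x * cnj (f x)) = (LINT x|\<rho>. u x * cnj (g x))" if uv: "(u, v) \<in> ?A" for u v
    proof -
      obtain u' v' where r: "(u', v') \<in> T" "(u', v') \<in> ?A" "AE x in \<rho>. u x = u' x" "AE x in \<rho>. v x
        = v' x" "L2 \<rho> u" "L2 \<rho> v"
        using rep[OF uv] by blast
      have "\<Gamma> u' \<in> L" using r unfolding L_def by blast
      hence "bform (\<Gamma> f) (\<Gamma> u') = 0" using z by blast
      thus ?thesis using adjoint_pairing[OF fg _ _ Lf r(1,3,4,5,6)] by simp
    qed
    hence "(f, g) \<in> adj \<rho> ?A" using Lf unfolding adj_def by blast
    thus "(f, g) \<in> ?A" using sa by simp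
  qed
  have Lag: "y \<in> L \<longleftrightarrow> (\<forall>z\<in>L. bform y z = 0)" for y
  proof
    assume "y \<in> L"
    then obtain f g where "y = \<Gamma> f" "(f, g) \<in> T" "(f, g) \<in> ?A" unfolding L_def by blast
    thus "\<forall>z\<in>L. bform y z = 0" using char by blast
  next
    assume z: "\<forall>z\<in>L. bform y z = 0"
    obtain f g where f: "(f, g) \<in> T" "\<Gamma> f = y" using \<Gamma>_surj by blast
    hence "(f, g) \<in> ?A" using char[OF f(1)] z by simp
    thus "y \<in> L" using f unfolding L_def by blast
  qed
  have "?A = aecl \<rho> {(f, g) \<in> T. \<Gamma> f \<in> L}"
  proof (intro set_eqI iffI; clarify)
    fix f g assume A: "(f, g) \<in> ?A"
    obtain u v where r: "(u, v) \<in> T" "(u, v) \<in> ?A" "AE x in \<rho>. f x = u x" "AE x in \<rho>. g x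
      = v x" "L2 \<rho> f" "L2 \<rho> g"
      using rep[OF A] by blast
    have "\<Gamma> u \<in> L" using r unfolding L_def by blast
    moreover have "AE x in \<rho>. f x = u x \<and> g x = v x" using r(3,4) by eventually_elim simp
    ultimately show "(f, g) \<in> aecl \<rho> {(f, g) \<in> T. \<Gamma> f \<in> L}" using r unfolding aecl_def by blast
  next
    fix f g assume "(f, g) \<in> aecl \<rho> {(f, g) \<in> T. \<Gamma> f \<in> L}"
    then obtain u v where r: "(u, v) \<in> {(f, g) \<in> T. \<Gamma> f \<in> L}" "AE x in \<rho>. f x = u x" "AE x in \<rho>. g x
      = v x" "L2 \<rho> f" "L2 \<rho> g" by (rule aeclE)
    hence "(u, v) \<in> ?A" using char Lag by blast
    moreover have "AE x in \<rho>. f x = u x \<and> g x = v x" using r(2,3) by eventually_elim simp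
    ultimately show "(f, g) \<in> ?A" using r(4,5) aecl_AE_closed by blast
  qed
  thus ?thesis using Lag by blast
qed

lemma boundary_conditions_imp_selfadjoint:
  assumes Lag: "\<And>y. y \<in> L \<longleftrightarrow> (\<forall>z\<in>L. bform y z = 0)"
  defines "A \<equiv> aecl \<rho> {(f, g) \<in> T. \<Gamma> f \<in> L}"
  shows "A \<subseteq> aecl \<rho> T" "A = adj \<rho> A"
proof -
  show "A \<subseteq> aecl \<rho> T" unfolding A_def by (rule aecl_mono) blast
  have inA: "(u, v) \<in> A" if "(u, v) \<in> T" "\<Gamma> u \<in> L" for u v
    unfolding A_def using that by (intro aecl_superset) (auto simp: Tmax_iff)
  show "A = adj \<rho> A"
  proof (intro set_eqI iffI; clarify)
    fix f g assume "(f, g) \<in> A"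
    then obtain f' g' where f: "(f', g') \<in> {(f, g) \<in> T. \<Gamma> f \<in> L}" "AE x in \<rho>. f x = f' x" "AE x in \<rho>. g x
      = g' x" "L2 \<rho> f" "L2 \<rho> g"
      unfolding A_def by (rule aeclE)
    have "(LINT x|\<rho>. v x * cnj (f x)) = (LINT x|\<rho>. u x * cnj (g x))" if "(u, v) \<in> A" for u v
    proof -
      obtain u' v' where u: "(u', v') \<in> {(f, g) \<in> T. \<Gamma> f \<in> L}" "AE x in \<rho>. u x = u' x" "AE x in \<rho>. v x
        = v' x" "L2 \<rho> u" "L2 \<rho> v"
        using \<open>(u, v) \<in> A\<close> unfolding A_def by (rule aeclE)
      have "bform (\<Gamma> f') (\<Gamma> u') = 0" using f(1) u(1) Lag[of "\<Gamma> f'"] by blast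
      thus ?thesis using adjoint_pairing[of f' g' f g u' v' u v] f u by blast
    qed
    thus "(f, g) \<in> adj \<rho> A" using f(4,5) unfolding adj_def by blast
  next
    fix f k assume fk: "(f, k) \<in> adj \<rho> A"
    hence L: "L2 \<rho> f" "L2 \<rho> k"
      and ad: "\<And>u v. (u, v) \<in> A \<Longrightarrow> (LINT x|\<rho>. v x * cnj (f x)) = (LINT x|\<rho>. u x * cnj (k x))"
      unfolding adj_def by blast+
    \<comment> \<open>Hence \<open>A\<close> contains every pair in \<open>T\<close> with vanishing
      boundary forms, so an element of its adjoint already comes from \<open>T\<close>.\<close>
    have 0: "0 \<in> L" unfolding Lag[of 0] by (simp add: bform_zero)
    have "\<exists>f'. (f', k) \<in> T \<and> (AE x in \<rho>. f x = f' x)"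
    proof (rule adjoint_kernel_sub_Tmax[OF L])
      fix u v assume uv: "(u, v) \<in> T" and z: "\<And>g. TD g \<Longrightarrow> Wa u g = 0 \<and> Wb u g = 0"
      have "TD u" using uv by (auto simp: TD_def)
      hence "\<Gamma> u \<in> L" using \<Gamma>_zero[OF _ z] 0 by simp
      thus "(LINT x|\<rho>. v x * cnj (f x)) = (LINT x|\<rho>. u x * cnj (k x))" by (intro ad inA[OF uv])
    qed
    then obtain f' where f': "(f', k) \<in> T" "AE x in \<rho>. f x = f' x" by blast
    \<comment> \<open>Surjectivity of \<Gamma> realises every vector of \<open>L\<close> by an
      element of \<open>A\<close>, so the adjoint relation tests \<open>\<Gamma> f'\<close> against
      the whole of \<open>L\<close>.\<close>
    have "\<Gamma> f' \<in> L" unfolding Lag[of "\<Gamma> f'"]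
    proof
      fix z assume z: "z \<in> L"
      obtain u v where u: "(u, v) \<in> T" "\<Gamma> u = z" using \<Gamma>_surj by blast
      have "(LINT x|\<rho>. v x * cnj (f x)) = (LINT x|\<rho>. u x * cnj (k x))" using u z by (intro ad inA) auto
      thus "bform (\<Gamma> f') z = 0" using adjoint_pairing[OF f' _ L u(1), where u=u and v=v] u by
        (simp add: Tmax_iff)
    qed
    hence A: "(f', k) \<in> A" using inA f' by blast
    have "AE x in \<rho>. f x = f' x \<and> k x = k x" using f'(2) by simp
    thus "(f, k) \<in> A" unfolding A_def by (rule aecl_AE_closed[OF A[unfolded A_def] L])
  qed
qed

lemma selfadjoint_restriction_iff:
  "(aecl \<rho> S \<subseteq> aecl \<rho> T \<and> aecl \<rho> S = adj \<rho> (aecl \<rho> S)) \<longleftrightarrow>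
    (\<exists>Ba Bb :: complex^2^2.
       rank (block Ba Bb) = 2 \<and> Ba ** Jmat ** cadj Ba = Bb ** Jmat ** cadj Bb \<and>
       aecl \<rho> S = aecl \<rho> {(f, g) \<in> T. Ba *v vector [Wa f (cnjf w2), Wa (cnjf w1) f]
        = Bb *v vector [Wb f (cnjf w2), Wb (cnjf w1) f]})" (is "?sa \<longleftrightarrow> ?bc")
proof
  assume sa: ?sa
  from selfadjoint_imp_boundary_conditions[OF conjunct1[OF sa] conjunct2[OF sa]]
  obtain L where L': "\<forall>y. y \<in> L \<longleftrightarrow> (\<forall>z\<in>L. bform y z = 0)" and S: "aecl \<rho> S = aecl \<rho> {(f, g) \<in> T. \<Gamma> f \<in> L}"
    by (elim exE conjE)
  have L: "y \<in> L \<longleftrightarrow> (\<forall>z\<in>L. bform y z = 0)" for y using L' by (rule spec)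
  obtain Ba Bb where B: "rank (block Ba Bb) = 2" "Ba ** Jmat ** cadj Ba = Bb ** Jmat ** cadj Bb"
    and e: "L = {y. Ba *v vector [y$1, y$2] = Bb *v vector [y$3, y$4]}"
    using matrices_of_lagrangian[OF L] by blast
  show ?bc by (rule exI[of _ Ba], rule exI[of _ Bb], intro conjI B)
    (use S in \<open>simp only: e mem_Collect_eq \<Gamma>_nth\<close>)
next
  assume ?bc
  then obtain Ba Bb :: "complex^2^2" where B: "rank (block Ba Bb) = 2" "Ba ** Jmat ** cadj Ba
    = Bb ** Jmat ** cadj Bb"
    and S: "aecl \<rho> S = aecl \<rho> {(f, g) \<in> T. Ba *v vector [Wa f (cnjf w2), Wa (cnjf w1) f]
        = Bb *v vector [Wb f (cnjf w2), Wb (cnjf w1) f]}" by blast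
  define L where "L = {y :: complex^4. Ba *v vector [y$1, y$2] = Bb *v vector [y$3, y$4]}"
  have Lag: "y \<in> L \<longleftrightarrow> (\<forall>z\<in>L. bform y z = 0)" for y unfolding L_def by (rule lagrangian_of_matrices[OF B])
  have S': "aecl \<rho> S = aecl \<rho> {(f, g) \<in> T. \<Gamma> f \<in> L}" unfolding S L_def mem_Collect_eq \<Gamma>_nth ..
  show ?sa unfolding S' by (intro conjI boundary_conditions_imp_selfadjoint Lag)
qed

end

theorem theorem7p5:
  fixes a b :: ereal and \<rho> :: "real measure" and \<sigma> \<kappa> :: "real measure \<times> real measure"
    and w1 w2 :: "real \<Rightarrow> complex"
    and S :: "((real \<Rightarrow> complex) \<times> (real \<Rightarrow> complex)) set"
  assumes ab: "a < b"
    and rho: "lf_measure_on a b \<rho>"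
    and sig: "signed_on a b \<sigma>"
    and chi: "signed_on a b \<kappa>"
    and rho_pts: "\<exists>x\<in>ssupp a b (pos \<rho>). \<exists>y\<in>ssupp a b (pos \<rho>). x \<noteq> y"
    and sig_supp: "ssupp a b \<sigma> = I_ab a b"
    and pts_rho: "\<forall>x\<in>I_ab a b. smeas_pt \<sigma> x * measure \<rho> {x} = 0"
    and pts_chi: "\<forall>x\<in>I_ab a b. smeas_pt \<sigma> x * smeas_pt \<kappa> x = 0"
    and gaps: "\<forall>\<alpha> \<beta>. \<alpha> \<in> ssupp a b (pos \<rho>) \<and> \<beta> \<in> ssupp a b (pos \<rho>) \<and> \<alpha> < \<beta> \<and>
                  {\<alpha><..<\<beta>} \<inter> ssupp a b (pos \<rho>) = {} \<longrightarrow>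
               (\<forall>f. Dtau a b \<rho> \<sigma> \<kappa> f \<and> (f \<longlongrightarrow> 0) (at_left \<alpha>) \<and> (f \<longlongrightarrow> 0) (at_right \<beta>)
                  \<longrightarrow> (\<forall>x\<in>{\<alpha><..<\<beta>}. f x = 0))"
    and LCa: "LC_left a b \<rho> \<sigma> \<kappa>"
    and LCb: "LC_right a b \<rho> \<sigma> \<kappa>"
    and w1: "\<exists>g. (w1, g) \<in> Tmax a b \<rho> \<sigma> \<kappa>"
    and w2: "\<exists>g. (w2, g) \<in> Tmax a b \<rho> \<sigma> \<kappa>"
    and wa: "W_a a b \<rho> \<sigma> \<kappa> w1 (cnjf w2) = 1" "W_a a b \<rho> \<sigma> \<kappa> w1 (cnjf w1) = 0"
            "W_a a b \<rho> \<sigma> \<kappa> w2 (cnjf w2) = 0"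
    and wb: "W_b a b \<rho> \<sigma> \<kappa> w1 (cnjf w2) = 1" "W_b a b \<rho> \<sigma> \<kappa> w1 (cnjf w1) = 0"
            "W_b a b \<rho> \<sigma> \<kappa> w2 (cnjf w2) = 0"
    and S_L2: "\<forall>(f, g)\<in>S. L2 \<rho> f \<and> L2 \<rho> g"
  shows "(aecl \<rho> S \<subseteq> aecl \<rho> (Tmax a b \<rho> \<sigma> \<kappa>) \<and> aecl \<rho> S = adj \<rho> (aecl \<rho> S)) \<longleftrightarrow>
    (\<exists>Ba Bb :: complex^2^2.
       rank (block Ba Bb) = 2 \<and> Ba ** Jmat ** cadj Ba = Bb ** Jmat ** cadj Bb \<and>
       aecl \<rho> S = aecl \<rho> {(f, g) \<in> Tmax a b \<rho> \<sigma> \<kappa>.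
          Ba *v vector [W_a a b \<rho> \<sigma> \<kappa> f (cnjf w2), W_a a b \<rho> \<sigma> \<kappa> (cnjf w1) f]
        = Bb *v vector [W_b a b \<rho> \<sigma> \<kappa> f (cnjf w2), W_b a b \<rho> \<sigma> \<kappa> (cnjf w1) f]})"
proof -
  interpret boundary_functionals a b \<rho> \<sigma> \<kappa> w1 w2
    by unfold_locales fact+
  show ?thesis by (rule selfadjoint_restriction_iff)
qed

end
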